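(* Let $r\geqslant 3$ be an integer and let $G$ be the Brady–Bridson snowflake group $$G=BB(1,r)=\langle a,b,s,t\mid aba^{-1}b^{-1}=1,\ s^{-1}as=a^rb,\ t^{-1}at=a^rb^{-1}\rangle .$$ Then $G$ admits a cocompact growth tight action, i.e. there exists a $G$-space $\mathcal{X}$ on which $G$ acts cocompactly such that $G\curvearrowright\mathcal{X}$ is a growth tight action.
   Context: A $G$-space is a proper, geodesic metric space $(\mathcal{X},d)$ with a properly discontinuous, isometric action of $G$. Growth: fix $o\in\mathcal{X}$ and let $\delta_G:=\limsup_{r\to\infty}\frac1r\log\#\{g\in G\mid d(o,g.o)\leqslant r\}$. For a normal subgroup $\Gamma$, let $\bar d(g\Gamma,g'\Gamma):=\inf_{\gamma,\gamma'\in\Gamma}d(g\gamma.o,g'\gamma'.o)$ and $\delta_{G/\Gamma}:=\limsup_{r\to\infty}\frac1r\log\#\{g\Gamma\in G/\Gamma\mid \bar d(\Gamma,g\Gamma)\leqslant r\}$. The action is growth tight if $\delta_G>\delta_{G/\Gamma}$ for every infinite normal subgroup $\Gamma$ of $G$. *)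

theory Defs
  imports "HOL-Analysis.Analysis" "HOL-Algebra.Group_Action"
begin

section \<open>Groups given by generators and relations\<close>

text \<open>The letter \<open>(x, True)\<close> stands for the generator \<open>x\<close>, the letter \<open>(x, False)\<close> for its
  formal inverse. All elements of the type \<open>'a\<close> are generators.\<close>

type_synonym 'a word = "('a \<times> bool) list"

text \<open>A relation \<open>u = v\<close> of a presentation is the pair \<open>(u, v)\<close>.\<close>

inductive word_eq :: "('a word \<times> 'a word) set \<Rightarrow> 'a word \<Rightarrow> 'a word \<Rightarrow> bool"
  for R :: "('a word \<times> 'a word) set" where
  refl: "word_eq R u u"
| sym: "word_eq R u v \<Longrightarrow> word_eq R v u"
| trans: "word_eq R u v \<Longrightarrow> word_eq R v w \<Longrightarrow> word_eq R u w"
| cancel: "word_eq R (u @ [(x, e), (x, \<not> e)] @ v) (u @ v)"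
| relation: "(l, l') \<in> R \<Longrightarrow> word_eq R (u @ l @ v) (u @ l' @ v)"

definition word_class :: "('a word \<times> 'a word) set \<Rightarrow> 'a word \<Rightarrow> 'a word set" where
  "word_class R u = {v. word_eq R u v}"

definition presented_group :: "('a word \<times> 'a word) set \<Rightarrow> 'a word set monoid" where
  "presented_group R =
    \<lparr>carrier = range (word_class R),
     mult = (\<lambda>P Q. {w. \<exists>u\<in>P. \<exists>v\<in>Q. word_eq R (u @ v) w}),
     one = word_class R []\<rparr>"

lemma word_class_eq_iff: "word_class R u = word_class R v \<longleftrightarrow> word_eq R u v"
  unfolding word_class_def by (auto intro: word_eq.intros)

lemma word_eq_append_left:
  assumes "word_eq R u v"
  shows "word_eq R (p @ u) (p @ v)"
  using assms
proof induction
  case (cancel u x e v)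
  then show ?case using word_eq.cancel[of R "p @ u" x e v] by simp
next
  case (relation l l' u v)
  then show ?case using word_eq.relation[of l l' R "p @ u" v] by simp
qed (auto intro: word_eq.intros)

lemma word_eq_append_right:
  assumes "word_eq R u v"
  shows "word_eq R (u @ p) (v @ p)"
  using assms
proof induction
  case (cancel u x e v)
  then show ?case using word_eq.cancel[of R u x e "v @ p"] by simp
next
  case (relation l l' u v)
  then show ?case using word_eq.relation[of l l' R u "v @ p"] by simp
qed (auto intro: word_eq.intros)

lemma word_eq_append:
  "word_eq R u u' \<Longrightarrow> word_eq R v v' \<Longrightarrow> word_eq R (u @ v) (u' @ v')"
  by (meson word_eq.trans word_eq_append_left word_eq_append_right)

lemma carrier_presented_group: "carrier (presented_group R) = range (word_class R)"
  by (simp add: presented_group_def)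

lemma one_presented_group: "\<one>\<^bsub>presented_group R\<^esub> = word_class R []"
  by (simp add: presented_group_def)

lemma mult_presented_group:
  "word_class R u \<otimes>\<^bsub>presented_group R\<^esub> word_class R v = word_class R (u @ v)"
  by (auto simp: presented_group_def word_class_def intro: word_eq.refl word_eq.trans word_eq_append)

definition inverse_word :: "'a word \<Rightarrow> 'a word" where
  "inverse_word u = rev (map (\<lambda>(x, e). (x, \<not> e)) u)"

lemma word_eq_inverse_left: "word_eq R (inverse_word u @ u) []"
proof (induction u)
  case Nil
  then show ?case by (simp add: inverse_word_def word_eq.refl)
next
  case (Cons a u)
  obtain x e where a: "a = (x, e)" by fastforce
  have "word_eq R (inverse_word u @ [(x, \<not> e), (x, \<not> \<not> e)] @ u) (inverse_word u @ u)"
    by (rule word_eq.cancel)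
  then show ?case
    using Cons word_eq.trans by (fastforce simp: inverse_word_def a)
qed

lemma group_presented_group: "group (presented_group R)"
proof (rule groupI)
  fix P
  assume "P \<in> carrier (presented_group R)"
  then obtain u where "P = word_class R u" by (auto simp: carrier_presented_group)
  then have "word_class R (inverse_word u) \<otimes>\<^bsub>presented_group R\<^esub> P = \<one>\<^bsub>presented_group R\<^esub>"
    by (simp add: mult_presented_group one_presented_group word_class_eq_iff word_eq_inverse_left)
  then show "\<exists>Q\<in>carrier (presented_group R). Q \<otimes>\<^bsub>presented_group R\<^esub> P = \<one>\<^bsub>presented_group R\<^esub>"
    by (auto simp: carrier_presented_group)
qed (auto simp: carrier_presented_group mult_presented_group one_presented_group)


section \<open>The snowflake groups \<open>BB(1,r)\<close>\<close>

datatype bb_gen = GenA | GenB | GenS | GenT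

definition snowflake_relations :: "nat \<Rightarrow> (bb_gen word \<times> bb_gen word) set" where
  "snowflake_relations r =
    {([(GenA, True), (GenB, True), (GenA, False), (GenB, False)], []),
     ([(GenS, False), (GenA, True), (GenS, True)], replicate r (GenA, True) @ [(GenB, True)]),
     ([(GenT, False), (GenA, True), (GenT, True)], replicate r (GenA, True) @ [(GenB, False)])}"

definition snowflake_group :: "nat \<Rightarrow> bb_gen word set monoid" where
  "snowflake_group r = presented_group (snowflake_relations r)"


section \<open>\<open>G\<close>-spaces\<close>

text \<open>Metric spaces are carrier-based here. A proper metric space is separable and so has at most
  the cardinality of the continuum. Hence it is isometric to one whose underlying set is a set of
  reals, with a metric unrelated to the usual one: an existence claim for \<open>G\<close>-spaces may be stated
  with the point type \<open>real\<close> without loss of generality.\<close>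

locale proper_metric_space = Metric_space +
  assumes compactin_mcball: "x \<in> M \<Longrightarrow> compactin mtopology (mcball x \<rho>)"

locale geodesic_metric_space = Metric_space +
  assumes geodesic:
    "\<lbrakk>x \<in> M; y \<in> M\<rbrakk> \<Longrightarrow>
      \<exists>\<gamma> :: real \<Rightarrow> 'a.
        \<gamma> ` {0..d x y} \<subseteq> M \<and> \<gamma> 0 = x \<and> \<gamma> (d x y) = y \<and>
        (\<forall>s\<in>{0..d x y}. \<forall>t\<in>{0..d x y}. d (\<gamma> s) (\<gamma> t) = \<bar>s - t\<bar>)"

locale G_space =
  proper_metric_space X d + geodesic_metric_space X d + group_action G X \<phi>
  for G :: "('g, 'm) monoid_scheme" (structure)
    and X :: "'x set" and d :: "'x \<Rightarrow> 'x \<Rightarrow> real" and \<phi> :: "'g \<Rightarrow> 'x \<Rightarrow> 'x" +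
  assumes nonempty: "X \<noteq> {}"
    and isometric: "\<lbrakk>g \<in> carrier G; x \<in> X; y \<in> X\<rbrakk> \<Longrightarrow> d (\<phi> g x) (\<phi> g y) = d x y"
    and properly_discontinuous:
      "compactin mtopology K \<Longrightarrow> finite {g \<in> carrier G. \<phi> g ` K \<inter> K \<noteq> {}}"

definition cocompact_action ::
    "('g, 'm) monoid_scheme \<Rightarrow> 'x set \<Rightarrow> ('x \<Rightarrow> 'x \<Rightarrow> real) \<Rightarrow> ('g \<Rightarrow> 'x \<Rightarrow> 'x) \<Rightarrow> bool" where
  "cocompact_action G X d \<phi> \<longleftrightarrow>
    (\<exists>K. compactin (Metric_space.mtopology X d) K \<and> (\<Union>g\<in>carrier G. \<phi> g ` K) = X)"


section \<open>Growth tightness\<close>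

text \<open>The counted sets below are finite in every \<open>G_space\<close>, because closed balls are compact
  and the action is properly discontinuous, and they are nonempty for nonnegative radii; so the
  conventions for \<open>card\<close> of an infinite set and for \<open>ln 0\<close> play no role.\<close>

definition growth_exponent ::
    "('g, 'm) monoid_scheme \<Rightarrow> ('x \<Rightarrow> 'x \<Rightarrow> real) \<Rightarrow> ('g \<Rightarrow> 'x \<Rightarrow> 'x) \<Rightarrow> 'x \<Rightarrow> ereal" where
  "growth_exponent G d \<phi> p =
    Limsup at_top (\<lambda>\<rho>::real. ereal (1 / \<rho> * ln (card {g \<in> carrier G. d p (\<phi> g p) \<le> \<rho>})))"

definition coset_dist ::
    "('x \<Rightarrow> 'x \<Rightarrow> real) \<Rightarrow> ('g \<Rightarrow> 'x \<Rightarrow> 'x) \<Rightarrow> 'x \<Rightarrow> 'g set \<Rightarrow> 'g set \<Rightarrow> real" where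
  "coset_dist d \<phi> p C C' = (INF (g, g') \<in> C \<times> C'. d (\<phi> g p) (\<phi> g' p))"

text \<open>The elements of \<open>G Mod N\<close> are formally right cosets, which coincide with the left cosets as
  \<open>N\<close> is normal.\<close>

definition quotient_growth_exponent ::
    "('g, 'm) monoid_scheme \<Rightarrow> 'g set \<Rightarrow> ('x \<Rightarrow> 'x \<Rightarrow> real) \<Rightarrow> ('g \<Rightarrow> 'x \<Rightarrow> 'x) \<Rightarrow> 'x \<Rightarrow> ereal" where
  "quotient_growth_exponent G N d \<phi> p =
    Limsup at_top
      (\<lambda>\<rho>::real. ereal (1 / \<rho> * ln (card {C \<in> carrier (G Mod N). coset_dist d \<phi> p N C \<le> \<rho>})))"

text \<open>Neither exponent depends on the base point \<open>p\<close>.\<close>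

definition growth_tight_action ::
    "('g, 'm) monoid_scheme \<Rightarrow> 'x set \<Rightarrow> ('x \<Rightarrow> 'x \<Rightarrow> real) \<Rightarrow> ('g \<Rightarrow> 'x \<Rightarrow> 'x) \<Rightarrow> bool" where
  "growth_tight_action G X d \<phi> \<longleftrightarrow>
    (\<forall>p\<in>X. \<forall>N. N \<lhd> G \<and> infinite N \<longrightarrow>
      quotient_growth_exponent G N d \<phi> p < growth_exponent G d \<phi> p)"

end

theory Submission
  imports Defs
begin

text \<open>Put \<open>e\<^sub>1 = a\<^sup>rb = s\<^sup>-\<^sup>1as\<close>, \<open>e\<^sub>2 = a\<^sup>rb\<^sup>-\<^sup>1 = t\<^sup>-\<^sup>1at\<close> and \<open>V = \<langle>a, b\<rangle>\<close>, a free abelian group of rank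
  two. The snowflake group \<open>G\<close> is a double HNN extension of \<open>V\<close> and acts on the associated
  Bass-Serre tree. The space is the Cayley graph of \<open>G\<close> for the generators \<open>a\<close>, \<open>s\<close>, \<open>t\<close>; the
  letter \<open>b = a\<^sup>-\<^sup>rs\<^sup>-\<^sup>1as\<close> is left out on purpose. For this word length \<open>|\<cdot>|\<close> the lines
  \<open>\<langle>e\<^sub>1\<rangle>\<close> and \<open>\<langle>e\<^sub>2\<rangle>\<close> of \<open>V\<close> are perpendicular in the strongest sense:
  \<open>|e\<^sub>1\<^sup>me\<^sub>2\<^sup>n| = |e\<^sub>1\<^sup>m| + |e\<^sub>2\<^sup>n|\<close> (lemma \<open>len_transverse\<close>). The only competition comes from the
  relation \<open>e\<^sub>1e\<^sub>2 = a\<^sup>2\<^sup>r\<close>, and for \<open>r \<ge> 3\<close> the \<open>2r\<close> letters \<open>a\<close> that it costs are never repaid.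

  A path that enters a translate of \<open>V\<close> across a line in direction \<open>e\<^sub>1\<close> and leaves it across a
  line in direction \<open>e\<^sub>2\<close> can therefore be led through the point where the two lines meet, at no
  cost. Hence \<open>|xy| = |x| + |y|\<close> whenever the tree path to \<open>x\<close> ends with an edge labelled \<open>s\<close> and
  the one to \<open>y\<close> begins with an edge labelled \<open>t\<^sup>-\<^sup>1\<close> (lemma \<open>cut_mult\<close>). The elements that begin
  with \<open>t\<^sup>-\<^sup>1\<close> and end with \<open>s\<close> form a monoid \<open>M\<close> on which the length is additive and in which
  two factorisations of the same element are comparable (lemma \<open>cut_levi\<close>), so that \<open>M\<close> behaves
  like a free monoid. Every element of \<open>G\<close> is in \<open>M\<close> after multiplication on both sides by
  elements of length at most two, and every nontrivial normal subgroup \<open>N\<close> meets \<open>M\<close> nontrivially.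

  These properties yield growth tightness (theorem \<open>growth_gap\<close>). Choose a long \<open>W \<in> M \<inter> N\<close>. A
  shortest representative of a coset of \<open>N\<close>, moved into \<open>M\<close>, cannot contain \<open>W\<close> as a factor,
  because deleting \<open>W\<close> would give a much shorter representative. So \<open>W\<close> can serve as a separator:
  if the lengths of such representatives \<open>c\<^sub>i\<close> are confined to one residue class modulo \<open>|W| + 1\<close>,
  then the elements \<open>c\<^sub>1Wc\<^sub>2W\<dots>c\<^sub>kW\<close> are distinct. The numbers of cosets
  are submultiplicative in the radius, hence their Poincare series diverges at its exponent
  \<open>\<delta>\<close> if \<open>\<delta> > 0\<close>; so a finite set of words \<open>cW\<close> has weight larger than 1 at \<open>\<delta>\<close>, still at least 1 at
  some \<open>\<delta>' > \<delta>\<close>, and the products of these words force \<open>G\<close> to grow at least with exponent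
  \<open>\<delta>'\<close>. For \<open>\<delta> = 0\<close> it is enough that \<open>G\<close> grows exponentially.

  The tree enters only through the function that assigns to \<open>g\<close> the first edge on the path from
  \<open>V\<close> to \<open>gV\<close>. It is read off from the normal form of \<open>g\<close>, which a stack machine computes
  letter by letter; that the machine respects the relations also shows that \<open>V\<close> embeds in \<open>G\<close>.\<close>

section \<open>Word length in a finitely generated group\<close>

lemma (in group) inv_cancel_left:
  "\<lbrakk>x \<in> carrier G; y \<in> carrier G\<rbrakk> \<Longrightarrow> inv x \<otimes> (x \<otimes> y) = y"
  "\<lbrakk>x \<in> carrier G; y \<in> carrier G\<rbrakk> \<Longrightarrow> x \<otimes> (inv x \<otimes> y) = y"
  by (simp_all flip: m_assoc)

lemma (in group) foldr_mult_closed: "set ws \<subseteq> carrier G \<Longrightarrow> foldr (\<otimes>) ws \<one> \<in> carrier G"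
  by (induction ws) auto

lemma (in group) foldr_mult_append:
  "set ws \<subseteq> carrier G \<Longrightarrow> set vs \<subseteq> carrier G \<Longrightarrow>
    foldr (\<otimes>) (ws @ vs) \<one> = foldr (\<otimes>) ws \<one> \<otimes> foldr (\<otimes>) vs \<one>"
  by (induction ws) (auto simp: foldr_mult_closed m_assoc simp del: foldr_append)

text \<open>The generating set is closed under inverses, so that words are plain lists of generators.\<close>

locale word_length = group G for G (structure) +
  fixes S :: "'a set"
  assumes finite_gens: "finite S"
    and gens_closed: "S \<subseteq> carrier G"
    and one_not_gen: "\<one> \<notin> S"
    and inv_gen: "\<sigma> \<in> S \<Longrightarrow> inv \<sigma> \<in> S"
    and generating: "g \<in> carrier G \<Longrightarrow> \<exists>ws. set ws \<subseteq> S \<and> foldr (\<otimes>) ws \<one> = g"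
begin

abbreviation lprod :: "'a list \<Rightarrow> 'a" where "lprod ws \<equiv> foldr (\<otimes>) ws \<one>"

definition len :: "'a \<Rightarrow> nat" where
  "len g = (LEAST n. \<exists>ws. set ws \<subseteq> S \<and> lprod ws = g \<and> length ws = n)"

lemma gen_closed: "\<sigma> \<in> S \<Longrightarrow> \<sigma> \<in> carrier G"
  using gens_closed by blast

lemma lprod_closed: "set ws \<subseteq> S \<Longrightarrow> lprod ws \<in> carrier G"
  using foldr_mult_closed gens_closed by blast

lemma lprod_append:
  "set ws \<subseteq> S \<Longrightarrow> set vs \<subseteq> S \<Longrightarrow> lprod (ws @ vs) = lprod ws \<otimes> lprod vs"
  by (rule foldr_mult_append) (use gens_closed in auto)

lemma len_le: "set ws \<subseteq> S \<Longrightarrow> len (lprod ws) \<le> length ws"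
  unfolding len_def by (rule Least_le) blast

lemma geodesic_word:
  assumes "g \<in> carrier G"
  obtains ws where "set ws \<subseteq> S" "lprod ws = g" "length ws = len g"
proof -
  have "\<exists>n ws. set ws \<subseteq> S \<and> lprod ws = g \<and> length ws = n"
    using generating[OF assms] by blast
  then have "\<exists>ws. set ws \<subseteq> S \<and> lprod ws = g \<and> length ws = len g"
    unfolding len_def by (rule LeastI_ex)
  then show ?thesis using that by blast
qed

lemma len_one [simp]: "len \<one> = 0"
  using len_le[of "[]"] by simp

lemma len_eq_0_iff: "g \<in> carrier G \<Longrightarrow> len g = 0 \<longleftrightarrow> g = \<one>"
  by (metis geodesic_word foldr.simps(1) id_apply len_one length_0_conv)

lemma len_mult:
  assumes "g \<in> carrier G" "h \<in> carrier G"
  shows "len (g \<otimes> h) \<le> len g + len h"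
proof -
  obtain ws where "set ws \<subseteq> S" "lprod ws = g" "length ws = len g"
    using geodesic_word[OF assms(1)] .
  moreover obtain vs where "set vs \<subseteq> S" "lprod vs = h" "length vs = len h"
    using geodesic_word[OF assms(2)] .
  ultimately show ?thesis
    using len_le[of "ws @ vs"] lprod_append[of ws vs] by simp
qed

lemma lprod_inverse:
  "set ws \<subseteq> S \<Longrightarrow> lprod (rev (map (\<lambda>\<sigma>. inv \<sigma>) ws)) = inv (lprod ws)"
proof (induction ws)
  case (Cons \<sigma> ws)
  have "set (rev (map (\<lambda>\<sigma>. inv \<sigma>) ws)) \<subseteq> S" "set [inv \<sigma>] \<subseteq> S"
    using Cons.prems inv_gen by auto
  from lprod_append[OF this] show ?case
    using Cons by (simp add: gen_closed lprod_closed inv_mult_group)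
qed simp

lemma len_inv [simp]:
  assumes "g \<in> carrier G"
  shows "len (inv g) = len g"
proof -
  have le: "len (inv g) \<le> len g" if "g \<in> carrier G" for g
  proof -
    obtain ws where ws: "set ws \<subseteq> S" "lprod ws = g" "length ws = len g"
      using geodesic_word[OF \<open>g \<in> carrier G\<close>] .
    then have "set (rev (map (\<lambda>\<sigma>. inv \<sigma>) ws)) \<subseteq> S" using inv_gen by auto
    from len_le[OF this] show ?thesis
      using ws lprod_inverse[OF ws(1)] by simp
  qed
  from le[of g] le[of "inv g"] show ?thesis using assms by simp
qed

lemma len_gen:
  assumes "\<sigma> \<in> S"
  shows "len \<sigma> = 1"
proof -
  have "len \<sigma> \<le> 1" using len_le[of "[\<sigma>]"] assms by (simp add: gen_closed)
  moreover have "len \<sigma> \<noteq> 0" using len_eq_0_iff[of \<sigma>] assms one_not_gen gen_closed by auto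
  ultimately show ?thesis by simp
qed

lemma len_split:
  assumes g: "g \<in> carrier G" and m: "m \<le> len g"
  obtains g1 g2 where "g1 \<in> carrier G" "g2 \<in> carrier G" "g = g1 \<otimes> g2"
    "len g1 = m" "len g2 = len g - m"
proof -
  obtain ws where ws: "set ws \<subseteq> S" "lprod ws = g" "length ws = len g"
    using geodesic_word[OF g] .
  have t: "set (take m ws) \<subseteq> S" and d: "set (drop m ws) \<subseteq> S"
    using ws(1) set_take_subset set_drop_subset by fast+
  have eq: "g = lprod (take m ws) \<otimes> lprod (drop m ws)"
    using lprod_append[OF t d] ws(2) by simp
  moreover have "len (lprod (take m ws)) \<le> m" "len (lprod (drop m ws)) \<le> len g - m"
    using len_le[OF t] len_le[OF d] ws(3) m by auto
  moreover have "len g \<le> len (lprod (take m ws)) + len (lprod (drop m ws))"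
    using len_mult[OF lprod_closed[OF t] lprod_closed[OF d]] eq by simp
  ultimately show ?thesis
    using that[OF lprod_closed[OF t] lprod_closed[OF d] eq] m by linarith
qed

lemma len_Suc_split:
  assumes "g \<in> carrier G" "g \<noteq> \<one>"
  obtains \<sigma> h where "\<sigma> \<in> S" "h \<in> carrier G" "g = \<sigma> \<otimes> h" "len g = Suc (len h)"
proof -
  obtain ws where ws: "set ws \<subseteq> S" "lprod ws = g" "length ws = len g"
    using geodesic_word[OF assms(1)] .
  then obtain \<sigma> vs where vs: "ws = \<sigma> # vs" using assms(2) by (cases ws) auto
  have "len (lprod vs) \<le> length vs" using len_le ws(1) vs by auto
  moreover have "len g \<le> Suc (len (lprod vs))"
    using len_mult[of \<sigma> "lprod vs"] len_gen[of \<sigma>] ws vs lprod_closed gen_closed by auto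
  ultimately show ?thesis
    using that[of \<sigma> "lprod vs"] ws vs lprod_closed by auto
qed

lemma finite_ball: "finite {g \<in> carrier G. len g \<le> n}"
proof (rule finite_subset)
  show "{g \<in> carrier G. len g \<le> n} \<subseteq> lprod ` {ws. set ws \<subseteq> S \<and> length ws \<le> n}"
  proof
    fix g assume g: "g \<in> {g \<in> carrier G. len g \<le> n}"
    then obtain ws where "set ws \<subseteq> S" "lprod ws = g" "length ws = len g"
      using geodesic_word by blast
    then show "g \<in> lprod ` {ws. set ws \<subseteq> S \<and> length ws \<le> n}" using g by force
  qed
  show "finite (lprod ` {ws. set ws \<subseteq> S \<and> length ws \<le> n})"
    using finite_lists_length_le[OF finite_gens] by blast
qed

end

section \<open>Poincare series and prefix codes\<close>

context word_length
begin

abbreviation weight :: "real \<Rightarrow> 'a \<Rightarrow> real" where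
  "weight \<delta> g \<equiv> exp (- (\<delta> * real (len g)))"

text \<open>Sorting the elements by length bounds the Poincare series at \<open>\<delta>\<close> by a geometric series with
  ratio \<open>exp (- \<epsilon>)\<close>.\<close>

lemma weights_bounded_if_slow_growth:
  assumes \<epsilon>: "\<epsilon> > 0"
    and slow: "\<And>n. real (card {g \<in> carrier G. len g \<le> n}) \<le> C * exp ((\<delta> - \<epsilon>) * real n)"
  shows "\<exists>B. \<forall>Y. finite Y \<and> Y \<subseteq> carrier G \<longrightarrow> sum (weight \<delta>) Y \<le> B"
proof -
  define q where "q = exp (- \<epsilon>)"
  have q: "0 < q" "q < 1" using \<epsilon> by (auto simp: q_def)
  have C: "C \<ge> 0"
    using order_trans[OF of_nat_0_le_iff slow[of 0]] by simp
  have "sum (weight \<delta>) Y \<le> C * (1 / (1 - q))" if Y: "finite Y" "Y \<subseteq> carrier G" for Y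
  proof -
    define m where "m = Suc (Max (insert 0 (len ` Y)))"
    have lt: "len g < m" if "g \<in> Y" for g
      using Y(1) that by (auto simp: m_def less_Suc_eq_le)
    have "sum (weight \<delta>) Y = (\<Sum>n<m. \<Sum>g\<in>{g\<in>Y. len g = n}. weight \<delta> g)"
      by (rule sum.group[symmetric]) (use Y lt in auto)
    also have "\<dots> \<le> (\<Sum>n<m. C * q ^ n)"
    proof (rule sum_mono)
      fix n assume "n \<in> {..<m}"
      have "(\<Sum>g\<in>{g\<in>Y. len g = n}. weight \<delta> g) = real (card {g\<in>Y. len g = n}) * exp (- (\<delta> * real n))"
        by simp
      also have "card {g\<in>Y. len g = n} \<le> card {g \<in> carrier G. len g \<le> n}"
        by (rule card_mono[OF finite_ball]) (use Y in auto)
      also have "real (card {g \<in> carrier G. len g \<le> n}) * exp (- (\<delta> * real n))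
        \<le> C * exp ((\<delta> - \<epsilon>) * real n) * exp (- (\<delta> * real n))"
        by (intro mult_right_mono slow) simp
      also have "\<dots> = C * q ^ n"
        by (simp add: q_def mult.assoc flip: exp_add exp_of_nat_mult) (simp add: algebra_simps)
      finally show "(\<Sum>g\<in>{g\<in>Y. len g = n}. weight \<delta> g) \<le> C * q ^ n"
        by (simp add: mult_right_mono)
    qed
    also have "\<dots> = C * (\<Sum>n<m. q ^ n)" by (simp add: sum_distrib_left)
    also have "(\<Sum>n<m. q ^ n) \<le> 1 / (1 - q)"
    proof -
      have "(\<Sum>n<m. q ^ n) = (1 - q ^ m) / (1 - q)"
        using q by (simp add: sum_gp_strict)
      also have "\<dots> \<le> 1 / (1 - q)" using q by (intro divide_right_mono) auto
      finally show ?thesis .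
    qed
    finally show ?thesis using C by (simp add: mult_left_mono)
  qed
  then show ?thesis by blast
qed

end

text \<open>The length-graded submonoid on which the growth argument runs. The Levi property says that two
  factorisations of one element have a common refinement; together with additivity it makes \<open>M\<close>
  free on its indecomposable elements, although no basis is ever mentioned. The free pair only
  serves to make the exponent of \<open>G\<close> positive, which is what is needed for quotients of
  subexponential growth.\<close>

locale cut_monoid = word_length +
  fixes M :: "'a set"
  assumes M_closed: "M \<subseteq> carrier G"
    and one_M: "\<one> \<in> M"
    and mult_M: "\<lbrakk>x \<in> M; y \<in> M\<rbrakk> \<Longrightarrow> x \<otimes> y \<in> M"
    and len_additive: "\<lbrakk>x \<in> M; y \<in> M\<rbrakk> \<Longrightarrow> len (x \<otimes> y) = len x + len y"
    and levi: "\<lbrakk>x \<in> M; y \<in> M; x' \<in> M; y' \<in> M; x \<otimes> y = x' \<otimes> y'\<rbrakk>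
      \<Longrightarrow> (\<exists>z\<in>M. x' = x \<otimes> z) \<or> (\<exists>z\<in>M. x = x' \<otimes> z)"
    and padding: "\<exists>K. \<forall>g\<in>carrier G. \<exists>p\<in>carrier G. \<exists>q\<in>carrier G.
      len p \<le> K \<and> len q \<le> K \<and> p \<otimes> g \<otimes> q \<in> M"
    and free_pair: "\<exists>\<alpha>\<in>M. \<exists>\<beta>\<in>M. \<forall>z\<in>M. \<alpha> \<noteq> \<beta> \<otimes> z \<and> \<beta> \<noteq> \<alpha> \<otimes> z"
begin

lemma M_carrier: "x \<in> M \<Longrightarrow> x \<in> carrier G"
  using M_closed by blast

lemma pow_M: "x \<in> M \<Longrightarrow> x [^] (n::nat) \<in> M"
  by (induction n) (auto intro: one_M mult_M)

lemma len_pow: "x \<in> M \<Longrightarrow> len (x [^] (n::nat)) = n * len x"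
  by (induction n) (auto simp: len_additive pow_M)

primrec powers :: "'a set \<Rightarrow> nat \<Rightarrow> 'a set" where
  "powers U 0 = {\<one>}"
| "powers U (Suc k) = (\<lambda>(u, x). u \<otimes> x) ` (U \<times> powers U k)"

text \<open>No codeword is a prefix of another one, up to \<open>M\<close>; hence products of codewords determine their
  factors.\<close>

definition prefix_code :: "'a set \<Rightarrow> bool" where
  "prefix_code U \<longleftrightarrow> finite U \<and> U \<subseteq> M \<and> \<one> \<notin> U \<and>
    (\<forall>u\<in>U. \<forall>u'\<in>U. \<forall>z\<in>M. \<forall>z'\<in>M. u \<otimes> z = u' \<otimes> z' \<longrightarrow> u = u')"

lemma powers_M: "prefix_code U \<Longrightarrow> powers U k \<subseteq> M"
  by (induction k) (auto simp: prefix_code_def intro: one_M mult_M)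

lemma finite_powers: "prefix_code U \<Longrightarrow> finite (powers U k)"
  by (induction k) (auto simp: prefix_code_def)

lemma prefix_code_cancel:
  assumes "prefix_code U" "u \<in> U" "u' \<in> U" "x \<in> M" "x' \<in> M" "u \<otimes> x = u' \<otimes> x'"
  shows "u = u' \<and> x = x'"
proof -
  have "u = u'" using assms unfolding prefix_code_def by blast
  moreover have "u \<in> carrier G" using assms M_carrier unfolding prefix_code_def by blast
  ultimately show ?thesis using assms(4-6) M_carrier Units_l_cancel Units_eq by metis
qed

text \<open>Cancelling first factors reduces a coincidence to the case that a nonempty product of codewords is
  trivial, which additivity of the length excludes.\<close>

lemma powers_disjoint:
  assumes "prefix_code U" "x \<in> powers U k" "x \<in> powers U j"
  shows "k = j"
  using assms(2,3)
proof (induction k arbitrary: x j)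
  have nz: "u \<otimes> y \<noteq> \<one>" if "u \<in> U" "y \<in> powers U i" for u y i
  proof
    assume "u \<otimes> y = \<one>"
    then have "len u + len y = 0"
      using len_additive[of u y] that powers_M[OF assms(1)] assms(1) len_one
      by (auto simp: prefix_code_def subset_iff)
    then show False
      using that assms(1) len_eq_0_iff[of u] M_carrier by (auto simp: prefix_code_def)
  qed
  {
    case 0
    show ?case
    proof (cases j)
      case (Suc i)
      then obtain u y where "x = u \<otimes> y" "u \<in> U" "y \<in> powers U i" using 0 by auto
      then show ?thesis using nz[of u y i] 0 by simp
    qed simp
  next
    case (Suc k)
    then obtain u y where uy: "x = u \<otimes> y" "u \<in> U" "y \<in> powers U k" by auto
    then obtain i where j: "j = Suc i" using Suc.prems(2) nz by (cases j) auto
    then obtain u' y' where uy': "x = u' \<otimes> y'" "u' \<in> U" "y' \<in> powers U i"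
      using Suc.prems(2) by auto
    have "y = y'"
      using prefix_code_cancel[OF assms(1) uy(2) uy'(2)] uy uy' powers_M[OF assms(1)] by blast
    then show ?case using Suc.IH uy(3) uy'(3) j by blast
  }
qed

lemma sum_powers:
  assumes U: "prefix_code U"
  shows "sum (weight \<delta>) (powers U k) = sum (weight \<delta>) U ^ k"
proof (induction k)
  case (Suc k)
  have inj: "inj_on (\<lambda>(u, x). u \<otimes> x) (U \<times> powers U k)"
  proof (rule inj_onI, clarify)
    fix u x u' x' assume "u \<in> U" "x \<in> powers U k" "u' \<in> U" "x' \<in> powers U k" "u \<otimes> x = u' \<otimes> x'"
    then show "u = u' \<and> x = x'"
      using prefix_code_cancel[OF U, of u u' x x'] powers_M[OF U] by blast
  qed
  have "sum (weight \<delta>) (powers U (Suc k)) = (\<Sum>(u, x)\<in>U \<times> powers U k. weight \<delta> (u \<otimes> x))"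
    unfolding powers.simps by (subst sum.reindex[OF inj]) (simp add: case_prod_unfold)
  also have "\<dots> = (\<Sum>(u, x)\<in>U \<times> powers U k. weight \<delta> u * weight \<delta> x)"
  proof (rule sum.cong)
    fix ux assume "ux \<in> U \<times> powers U k"
    then have "fst ux \<in> M" "snd ux \<in> M"
      using powers_M[OF U, of k] U by (auto simp: prefix_code_def)
    then show "(case ux of (u, x) \<Rightarrow> weight \<delta> (u \<otimes> x)) = (case ux of (u, x) \<Rightarrow> weight \<delta> u * weight \<delta> x)"
      by (simp add: case_prod_unfold len_additive algebra_simps flip: exp_add)
  qed simp
  also have "\<dots> = sum (weight \<delta>) U * sum (weight \<delta>) (powers U k)"
    by (simp add: sum_product sum.cartesian_product)
  finally show ?case using Suc by simp
qed simp

text \<open>The converse of the Kraft inequality: \<open>k\<close>-fold products of codewords have total weight at least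
  1 for every \<open>k\<close>, and they are distinct for distinct \<open>k\<close>, so the Poincare series diverges.\<close>

lemma prefix_code_growth:
  assumes U: "prefix_code U" and ge: "sum (weight \<delta>) U \<ge> 1" and \<epsilon>: "\<epsilon> > 0"
  shows "\<not> (\<exists>C. \<forall>n. real (card {g \<in> carrier G. len g \<le> n}) \<le> C * exp ((\<delta> - \<epsilon>) * real n))"
proof
  assume "\<exists>C. \<forall>n. real (card {g \<in> carrier G. len g \<le> n}) \<le> C * exp ((\<delta> - \<epsilon>) * real n)"
  then obtain C where "\<And>n. real (card {g \<in> carrier G. len g \<le> n}) \<le> C * exp ((\<delta> - \<epsilon>) * real n)"
    by blast
  from weights_bounded_if_slow_growth[OF \<epsilon> this]
  obtain B where B: "\<And>Y. finite Y \<Longrightarrow> Y \<subseteq> carrier G \<Longrightarrow> sum (weight \<delta>) Y \<le> B"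
    by blast
  have "real n \<le> B" for n
  proof -
    have "real n = (\<Sum>k<n. (1::real))" by simp
    also have "\<dots> \<le> (\<Sum>k<n. sum (weight \<delta>) (powers U k))"
      using one_le_power[OF ge] by (intro sum_mono) (simp add: sum_powers[OF U])
    also have "\<dots> = sum (weight \<delta>) (\<Union>k<n. powers U k)"
      by (rule sum.UNION_disjoint[symmetric])
        (use finite_powers[OF U] powers_disjoint[OF U] in auto)
    also have "\<dots> \<le> B"
      by (rule B) (use finite_powers[OF U] powers_M[OF U] M_carrier in auto)
    finally show ?thesis .
  qed
  from this[of "nat \<lceil>B\<rceil> + 1"] show False by linarith
qed

lemma positive_growth:
  shows "\<exists>U \<delta>. \<delta> > 0 \<and> prefix_code U \<and> sum (weight \<delta>) U \<ge> 1"
proof -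
  obtain \<alpha> \<beta> where ab: "\<alpha> \<in> M" "\<beta> \<in> M" "\<And>z. z \<in> M \<Longrightarrow> \<alpha> \<noteq> \<beta> \<otimes> z \<and> \<beta> \<noteq> \<alpha> \<otimes> z"
    using free_pair by blast
  have ne: "\<alpha> \<noteq> \<beta>" "\<alpha> \<noteq> \<one>" "\<beta> \<noteq> \<one>"
    using ab(3)[OF one_M] ab(3)[OF ab(1)] ab(3)[OF ab(2)] ab(1,2) M_carrier by auto
  have diff: "\<alpha> \<otimes> z \<noteq> \<beta> \<otimes> z'" if "z \<in> M" "z' \<in> M" for z z'
    using levi[of \<alpha> z \<beta> z'] ab that by blast
  have code: "prefix_code {\<alpha>, \<beta>}"
    unfolding prefix_code_def
  proof (intro conjI ballI impI)
    fix u u' z z' assume "u \<in> {\<alpha>, \<beta>}" "u' \<in> {\<alpha>, \<beta>}" "z \<in> M" "z' \<in> M" "u \<otimes> z = u' \<otimes> z'"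
    then show "u = u'" using diff[of z z'] diff[of z' z] by auto
  qed (use ab(1,2) ne in auto)
  define l where "l = real (len \<alpha> + len \<beta>)"
  have l: "l > 0"
    using ne(2) len_eq_0_iff[of \<alpha>] ab(1) M_carrier by (auto simp: l_def)
  define \<delta> where "\<delta> = ln 2 / l"
  have half: "1 / 2 \<le> weight \<delta> g" if "g \<in> {\<alpha>, \<beta>}" for g
  proof -
    have "\<delta> * real (len g) \<le> \<delta> * l"
      using that l by (intro mult_left_mono) (auto simp: l_def \<delta>_def)
    also have "\<dots> = ln 2" using l by (simp add: \<delta>_def)
    finally have "exp (- ln 2) \<le> weight \<delta> g" by simp
    then show ?thesis by (simp add: exp_minus)
  qed
  have "1 \<le> sum (weight \<delta>) {\<alpha>, \<beta>}"
    using half[of \<alpha>] half[of \<beta>] ne by simp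
  moreover have "\<delta> > 0" using l by (simp add: \<delta>_def)
  ultimately show ?thesis using code by blast
qed

end

section \<open>Growth of a quotient by a normal subgroup\<close>

text \<open>Fekete's lemma in multiplicative form. The point is that the exponent is a lower bound for every
  radius, without a subexponential error.\<close>

lemma submultiplicative_growth:
  fixes Q :: "nat \<Rightarrow> real"
  assumes ge1: "\<And>n. Q n \<ge> 1" and mono: "\<And>m n. m \<le> n \<Longrightarrow> Q m \<le> Q n"
    and submult: "\<And>m n. Q (m + n) \<le> Q m * Q n"
  shows "\<exists>\<delta>\<ge>0. (\<forall>n. exp (\<delta> * real n) \<le> Q n) \<and>
    (\<forall>\<epsilon>>0. \<exists>C. \<forall>n. Q n \<le> C * exp ((\<delta> + \<epsilon>) * real n))"
proof -
  define I where "I = (\<lambda>n. ln (Q n) / real n) ` {1..}"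
  define \<delta> where "\<delta> = Inf I"
  have I0: "0 \<le> x" if "x \<in> I" for x
    using that ge1 by (auto simp: I_def)
  have bdd: "bdd_below I" using I0 by (rule bdd_belowI)
  have ne: "I \<noteq> {}" by (auto simp: I_def)
  have "\<delta> \<ge> 0" unfolding \<delta>_def using cInf_greatest[OF ne I0] by blast
  moreover have "exp (\<delta> * real n) \<le> Q n" for n
  proof (cases "n = 0")
    case True then show ?thesis using ge1[of 0] by simp
  next
    case False
    then have "\<delta> \<le> ln (Q n) / real n"
      unfolding \<delta>_def by (intro cInf_lower bdd) (auto simp: I_def)
    then have "\<delta> * real n \<le> ln (Q n)" using False by (simp add: field_simps)
    then have "exp (\<delta> * real n) \<le> exp (ln (Q n))" by simp
    then show ?thesis using ge1[of n] by simp
  qed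
  moreover have "\<exists>C. \<forall>n. Q n \<le> C * exp ((\<delta> + \<epsilon>) * real n)" if "\<epsilon> > 0" for \<epsilon>
  proof -
    obtain x where "x \<in> I" "x < \<delta> + \<epsilon>"
      using cInf_lessD[OF ne, of "\<delta> + \<epsilon>"] \<open>\<epsilon> > 0\<close> by (auto simp: \<delta>_def)
    then obtain k where k: "k \<ge> 1" "ln (Q k) / real k < \<delta> + \<epsilon>" by (auto simp: I_def)
    have lnQ: "ln (Q k) \<le> (\<delta> + \<epsilon>) * real k" using k by (simp add: field_simps)
    have "exp (ln (Q k)) \<le> exp ((\<delta> + \<epsilon>) * real k)" using lnQ by simp
    then have Qk: "Q k \<le> exp ((\<delta> + \<epsilon>) * real k)" using ge1[of k] by simp
    have pow: "Q (q * k + m) \<le> Q k ^ q * Q m" for q m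
    proof (induction q)
      case (Suc q)
      have "Q (Suc q * k + m) \<le> Q k * Q (q * k + m)"
        using submult[of k "q * k + m"] by (simp add: algebra_simps)
      also have "\<dots> \<le> Q k * (Q k ^ q * Q m)"
        using Suc ge1[of k] by (intro mult_left_mono) auto
      finally show ?case by (simp add: mult.assoc)
    qed simp
    have "Q n \<le> Q k * exp ((\<delta> + \<epsilon>) * real n)" for n
    proof -
      have "Q n = Q ((n div k) * k + n mod k)" by simp
      also have "\<dots> \<le> Q k ^ (n div k) * Q (n mod k)" by (rule pow)
      also have "\<dots> \<le> Q k ^ (n div k) * Q k"
        using ge1[of k] k(1) by (intro mult_left_mono mono) (auto simp: less_imp_le)
      also have "Q k ^ (n div k) \<le> exp ((\<delta> + \<epsilon>) * real k) ^ (n div k)"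
        using Qk ge1[of k] by (intro power_mono) auto
      also have "exp ((\<delta> + \<epsilon>) * real k) ^ (n div k) = exp ((\<delta> + \<epsilon>) * real (n div k * k))"
        by (simp add: algebra_simps flip: exp_of_nat_mult)
      also have "\<dots> \<le> exp ((\<delta> + \<epsilon>) * real n)"
        using \<open>\<delta> \<ge> 0\<close> \<open>\<epsilon> > 0\<close> by (simp only: exp_le_cancel_iff, intro mult_left_mono of_nat_mono) auto
      finally show ?thesis using ge1[of k] by (simp add: mult.commute)
    qed
    then show ?thesis by blast
  qed
  ultimately show ?thesis by blast
qed

context word_length
begin

definition coset_len :: "'a set \<Rightarrow> nat" where
  "coset_len C = (LEAST n. \<exists>g\<in>C. len g = n)"

abbreviation coset_ball :: "'a set \<Rightarrow> nat \<Rightarrow> 'a set set" where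
  "coset_ball N n \<equiv> {C \<in> rcosets N. coset_len C \<le> n}"

lemma coset_len_le: "g \<in> C \<Longrightarrow> coset_len C \<le> len g"
  unfolding coset_len_def by (rule Least_le) blast

lemma shortest_representative:
  assumes "N \<lhd> G" "C \<in> rcosets N"
  obtains g where "g \<in> carrier G" "C = N #> g" "g \<in> C" "len g = coset_len C"
proof -
  interpret N: normal N G by fact
  obtain x where x: "x \<in> carrier G" "C = N #> x" using assms(2) by (auto simp: RCOSETS_def)
  then have "\<exists>n. \<exists>g\<in>C. len g = n"
    using rcos_self[OF x(1) N.is_subgroup] by blast
  then have "\<exists>g\<in>C. len g = coset_len C"
    unfolding coset_len_def by (rule LeastI_ex)
  then obtain g where g: "g \<in> C" "len g = coset_len C" by blast
  have "g \<in> carrier G" using g x r_coset_subset_G[OF N.subset] by blast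
  moreover have "C = N #> g" using repr_independence[of g N x] g x N.is_subgroup by blast
  ultimately show ?thesis using that g by blast
qed

lemma finite_coset_ball:
  assumes "N \<lhd> G"
  shows "finite (coset_ball N n)"
proof (rule finite_subset)
  show "coset_ball N n \<subseteq> (\<lambda>g. N #> g) ` {g \<in> carrier G. len g \<le> n}"
  proof
    fix C assume C: "C \<in> coset_ball N n"
    then obtain g where "g \<in> carrier G" "C = N #> g" "len g = coset_len C"
      using shortest_representative[OF assms, of C] by blast
    then show "C \<in> (\<lambda>g. N #> g) ` {g \<in> carrier G. len g \<le> n}" using C by auto
  qed
qed (use finite_ball in blast)

text \<open>A shortest representative splits as a product of two elements with prescribed lengths, because the
  length is a word length.\<close>

lemma card_coset_ball_submult:
  assumes "N \<lhd> G"
  shows "card (coset_ball N (m + n)) \<le> card (coset_ball N m) * card (coset_ball N n)"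
proof -
  interpret N: normal N G by fact
  have "coset_ball N (m + n) \<subseteq> (\<lambda>(A, B). A <#> B) ` (coset_ball N m \<times> coset_ball N n)"
  proof
    fix C assume "C \<in> coset_ball N (m + n)"
    then have C: "C \<in> rcosets N" "coset_len C \<le> m + n" by auto
    from shortest_representative[OF assms C(1)]
    obtain g where g: "g \<in> carrier G" "C = N #> g" "len g = coset_len C" by blast
    have le: "min m (len g) \<le> len g" by simp
    obtain g1 g2 where s: "g1 \<in> carrier G" "g2 \<in> carrier G" "g = g1 \<otimes> g2"
      "len g1 = min m (len g)" "len g2 = len g - min m (len g)"
      using len_split[OF g(1) le] by blast
    have mem: "N #> g' \<in> rcosets N" "coset_len (N #> g') \<le> len g'" if "g' \<in> carrier G" for g'
      using that coset_len_le rcos_self N.is_subgroup by (auto simp: RCOSETS_def)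
    have "C = (N #> g1) <#> (N #> g2)" using N.rcos_sum[OF s(1,2)] g s by simp
    moreover have "N #> g1 \<in> coset_ball N m" "N #> g2 \<in> coset_ball N n"
      using mem[OF s(1)] mem[OF s(2)] s(4,5) g(3) C(2) by (auto simp: min_def split: if_splits)
    ultimately show "C \<in> (\<lambda>(A, B). A <#> B) ` (coset_ball N m \<times> coset_ball N n)" by force
  qed
  then have "card (coset_ball N (m + n)) \<le> card (coset_ball N m \<times> coset_ball N n)"
    by (intro surj_card_le finite_cartesian_product finite_coset_ball[OF assms])
  then show ?thesis by (simp add: card_cartesian_product)
qed

lemma coset_growth:
  assumes N: "N \<lhd> G"
  shows "\<exists>\<delta>\<ge>0. (\<forall>n. exp (\<delta> * real n) \<le> real (card (coset_ball N n))) \<and>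
    (\<forall>\<epsilon>>0. \<exists>C. \<forall>n. real (card (coset_ball N n)) \<le> C * exp ((\<delta> + \<epsilon>) * real n))"
proof (rule submultiplicative_growth)
  interpret N: normal N G by fact
  fix n
  have "N #> \<one> \<in> coset_ball N n"
    using coset_len_le[OF rcos_self[OF one_closed N.is_subgroup]] by (auto simp: RCOSETS_def)
  then have "card (coset_ball N n) \<noteq> 0" using finite_coset_ball[OF N] by auto
  then show "1 \<le> real (card (coset_ball N n))" by simp
next
  fix m n :: nat assume "m \<le> n"
  then show "real (card (coset_ball N m)) \<le> real (card (coset_ball N n))"
    by (intro of_nat_mono card_mono finite_coset_ball[OF N]) auto
next
  fix m n
  show "real (card (coset_ball N (m + n))) \<le> real (card (coset_ball N m)) * real (card (coset_ball N n))"
    using card_coset_ball_submult[OF N, of m n] by (simp flip: of_nat_mult)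
qed

text \<open>The cosets outside a fixed ball of radius \<open>m\<close> but inside a much larger one of radius \<open>n\<close>
  number at least about \<open>exp (\<delta> n)\<close>, and each of them has weight at least \<open>exp (- \<delta> n)\<close>: every partial
  sum can be increased by 1/2.\<close>

lemma coset_series_diverges:
  assumes N: "N \<lhd> G" and \<delta>: "\<delta> > 0"
    and ge: "\<And>n. exp (\<delta> * real n) \<le> real (card (coset_ball N n))"
  shows "\<exists>n. (\<Sum>C\<in>coset_ball N n. exp (- (\<delta> * real (coset_len C)))) \<ge> B"
proof -
  define s where "s = (\<lambda>n. \<Sum>C\<in>coset_ball N n. exp (- (\<delta> * real (coset_len C))))"
  have step: "\<exists>n. s n \<ge> s m + 1 / 2" for m
  proof -
    define c where "c = real (card (coset_ball N m))"
    \<comment> \<open>large enough that \<open>exp (\<delta> n) \<ge> \<delta> n \<ge> 2 c\<close>\<close>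
    define n where "n = m + nat \<lceil>2 * c / \<delta>\<rceil>"
    have "2 * c \<le> \<delta> * real n"
    proof -
      have "2 * c / \<delta> \<le> real n" by (simp add: n_def) linarith
      then show ?thesis using \<delta> by (simp add: field_simps)
    qed
    also have "\<dots> \<le> exp (\<delta> * real n)" using exp_ge_add_one_self[of "\<delta> * real n"] by linarith
    finally have half: "c * exp (- (\<delta> * real n)) \<le> 1 / 2"
      by (simp add: exp_minus field_simps)
    have sub: "coset_ball N m \<subseteq> coset_ball N n" by (auto simp: n_def)
    have "s n - s m = (\<Sum>C\<in>coset_ball N n - coset_ball N m. exp (- (\<delta> * real (coset_len C))))"
      unfolding s_def by (simp add: sum_diff[OF finite_coset_ball[OF N] sub])
    also have "\<dots> \<ge> (\<Sum>C\<in>coset_ball N n - coset_ball N m. exp (- (\<delta> * real n)))"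
      using \<delta> by (intro sum_mono) auto
    also have "(\<Sum>C\<in>coset_ball N n - coset_ball N m. exp (- (\<delta> * real n)))
      = (real (card (coset_ball N n)) - c) * exp (- (\<delta> * real n))"
      using card_mono[OF finite_coset_ball[OF N] sub] finite_coset_ball[OF N]
      by (simp add: card_Diff_subset[OF finite_coset_ball[OF N] sub] c_def of_nat_diff)
    also have "\<dots> \<ge> (exp (\<delta> * real n) - c) * exp (- (\<delta> * real n))"
      using ge[of n] by (intro mult_right_mono) auto
    also have "(exp (\<delta> * real n) - c) * exp (- (\<delta> * real n)) = 1 - c * exp (- (\<delta> * real n))"
      by (simp add: left_diff_distrib flip: exp_add)
    finally show ?thesis using half by (intro exI[of _ n]) linarith
  qed
  have "\<exists>n. s n \<ge> s 0 + real k / 2" for k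
  proof (induction k)
    case (Suc k)
    then obtain m where "s m \<ge> s 0 + real k / 2" by blast
    moreover obtain n where "s n \<ge> s m + 1 / 2" using step by blast
    ultimately show ?case by (intro exI[of _ n]) (simp add: field_simps)
  qed auto
  moreover have "s 0 \<ge> 0" by (simp add: s_def sum_nonneg)
  moreover have "B \<le> real (nat \<lceil>2 * \<bar>B\<bar>\<rceil>) / 2" by linarith
  ultimately have "\<exists>n. s n \<ge> B"
    by (meson add_increasing order_trans)
  then show ?thesis by (simp add: s_def)
qed

end

context cut_monoid
begin

text \<open>Moving a shortest representative into \<open>M\<close> costs at most \<open>2K\<close>. If the result contained \<open>W\<close>,
  then deleting \<open>W\<close> and undoing the padding would give an element of the same coset, since \<open>W\<close>
  lies in the normal subgroup, of length at most the old one plus \<open>4K - |W|\<close>. The assignment is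
  finite-to-one because the padding varies in a finite set.\<close>

lemma short_padded_representatives:
  assumes N: "N \<lhd> G" and h: "h \<in> M" "h \<in> N" "h \<noteq> \<one>"
  obtains W K c where "W \<in> M" "len W > 0"
    "\<forall>C\<in>rcosets N. c C \<in> M \<and> len (c C) \<le> coset_len C + 2 * K \<and>
      (\<forall>x\<in>M. \<forall>y\<in>M. c C \<noteq> x \<otimes> W \<otimes> y)"
    "\<forall>x. finite {C \<in> rcosets N. c C = x} \<and>
      card {C \<in> rcosets N. c C = x} \<le> card {g \<in> carrier G. len g \<le> K} ^ 2"
proof -
  interpret N: normal N G by fact
  obtain K where "\<forall>g\<in>carrier G. \<exists>p\<in>carrier G. \<exists>q\<in>carrier G.
      len p \<le> K \<and> len q \<le> K \<and> p \<otimes> g \<otimes> q \<in> M" using padding by blast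
  then have K: "\<And>g. g \<in> carrier G \<Longrightarrow> \<exists>p\<in>carrier G. \<exists>q\<in>carrier G.
      len p \<le> K \<and> len q \<le> K \<and> p \<otimes> g \<otimes> q \<in> M" by blast
  define good where "good = (\<lambda>C x. \<exists>p\<in>carrier G. \<exists>q\<in>carrier G. \<exists>a\<in>carrier G. len p \<le> K \<and> len q \<le> K \<and>
    C = N #> a \<and> len a = coset_len C \<and> x = p \<otimes> a \<otimes> q \<and> x \<in> M)"
  have ex: "\<exists>x. good C x" if C: "C \<in> rcosets N" for C
  proof -
    obtain a where a: "a \<in> carrier G" "C = N #> a" "a \<in> C" "len a = coset_len C"
      using shortest_representative[OF N C] .
    obtain p q where "p \<in> carrier G" "q \<in> carrier G" "len p \<le> K" "len q \<le> K" "p \<otimes> a \<otimes> q \<in> M"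
      using K[OF a(1)] by blast
    then show ?thesis using a unfolding good_def by (intro exI[of _ "p \<otimes> a \<otimes> q"] bexI[of _ p] bexI[of _ q] bexI[of _ a]) auto
  qed
  define c where "c = (\<lambda>C. SOME x. good C x)"
  have c: "good C (c C)" if "C \<in> rcosets N" for C
    unfolding c_def using someI_ex[OF ex[OF that]] .
  \<comment> \<open>\<open>2K\<close> for the padding and \<open>2K\<close> for undoing it have to be outweighed\<close>
  define W where "W = h [^] (4 * K + 1)"
  have W: "W \<in> M" unfolding W_def by (rule pow_M[OF h(1)])
  have WN: "W \<in> N"
  proof -
    have "h [^] n \<in> N" for n :: nat using h by (induction n) (auto simp: N.one_closed N.m_closed)
    then show ?thesis unfolding W_def by blast
  qed
  have hl: "len h > 0" using h len_eq_0_iff[of h] M_carrier by auto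
  have "len W = (4 * K + 1) * len h" unfolding W_def by (rule len_pow[OF h(1)])
  then have lW: "len W > 4 * K" using hl by (cases "len h") auto
  note carr = M_carrier m_closed inv_closed
  show ?thesis
  proof (rule that[of W c K], goal_cases)
    case 1 show ?case by fact
  next
    case 2 show ?case using lW by simp
  next
    case 3 show ?case
    proof (intro ballI conjI)
      fix C assume C: "C \<in> rcosets N"
      from c[OF C] obtain p q a where d: "p \<in> carrier G" "q \<in> carrier G" "a \<in> carrier G"
        "len p \<le> K" "len q \<le> K" "C = N #> a" "len a = coset_len C" "c C = p \<otimes> a \<otimes> q" "c C \<in> M"
        unfolding good_def by blast
      show "c C \<in> M" by fact
      show le: "len (c C) \<le> coset_len C + 2 * K"
        using len_mult[of p a] len_mult[of "p \<otimes> a" q] d by auto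
      fix x y assume xy: "x \<in> M" "y \<in> M"
      show "c C \<noteq> x \<otimes> W \<otimes> y"
      proof
        assume eq: "c C = x \<otimes> W \<otimes> y"
        have xc: "x \<in> carrier G" "y \<in> carrier G" "W \<in> carrier G" using xy W M_carrier by auto
        define a' where "a' = (inv p \<otimes> x) \<otimes> (y \<otimes> inv q)"
        have aeq: "a = (inv p \<otimes> x) \<otimes> W \<otimes> (y \<otimes> inv q)"
        proof -
          have "a = inv p \<otimes> (p \<otimes> a \<otimes> q) \<otimes> inv q" using d by (simp add: m_assoc inv_cancel_left)
          also have "p \<otimes> a \<otimes> q = x \<otimes> W \<otimes> y" using eq d by simp
          finally show ?thesis using xc d by (simp add: m_assoc)
        qed
        have "a' \<otimes> inv a = (inv p \<otimes> x) \<otimes> inv W \<otimes> inv (inv p \<otimes> x)"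
          unfolding aeq a'_def using xc d by (simp add: m_assoc inv_mult_group inv_cancel_left)
        also have "\<dots> \<in> N" using xc d WN by (intro N.inv_op_closed2) auto
        finally have n: "a' \<otimes> inv a \<in> N" .
        have ac: "a' \<in> carrier G" using xc d by (auto simp: a'_def)
        then have "a' = (a' \<otimes> inv a) \<otimes> a" using d by (simp add: m_assoc)
        then have "a' \<in> C" using n d(6) by (auto simp: r_coset_def)
        then have "coset_len C \<le> len a'" by (rule coset_len_le)
        also have "\<dots> \<le> (len p + len x) + (len y + len q)"
          unfolding a'_def using len_mult[of "inv p" x] len_mult[of y "inv q"]
            len_mult[of "inv p \<otimes> x" "y \<otimes> inv q"] xc d by simp
        finally have "coset_len C \<le> 2 * K + len x + len y" using d by simp
        moreover have "len (c C) = len x + len W + len y"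
          using eq len_additive mult_M xy W by simp
        ultimately show False using le lW by linarith
      qed
    qed
  next
    case 4 show ?case
    proof (intro allI conjI)
      fix x
      let ?B = "{g \<in> carrier G. len g \<le> K}"
      have sub: "{C \<in> rcosets N. c C = x} \<subseteq> (\<lambda>(p, q). N #> (inv p \<otimes> x \<otimes> inv q)) ` (?B \<times> ?B)"
      proof
        fix C assume C: "C \<in> {C \<in> rcosets N. c C = x}"
        then have "good C x" using c by auto
        then obtain p q a where d: "p \<in> carrier G" "q \<in> carrier G" "a \<in> carrier G"
          "len p \<le> K" "len q \<le> K" "C = N #> a" "x = p \<otimes> a \<otimes> q"
          unfolding good_def by blast
        have "a = inv p \<otimes> x \<otimes> inv q" using d by (simp add: m_assoc inv_cancel_left)
        then show "C \<in> (\<lambda>(p, q). N #> (inv p \<otimes> x \<otimes> inv q)) ` (?B \<times> ?B)"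
          using d by (intro image_eqI[of _ _ "(p, q)"]) auto
      qed
      have fin: "finite (?B \<times> ?B)" using finite_ball by blast
      show "finite {C \<in> rcosets N. c C = x}" using finite_subset[OF sub] fin by blast
      have "card {C \<in> rcosets N. c C = x} \<le> card (?B \<times> ?B)"
        using surj_card_le[OF fin sub] .
      then show "card {C \<in> rcosets N. c C = x} \<le> card ?B ^ 2"
        by (simp add: card_cartesian_product power2_eq_square)
    qed
  qed
qed

text \<open>If \<open>cW\<close> and \<open>c'W\<close> start the same element and \<open>c' = cz\<close>, then \<open>W\<close> and \<open>zW\<close> are comparable.
  The congruence makes \<open>z\<close> trivial or longer than \<open>W\<close>, and in the latter case \<open>W\<close> is a prefix
  of \<open>z\<close>, so that \<open>c'\<close> contains \<open>W\<close>. Without the congruence one would need a \<open>W\<close> that does not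
  overlap itself.\<close>

lemma avoiding_prefix_code:
  assumes W: "W \<in> M" and Y: "finite Y" "Y \<subseteq> M"
    and avoid: "\<And>c x y. c \<in> Y \<Longrightarrow> x \<in> M \<Longrightarrow> y \<in> M \<Longrightarrow> c \<noteq> x \<otimes> W \<otimes> y"
    and len0: "len W > 0"
    and cong: "\<And>c. c \<in> Y \<Longrightarrow> len c mod Suc (len W) = \<rho>"
  shows "prefix_code ((\<lambda>c. c \<otimes> W) ` Y)"
proof -
  have no_prefix: False if c: "c \<in> Y" "c' \<in> Y" "z \<in> M" "c' = c \<otimes> z" "z \<noteq> \<one>"
    and eq: "W \<otimes> y = z \<otimes> (W \<otimes> y')" and y: "y \<in> M" "y' \<in> M" for c c' z y y'
  proof -
    have "len c' = len c + len z" using c Y len_additive by auto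
    then have "Suc (len W) dvd len z"
      using cong[OF c(1)] cong[OF c(2)]
      by (metis diff_add_inverse le_add1 mod_eq_dvd_iff_nat)
    moreover have "len z \<noteq> 0" using c len_eq_0_iff M_carrier by blast
    ultimately have long: "len W < len z" by (auto dest!: dvd_imp_le)
    have "W \<otimes> y' \<in> M" using W y mult_M by blast
    from levi[OF W y(1) c(3) this eq] have "\<exists>w\<in>M. z = W \<otimes> w"
    proof
      assume "\<exists>w\<in>M. W = z \<otimes> w"
      then obtain w where w: "w \<in> M" "W = z \<otimes> w" by blast
      have "len W = len z + len w" using w len_additive c(3) by simp
      then show ?thesis using long by simp
    qed
    then obtain w where w: "w \<in> M" "z = W \<otimes> w" by blast
    have "c' = c \<otimes> W \<otimes> w" using c w W Y M_carrier by (simp add: m_assoc subset_iff)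
    then show False using avoid[OF c(2) _ w(1)] c(1) Y by blast
  qed
  show ?thesis
    unfolding prefix_code_def
  proof (intro conjI ballI impI)
    show "finite ((\<lambda>c. c \<otimes> W) ` Y)" "(\<lambda>c. c \<otimes> W) ` Y \<subseteq> M"
      using Y W mult_M by auto
    show "\<one> \<notin> (\<lambda>c. c \<otimes> W) ` Y"
    proof
      assume "\<one> \<in> (\<lambda>c. c \<otimes> W) ` Y"
      then obtain c where c: "c \<in> Y" "\<one> = c \<otimes> W" by auto
      have "len (c \<otimes> W) = len c + len W" using c Y W len_additive by blast
      then show False using c(2) len0 len_one by simp
    qed
    fix u u' y y'
    assume "u \<in> (\<lambda>c. c \<otimes> W) ` Y" "u' \<in> (\<lambda>c. c \<otimes> W) ` Y" and y: "y \<in> M" "y' \<in> M"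
      and eq: "u \<otimes> y = u' \<otimes> y'"
    then obtain c c' where c: "c \<in> Y" "u = c \<otimes> W" "c' \<in> Y" "u' = c' \<otimes> W" by auto
    have cM: "c \<in> M" "c' \<in> M" and Wy: "W \<otimes> y \<in> M" "W \<otimes> y' \<in> M" using c Y W y mult_M by auto
    note cc = cM[THEN M_carrier] y[THEN M_carrier] W[THEN M_carrier]
    have eq: "c \<otimes> (W \<otimes> y) = c' \<otimes> (W \<otimes> y')" using eq c cc by (simp add: m_assoc)
    have "c = c'"
      using levi[OF cM(1) Wy(1) cM(2) Wy(2) eq]
    proof
      assume "\<exists>z\<in>M. c' = c \<otimes> z"
      then obtain z where z: "z \<in> M" "c' = c \<otimes> z" by blast
      then have zc: "z \<in> carrier G" using M_carrier by blast
      have "W \<otimes> y = z \<otimes> (W \<otimes> y')" using eq cc zc unfolding z(2) by (simp add: m_assoc)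
      then show ?thesis using no_prefix[OF c(1) c(3) z _ _ y] z cc by (cases "z = \<one>") auto
    next
      assume "\<exists>z\<in>M. c = c' \<otimes> z"
      then obtain z where z: "z \<in> M" "c = c' \<otimes> z" by blast
      then have zc: "z \<in> carrier G" using M_carrier by blast
      have "W \<otimes> y' = z \<otimes> (W \<otimes> y)" using eq cc zc unfolding z(2) by (simp add: m_assoc)
      then show ?thesis using no_prefix[OF c(3) c(1) z _ _ y(2,1)] z cc by (cases "z = \<one>") auto
    qed
    then show "u = u'" using c by simp
  qed
qed

text \<open>The padded representatives inherit the divergence of the coset series up to the constant \<open>F\<close>
  that bounds the fibres. Since there are finitely many residue classes of lengths, the weights in
  one of them exceed any given bound, in particular the one that pays for the factor \<open>W\<close>.\<close>

lemma code_with_gain: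
  assumes N: "N \<lhd> G" and h: "h \<in> M" "h \<in> N" "h \<noteq> \<one>" and \<delta>: "\<delta> > 0"
    and ge: "\<And>n. exp (\<delta> * real n) \<le> real (card (coset_ball N n))"
  shows "\<exists>U. prefix_code U \<and> sum (weight \<delta>) U \<ge> 2"
proof -
  obtain W K c where W: "W \<in> M" "len W > 0"
    and *: "\<forall>C\<in>rcosets N. c C \<in> M \<and> len (c C) \<le> coset_len C + 2 * K \<and>
      (\<forall>x\<in>M. \<forall>y\<in>M. c C \<noteq> x \<otimes> W \<otimes> y)"
    and **: "\<forall>x. finite {C \<in> rcosets N. c C = x} \<and>
      card {C \<in> rcosets N. c C = x} \<le> card {g \<in> carrier G. len g \<le> K} ^ 2"
    using short_padded_representatives[OF N h] .
  have cM: "c C \<in> M" and clen: "len (c C) \<le> coset_len C + 2 * K"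
    and cavoid: "x \<in> M \<Longrightarrow> y \<in> M \<Longrightarrow> c C \<noteq> x \<otimes> W \<otimes> y" if "C \<in> rcosets N" for C x y
    using * that by blast+
  have cfib: "card {C \<in> rcosets N. c C = x} \<le> card {g \<in> carrier G. len g \<le> K} ^ 2"
    "finite {C \<in> rcosets N. c C = x}" for x
    using ** by blast+
  define F where "F = real (card {g \<in> carrier G. len g \<le> K} ^ 2)"
  \<comment> \<open>weight that the codewords need before \<open>W\<close> is appended\<close>
  define T where "T = 2 * exp (\<delta> * real (len W))"
  define D where "D = real (Suc (len W))"
  obtain n where n: "F * exp (\<delta> * real (2 * K)) * (D * T) < (\<Sum>C\<in>coset_ball N n. exp (- (\<delta> * real (coset_len C))))"
    using coset_series_diverges[OF N \<delta> ge, of "F * exp (\<delta> * real (2 * K)) * (D * T) + 1"]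
    by (meson less_add_one less_le_trans)
  define A where "A = c ` coset_ball N n"
  define Y where "Y = (\<lambda>\<rho>. {x \<in> A. len x mod Suc (len W) = \<rho>})"
  have finA: "finite A" using finite_coset_ball[OF N] by (simp add: A_def)
  have "(\<Sum>C\<in>coset_ball N n. exp (- (\<delta> * real (coset_len C))))
    \<le> (\<Sum>C\<in>coset_ball N n. exp (\<delta> * real (2 * K)) * weight \<delta> (c C))"
  proof (rule sum_mono)
    fix C assume "C \<in> coset_ball N n"
    then have "real (len (c C)) \<le> real (coset_len C) + real (2 * K)"
      using clen[of C] by (metis (mono_tags, lifting) mem_Collect_eq of_nat_add of_nat_le_iff)
    from mult_left_mono[OF this, of \<delta>] have "- (\<delta> * real (coset_len C)) \<le> \<delta> * real (2 * K) + - (\<delta> * real (len (c C)))"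
      using \<delta> by (simp add: algebra_simps)
    then show "exp (- (\<delta> * real (coset_len C))) \<le> exp (\<delta> * real (2 * K)) * weight \<delta> (c C)"
      by (simp flip: exp_add)
  qed
  also have "\<dots> = exp (\<delta> * real (2 * K)) * (\<Sum>C\<in>coset_ball N n. weight \<delta> (c C))"
    by (simp add: sum_distrib_left)
  also have "(\<Sum>C\<in>coset_ball N n. weight \<delta> (c C)) = (\<Sum>x\<in>A. \<Sum>C\<in>{C\<in>coset_ball N n. c C = x}. weight \<delta> (c C))"
    unfolding A_def by (rule sum.image_gen[OF finite_coset_ball[OF N]])
  also have "\<dots> \<le> (\<Sum>x\<in>A. F * weight \<delta> x)"
  proof (rule sum_mono)
    fix x
    have "card {C\<in>coset_ball N n. c C = x} \<le> card {C \<in> rcosets N. c C = x}"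
      by (rule card_mono[OF cfib(2)]) auto
    then have "real (card {C\<in>coset_ball N n. c C = x}) \<le> F"
      using cfib(1)[of x] unfolding F_def by linarith
    then show "(\<Sum>C\<in>{C\<in>coset_ball N n. c C = x}. weight \<delta> (c C)) \<le> F * weight \<delta> x"
      by (simp add: mult_right_mono)
  qed
  also have "\<dots> = F * sum (weight \<delta>) A" by (simp add: sum_distrib_left)
  also have "sum (weight \<delta>) A = (\<Sum>\<rho>\<in>{..<Suc (len W)}. sum (weight \<delta>) (Y \<rho>))"
    unfolding Y_def by (rule sum.group[symmetric]) (use finA in auto)
  finally have big: "F * exp (\<delta> * real (2 * K)) * (D * T)
    < F * exp (\<delta> * real (2 * K)) * (\<Sum>\<rho>\<in>{..<Suc (len W)}. sum (weight \<delta>) (Y \<rho>))"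
    using n by (simp add: mult_ac)
  have "F \<ge> 0" by (simp add: F_def)
  then have "D * T < (\<Sum>\<rho>\<in>{..<Suc (len W)}. sum (weight \<delta>) (Y \<rho>))"
    using big by (metis mult_left_less_imp_less exp_ge_zero mult_nonneg_nonneg)
  then have "\<exists>\<rho>\<in>{..<Suc (len W)}. T < sum (weight \<delta>) (Y \<rho>)"
  proof (rule contrapos_pp)
    assume "\<not> ?thesis"
    then have "(\<Sum>\<rho>\<in>{..<Suc (len W)}. sum (weight \<delta>) (Y \<rho>)) \<le> (\<Sum>\<rho>\<in>{..<Suc (len W)}. T)"
      by (intro sum_mono) (meson not_less)
    then show "\<not> D * T < (\<Sum>\<rho>\<in>{..<Suc (len W)}. sum (weight \<delta>) (Y \<rho>))"
      by (simp add: D_def)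
  qed
  then obtain \<rho> where \<rho>: "T < sum (weight \<delta>) (Y \<rho>)" by blast
  have YM: "Y \<rho> \<subseteq> M" using cM by (auto simp: Y_def A_def)
  have fY: "finite (Y \<rho>)" using finA by (simp add: Y_def)
  have code: "prefix_code ((\<lambda>x. x \<otimes> W) ` Y \<rho>)"
    by (rule avoiding_prefix_code[OF W(1) fY YM _ W(2)]) (use cavoid in \<open>auto simp: Y_def A_def\<close>)
  have "inj_on (\<lambda>x. x \<otimes> W) (Y \<rho>)"
    using YM W M_carrier by (intro inj_onI) (metis right_cancel subsetD)
  then have "sum (weight \<delta>) ((\<lambda>x. x \<otimes> W) ` Y \<rho>) = (\<Sum>x\<in>Y \<rho>. weight \<delta> (x \<otimes> W))"
    by (simp add: sum.reindex)
  also have "\<dots> = (\<Sum>x\<in>Y \<rho>. weight \<delta> x * weight \<delta> W)"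
    by (rule sum.cong) (use YM W in \<open>auto simp: len_additive subset_iff algebra_simps simp flip: exp_add\<close>)
  also have "\<dots> = sum (weight \<delta>) (Y \<rho>) * weight \<delta> W" by (simp add: sum_distrib_right)
  also have "\<dots> \<ge> T * weight \<delta> W" using \<rho> by (intro mult_right_mono) auto
  also have "T * weight \<delta> W = 2" by (simp add: T_def flip: exp_add)
  finally show ?thesis using code by blast
qed

text \<open>A code of weight 2 at \<open>\<delta>\<close> keeps weight 1 at a slightly larger exponent because it is finite.
  For \<open>\<delta> = 0\<close> the coset series need not diverge, since the quotient may be finite; then it is
  enough that \<open>G\<close> grows exponentially.\<close>

theorem growth_gap:
  assumes N: "N \<lhd> G" and h: "h \<in> M" "h \<in> N" "h \<noteq> \<one>"
  shows "\<exists>\<delta> \<delta>'. 0 \<le> \<delta> \<and> \<delta> < \<delta>' \<and>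
    (\<forall>\<epsilon>>0. \<exists>C. \<forall>n. real (card (coset_ball N n)) \<le> C * exp ((\<delta> + \<epsilon>) * real n)) \<and>
    (\<forall>\<epsilon>>0. \<not> (\<exists>C. \<forall>n. real (card {g \<in> carrier G. len g \<le> n}) \<le> C * exp ((\<delta>' - \<epsilon>) * real n)))"
proof -
  obtain \<delta> where \<delta>: "\<delta> \<ge> 0" "\<And>n. exp (\<delta> * real n) \<le> real (card (coset_ball N n))"
    "\<And>\<epsilon>. \<epsilon> > 0 \<Longrightarrow> \<exists>C. \<forall>n. real (card (coset_ball N n)) \<le> C * exp ((\<delta> + \<epsilon>) * real n)"
    using coset_growth[OF N] by blast
  have "\<exists>U \<delta>'. \<delta> < \<delta>' \<and> prefix_code U \<and> sum (weight \<delta>') U \<ge> 1"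
  proof (cases "\<delta> = 0")
    case True
    then show ?thesis using positive_growth by blast
  next
    case False
    then obtain U where U: "prefix_code U" "sum (weight \<delta>) U \<ge> 2"
      using code_with_gain[OF N h _ \<delta>(2)] \<delta>(1) by force
    define L where "L = real (Suc (Max (insert 0 (len ` U))))"
    have L: "real (len u) \<le> L" if "u \<in> U" for u
    proof -
      have "len u \<le> Max (insert 0 (len ` U))"
        using that U(1) by (intro Max_ge) (auto simp: prefix_code_def)
      then show ?thesis by (simp add: L_def)
    qed
    have L0: "L > 0" by (simp add: L_def)
    \<comment> \<open>at this exponent every codeword keeps at least half of its weight\<close>
    define \<delta>' where "\<delta>' = \<delta> + ln 2 / L"
    have "1 \<le> sum (weight \<delta>) U / 2" using U by simp
    also have "\<dots> = (\<Sum>u\<in>U. weight \<delta> u / 2)" by (simp add: sum_divide_distrib)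
    also have "\<dots> \<le> sum (weight \<delta>') U"
    proof (rule sum_mono)
      fix u assume "u \<in> U"
      from mult_left_mono[OF L[OF this], of "ln 2 / L"] L0
      have "ln 2 / L * real (len u) \<le> ln 2" by simp
      then have "- (\<delta> * real (len u)) - ln 2 \<le> - (\<delta>' * real (len u))"
        by (simp add: \<delta>'_def algebra_simps)
      then have "exp (- (\<delta> * real (len u)) - ln 2) \<le> weight \<delta>' u" by simp
      then show "weight \<delta> u / 2 \<le> weight \<delta>' u" by (simp add: exp_diff)
    qed
    finally have "1 \<le> sum (weight \<delta>') U" .
    moreover have "\<delta> < \<delta>'" using L0 by (simp add: \<delta>'_def)
    ultimately show ?thesis using U by blast
  qed
  then obtain U \<delta>' where "\<delta> < \<delta>'" "prefix_code U" "sum (weight \<delta>') U \<ge> 1" by blast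
  then show ?thesis using \<delta>(1,3) prefix_code_growth by blast
qed

end

section \<open>The first edge towards a group element, and the norm of the vertex group\<close>

text \<open>The stable letters \<open>s\<close> and \<open>t\<close> are distinguished by a truth value \<open>c\<close>; the associated vector is
  \<open>a\<^sup>rb\<close> for \<open>s\<close> and \<open>a\<^sup>rb\<^sup>-\<^sup>1\<close> for \<open>t\<close>, with second coordinate \<open>slope c\<close>.\<close>

definition slope :: "bool \<Rightarrow> int" where "slope c = (if c then 1 else - 1)"

lemma slope_square [simp]: "slope c * slope c = 1" "slope c * (slope c * x) = x"
  by (auto simp: slope_def)

text \<open>The edge of the tree from \<open>V\<close> to \<open>\<tau>V\<close>, where \<open>\<tau>\<close> is the stable letter \<open>c\<close> with exponent sign
  \<open>e\<close>, has stabiliser \<open>\<langle>a\<rangle>\<close> if \<open>e\<close> holds and \<open>\<langle>a\<^sup>rb\<^sup>\<plusminus>\<^sup>1\<rangle>\<close> otherwise. Complements are \<open>\<langle>b\<rangle>\<close> and \<open>\<langle>a\<rangle>\<close>;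
  the value is the coordinate of \<open>a\<^sup>ib\<^sup>j\<close> in the complement and so names its coset.\<close>

fun coset_rep :: "nat \<Rightarrow> bool \<Rightarrow> bool \<Rightarrow> int \<Rightarrow> int \<Rightarrow> int" where
  "coset_rep r c e i j = (if e then j else i - int r * slope c * j)"

text \<open>What is needed of the Bass-Serre tree: \<open>vec i j\<close> is \<open>a\<^sup>ib\<^sup>j\<close>, \<open>\<tau>\<close> lists the stable letters and
  their inverses, and \<open>dir g\<close> is the first edge on the tree path from \<open>V\<close> to \<open>gV\<close>, absent for
  \<open>g \<in> V\<close>. An edge \<open>(\<rho>, c, e)\<close> at \<open>V\<close> is given by a coset \<open>\<rho>\<close> of its stabiliser and the letter
  across it. The last axiom says that the first edge changes only when a path visits \<open>V\<close>.\<close>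

locale snowflake_tree = word_length +
  fixes r :: nat and vec :: "int \<Rightarrow> int \<Rightarrow> 'a" and \<tau> :: "bool \<Rightarrow> bool \<Rightarrow> 'a"
    and dir :: "'a \<Rightarrow> (int \<times> bool \<times> bool) option"
  assumes r3: "r \<ge> 3"
    and gens: "S = {vec 1 0, vec (- 1) 0} \<union> range (case_prod \<tau>)"
    and vec_closed [simp]: "vec i j \<in> carrier G"
    and vec_mult: "vec i j \<otimes> vec k l = vec (i + k) (j + l)"
    and vec_inject: "vec i j = vec k l \<longleftrightarrow> i = k \<and> j = l"
    and inv_stable [simp]: "inv (\<tau> c e) = \<tau> c (\<not> e)"
    and conj_stable: "\<tau> c False \<otimes> vec m 0 \<otimes> \<tau> c True = vec (int r * m) (slope c * m)"
    and dir_None: "g \<in> carrier G \<Longrightarrow> dir g = None \<longleftrightarrow> g \<in> range (case_prod vec)"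
    and dir_leave: "dir (vec i j \<otimes> \<tau> c e) = Some (coset_rep r c e i j, c, e)"
    and dir_step: "\<lbrakk>g \<in> carrier G; \<sigma> \<in> S \<union> range (case_prod vec); dir g \<noteq> None; dir (g \<otimes> \<sigma>) \<noteq> None\<rbrakk>
      \<Longrightarrow> dir (g \<otimes> \<sigma>) = dir g"
begin

lemma stable_gen: "\<tau> c e \<in> S" by (auto simp: gens)

lemma stable_closed [simp]: "\<tau> c e \<in> carrier G"
  using stable_gen gens_closed by blast

lemma vec_zero: "vec 0 0 = \<one>"
proof -
  have "vec 0 0 \<otimes> vec 0 0 = vec 0 0" by (simp add: vec_mult)
  then show ?thesis using l_cancel_one[of "vec 0 0" "vec 0 0"] by simp
qed

lemma inv_vec [simp]: "inv (vec i j) = vec (- i) (- j)"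
  by (rule inv_equality) (auto simp: vec_mult vec_zero)

lemma dir_vec [simp]: "dir (vec i j) = None"
  by (subst dir_None) (auto intro: range_eqI[of _ _ "(i, j)"])

lemma dir_one [simp]: "dir \<one> = None"
  using dir_vec[of 0 0] by (simp add: vec_zero)

lemma dir_stable [simp]: "dir (\<tau> c e) = Some (0, c, e)"
  using dir_leave[of 0 0 c e] by (simp add: vec_zero)

lemma dir_None_vec:
  assumes "g \<in> carrier G" "dir g = None"
  obtains i j where "g = vec i j"
  using assms dir_None by auto

lemma dir_mult_vec:
  assumes "g \<in> carrier G" "dir g \<noteq> None"
  shows "dir (g \<otimes> vec i j) = dir g"
proof (rule dir_step[OF assms(1) _ assms(2)])
  show "vec i j \<in> S \<union> range (case_prod vec)" by (auto intro: range_eqI[of _ _ "(i, j)"])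
  show "dir (g \<otimes> vec i j) \<noteq> None"
  proof
    assume "dir (g \<otimes> vec i j) = None"
    then obtain k l where "g \<otimes> vec i j = vec k l"
      using dir_None_vec[of "g \<otimes> vec i j"] assms(1) by auto
    then have "g \<otimes> vec i j \<otimes> vec (- i) (- j) = vec (k - i) (l - j)" by (simp add: vec_mult)
    then have "g = vec (k - i) (l - j)" using assms(1) by (simp add: m_assoc vec_mult vec_zero)
    then show False using assms(2) by simp
  qed
qed

lemma dir_inv_None: "g \<in> carrier G \<Longrightarrow> dir (inv g) = None \<longleftrightarrow> dir g = None"
  by (metis inv_closed inv_inv inv_vec dir_None_vec dir_vec)

lemma enter_vertex:
  assumes "g \<in> carrier G" "dir g \<noteq> None" "\<sigma> \<in> S" "dir (g \<otimes> \<sigma>) = None"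
  obtains i j c e where "g \<otimes> \<sigma> = vec i j" "\<sigma> = \<tau> c (\<not> e)" "dir g = Some (coset_rep r c e i j, c, e)"
proof -
  obtain i j where ij: "g \<otimes> \<sigma> = vec i j"
    using dir_None_vec[OF _ assms(4)] assms gen_closed by auto
  have "\<sigma> \<noteq> vec k l" for k l
    using dir_mult_vec[OF assms(1,2)] assms by auto
  then obtain c e' where "\<sigma> = \<tau> c e'"
    using assms(3) by (auto simp: gens)
  then have "\<sigma> = \<tau> c (\<not> (\<not> e'))" by simp
  then obtain e where \<sigma>: "\<sigma> = \<tau> c (\<not> e)" by blast
  have "g = vec i j \<otimes> inv (\<tau> c (\<not> e))"
    using ij assms(1) unfolding \<sigma> by (metis inv_solve_right stable_closed vec_closed)
  then have "g = vec i j \<otimes> \<tau> c e" by simp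
  then show ?thesis using that[OF ij \<sigma>] dir_leave by simp
qed

text \<open>A path that starts behind the edge \<open>(\<rho>, c, e)\<close> can leave its branch of the tree only through \<open>V\<close>,
  and it enters \<open>V\<close> at a point of the line that belongs to this edge.\<close>

lemma cross_word:
  assumes "set ws \<subseteq> S" "u \<in> carrier G" "dir u = Some (\<rho>, c, e)" "dir (u \<otimes> lprod ws) \<noteq> Some (\<rho>, c, e)"
  shows "\<exists>ws1 ws2 i j. ws = ws1 @ \<tau> c (\<not> e) # ws2 \<and> u \<otimes> lprod ws1 \<otimes> \<tau> c (\<not> e) = vec i j \<and> coset_rep r c e i j = \<rho>"
  using assms
proof (induction ws arbitrary: u)
  case (Cons \<sigma> ws)
  have \<sigma>: "\<sigma> \<in> S" "\<sigma> \<in> carrier G" using Cons.prems(1) gen_closed by auto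
  have ws: "set ws \<subseteq> S" using Cons.prems(1) by simp
  show ?case
  proof (cases "dir (u \<otimes> \<sigma>) = None")
    case True
    obtain i j c' e' where *: "u \<otimes> \<sigma> = vec i j" "\<sigma> = \<tau> c' (\<not> e')" "dir u = Some (coset_rep r c' e' i j, c', e')"
      using enter_vertex[OF Cons.prems(2) _ \<sigma>(1) True] Cons.prems(3) by auto
    then have "c' = c" "e' = e" "coset_rep r c e i j = \<rho>" using Cons.prems(3) by auto
    then show ?thesis
      using * Cons.prems(2)
      by (intro exI[of _ "[]"] exI[of _ ws] exI[of _ i] exI[of _ j]) simp
  next
    case False
    then have "dir (u \<otimes> \<sigma>) = Some (\<rho>, c, e)"
      using dir_step[of u \<sigma>] Cons.prems \<sigma> by auto
    moreover have "u \<otimes> \<sigma> \<otimes> lprod ws = u \<otimes> lprod (\<sigma> # ws)"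
      using Cons.prems(2) \<sigma> lprod_closed[OF ws] by (simp add: m_assoc)
    ultimately obtain ws1 ws2 i j where "ws = ws1 @ \<tau> c (\<not> e) # ws2"
      "u \<otimes> \<sigma> \<otimes> lprod ws1 \<otimes> \<tau> c (\<not> e) = vec i j" "coset_rep r c e i j = \<rho>"
      using Cons.IH[OF ws, of "u \<otimes> \<sigma>"] Cons.prems \<sigma> by auto
    then show ?thesis
      using ws \<sigma> Cons.prems(2) lprod_closed[of ws1]
      by (intro exI[of _ "\<sigma> # ws1"] exI[of _ ws2] exI[of _ i] exI[of _ j]) (simp add: m_assoc)
  qed
qed simp

lemma cross:
  assumes u: "u \<in> carrier G" and y: "y \<in> carrier G" and "dir u = Some (\<rho>, c, e)" "dir y \<noteq> Some (\<rho>, c, e)"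
  obtains i j where "coset_rep r c e i j = \<rho>"
    "len (inv u \<otimes> (vec i j \<otimes> \<tau> c e)) + 1 + len (inv (vec i j) \<otimes> y) \<le> len (inv u \<otimes> y)"
proof -
  obtain ws where ws: "set ws \<subseteq> S" "lprod ws = inv u \<otimes> y" "length ws = len (inv u \<otimes> y)"
    using geodesic_word[of "inv u \<otimes> y"] u y by auto
  have y_eq: "y = u \<otimes> lprod ws" using ws u y by (simp add: inv_cancel_left)
  then obtain ws1 ws2 i j where *: "ws = ws1 @ \<tau> c (\<not> e) # ws2"
    "u \<otimes> lprod ws1 \<otimes> \<tau> c (\<not> e) = vec i j" "coset_rep r c e i j = \<rho>"
    using cross_word[OF ws(1) u assms(3)] assms(4) by auto
  have ws12: "set ws1 \<subseteq> S" "set ws2 \<subseteq> S" using ws(1) *(1) by auto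
  note cl = lprod_closed[OF ws12(1)] lprod_closed[OF ws12(2)]
  have "vec i j \<otimes> \<tau> c e = u \<otimes> lprod ws1 \<otimes> \<tau> c (\<not> e) \<otimes> inv (\<tau> c (\<not> e))"
    using *(2) by simp
  also have "\<dots> = u \<otimes> lprod ws1" using u cl by (simp add: m_assoc del: inv_stable)
  finally have "inv u \<otimes> (vec i j \<otimes> \<tau> c e) = lprod ws1" using u cl by (simp add: inv_cancel_left)
  moreover have "y = vec i j \<otimes> lprod ws2"
    using y_eq u cl ws12 *(2) stable_gen unfolding *(1)
    by (simp add: lprod_append m_assoc del: foldr_append flip: *(2))
  then have "inv (vec i j) \<otimes> y = lprod ws2" using cl by (simp add: inv_cancel_left del: inv_vec)
  ultimately show ?thesis
    using that[OF *(3)] len_le[OF ws12(1)] len_le[OF ws12(2)] ws(3) *(1) by simp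
qed

lemma cross_weak:
  assumes u: "u \<in> carrier G" and y: "y \<in> carrier G" and "dir u = Some (\<rho>, c, e)" "dir y \<noteq> Some (\<rho>, c, e)"
  obtains i j where "coset_rep r c e i j = \<rho>"
    "len (inv u \<otimes> vec i j) + len (inv (vec i j) \<otimes> y) \<le> len (inv u \<otimes> y)"
proof -
  obtain i j where *: "coset_rep r c e i j = \<rho>"
    "len (inv u \<otimes> (vec i j \<otimes> \<tau> c e)) + 1 + len (inv (vec i j) \<otimes> y) \<le> len (inv u \<otimes> y)"
    using cross[OF assms] .
  have "inv u \<otimes> vec i j = inv u \<otimes> (vec i j \<otimes> \<tau> c e) \<otimes> inv (\<tau> c e)"
    using u by (simp add: m_assoc del: inv_stable)
  then have "len (inv u \<otimes> vec i j) \<le> len (inv u \<otimes> (vec i j \<otimes> \<tau> c e)) + 1"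
    using len_mult[of "inv u \<otimes> (vec i j \<otimes> \<tau> c e)" "inv (\<tau> c e)"] u len_gen[OF stable_gen, of c "\<not> e"]
    by simp
  then show ?thesis using that[OF *(1)] *(2) by linarith
qed

lemma stay_outside:
  assumes "set ws \<subseteq> S" "x \<in> carrier G" "\<forall>k\<le>length ws. dir (x \<otimes> lprod (take k ws)) \<noteq> None"
  shows "dir (x \<otimes> lprod ws) = dir x"
  using assms
proof (induction ws arbitrary: x)
  case (Cons \<sigma> ws)
  have \<sigma>: "\<sigma> \<in> S" "\<sigma> \<in> carrier G" and ws: "set ws \<subseteq> S" using Cons.prems(1) gen_closed by auto
  have x: "dir x \<noteq> None" "dir (x \<otimes> \<sigma>) \<noteq> None"
    using Cons.prems(3)[rule_format, of 0] Cons.prems(3)[rule_format, of 1] Cons.prems(2) \<sigma> by auto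
  have "dir (x \<otimes> \<sigma> \<otimes> lprod (take k ws)) \<noteq> None" if "k \<le> length ws" for k
    using Cons.prems(3)[rule_format, of "Suc k"] that Cons.prems(2) \<sigma> lprod_closed[of "take k ws"] ws
      set_take_subset[of k ws] by (auto simp: m_assoc)
  then have "dir (x \<otimes> \<sigma> \<otimes> lprod ws) = dir (x \<otimes> \<sigma>)"
    using Cons.IH[OF ws, of "x \<otimes> \<sigma>"] Cons.prems(2) \<sigma> by auto
  then show ?case
    using dir_step[OF Cons.prems(2) _ x] \<sigma> Cons.prems(2) lprod_closed[OF ws] by (simp add: m_assoc)
qed simp

text \<open>A factorisation with the shortest possible tail never returns to \<open>V\<close>.\<close>

lemma last_exit:
  assumes h: "h \<in> carrier G" and "dir h \<noteq> None"
  obtains i j c e ws where "set ws \<subseteq> S" "h = vec i j \<otimes> \<tau> c e \<otimes> lprod ws"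
    "\<forall>k\<le>length ws. dir (vec i j \<otimes> \<tau> c e \<otimes> lprod (take k ws)) \<noteq> None"
proof -
  define P where "P = (\<lambda>n. \<exists>ws i j. set ws \<subseteq> S \<and> h = vec i j \<otimes> lprod ws \<and> length ws = n)"
  obtain ws0 where "set ws0 \<subseteq> S" "lprod ws0 = h" using generating[OF h] by blast
  then have "P (length ws0)"
    unfolding P_def using h by (intro exI[of _ ws0] exI[of _ 0]) (auto simp: vec_zero)
  then have "P (LEAST n. P n)" by (rule LeastI)
  then obtain ws i j where ws: "set ws \<subseteq> S" "h = vec i j \<otimes> lprod ws" "length ws = (LEAST n. P n)"
    unfolding P_def by blast
  have out: "dir (vec i j \<otimes> lprod (take k ws)) \<noteq> None" if k: "0 < k" "k \<le> length ws" for k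
  proof
    assume none: "dir (vec i j \<otimes> lprod (take k ws)) = None"
    have sub: "set (take k ws) \<subseteq> S" "set (drop k ws) \<subseteq> S"
      using ws(1) set_take_subset set_drop_subset by fast+
    note cl = lprod_closed[OF sub(1)] lprod_closed[OF sub(2)]
    obtain i' j' where "vec i j \<otimes> lprod (take k ws) = vec i' j'"
      using dir_None_vec[OF _ none] cl by auto
    moreover have "h = vec i j \<otimes> lprod (take k ws) \<otimes> lprod (drop k ws)"
      using lprod_append[OF sub] ws(2) cl by (simp add: m_assoc)
    ultimately have "P (length (drop k ws))"
      unfolding P_def using sub(2) by (intro exI[of _ "drop k ws"] exI[of _ i'] exI[of _ j']) simp
    then have "(LEAST n. P n) \<le> length (drop k ws)" by (rule Least_le)
    then show False using ws(3) k by simp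
  qed
  have "ws \<noteq> []" using assms(2) ws(2) by auto
  then obtain \<sigma> vs where vs: "ws = \<sigma> # vs" by (cases ws) auto
  have \<sigma>: "\<sigma> \<in> S" "\<sigma> \<in> carrier G" and vsS: "set vs \<subseteq> S" using ws(1) vs gen_closed by auto
  have "dir (vec i j \<otimes> \<sigma>) \<noteq> None" using out[of 1] vs \<sigma> by simp
  then have "\<sigma> \<noteq> vec k l" for k l by (auto simp: vec_mult)
  then obtain c e where ce: "\<sigma> = \<tau> c e" using \<sigma>(1) by (auto simp: gens)
  show ?thesis
  proof (rule that[OF vsS])
    show "h = vec i j \<otimes> \<tau> c e \<otimes> lprod vs"
      using ws(2) vs ce lprod_closed[OF vsS] by (simp add: m_assoc)
    show "\<forall>k\<le>length vs. dir (vec i j \<otimes> \<tau> c e \<otimes> lprod (take k vs)) \<noteq> None"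
    proof (intro allI impI)
      fix k assume "k \<le> length vs"
      moreover have "lprod (take k vs) \<in> carrier G"
        using vsS set_take_subset[of k vs] by (intro lprod_closed) auto
      ultimately show "dir (vec i j \<otimes> \<tau> c e \<otimes> lprod (take k vs)) \<noteq> None"
        using out[of "Suc k"] vs ce by (simp add: m_assoc)
    qed
  qed
qed

lemma dir_vec_mult:
  assumes h: "h \<in> carrier G" and "dir h = Some (\<rho>, c, e)"
  shows "dir (vec k l \<otimes> h) = Some (\<rho> + coset_rep r c e k l, c, e)"
proof -
  obtain i j c' e' ws where ws: "set ws \<subseteq> S" "h = vec i j \<otimes> \<tau> c' e' \<otimes> lprod ws"
    "\<forall>k\<le>length ws. dir (vec i j \<otimes> \<tau> c' e' \<otimes> lprod (take k ws)) \<noteq> None"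
    using last_exit[OF h] assms(2) by (metis option.distinct(1))
  have "dir h = dir (vec i j \<otimes> \<tau> c' e')" unfolding ws(2) by (rule stay_outside[OF ws(1) _ ws(3)]) simp
  then have *: "c' = c" "e' = e" "\<rho> = coset_rep r c e i j" using assms(2) dir_leave by auto
  have eq: "vec k l \<otimes> (vec i j \<otimes> \<tau> c' e' \<otimes> x) = vec (k + i) (l + j) \<otimes> \<tau> c' e' \<otimes> x"
    if "x \<in> carrier G" for x
    using that by (simp add: vec_mult flip: m_assoc)
  have out: "dir (vec (k + i) (l + j) \<otimes> \<tau> c' e' \<otimes> lprod (take m ws)) \<noteq> None" if "m \<le> length ws" for m
  proof
    let ?x = "lprod (take m ws)"
    have x: "?x \<in> carrier G" using ws(1) set_take_subset[of m ws] by (intro lprod_closed) auto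
    assume "dir (vec (k + i) (l + j) \<otimes> \<tau> c' e' \<otimes> ?x) = None"
    then obtain a b where "vec k l \<otimes> (vec i j \<otimes> \<tau> c' e' \<otimes> ?x) = vec a b"
      using dir_None_vec[of "vec (k + i) (l + j) \<otimes> \<tau> c' e' \<otimes> ?x"] x eq by auto
    then have "vec (- k) (- l) \<otimes> (vec k l \<otimes> (vec i j \<otimes> \<tau> c' e' \<otimes> ?x)) = vec (a - k) (b - l)"
      by (simp add: vec_mult)
    then have "vec i j \<otimes> \<tau> c' e' \<otimes> ?x = vec (a - k) (b - l)"
      using x inv_cancel_left(1)[of "vec k l"] by simp
    then show False using ws(3) that by auto
  qed
  have "dir (vec k l \<otimes> h) = dir (vec (k + i) (l + j) \<otimes> \<tau> c' e' \<otimes> lprod ws)"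
    using eq[OF lprod_closed[OF ws(1)]] ws(2) by simp
  also have "\<dots> = dir (vec (k + i) (l + j) \<otimes> \<tau> c' e')"
    by (rule stay_outside[OF ws(1)]) (use out in auto)
  finally show ?thesis using * by (simp add: dir_leave algebra_simps)
qed

text \<open>The tree path from \<open>V\<close> over \<open>gV\<close> to \<open>ghV\<close> has no backtracking at \<open>gV\<close> if the edges from there
  towards \<open>V\<close> and towards \<open>ghV\<close> differ. Following a path for \<open>h\<close> that never returns to \<open>V\<close>, the
  translated path from \<open>g\<close> never meets \<open>V\<close>; otherwise the path for \<open>h\<close> itself would run into the
  branch of the tree that contains \<open>g\<^sup>-\<^sup>1V\<close>.\<close>

lemma no_backtrack:
  assumes g: "g \<in> carrier G" and h: "h \<in> carrier G" and ne: "dir g \<noteq> None" "dir h \<noteq> None"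
    and diff: "dir (inv g) \<noteq> dir h"
  shows "dir (g \<otimes> h) = dir g" "dir (inv (g \<otimes> h)) = dir (inv h)"
proof -
  have main: "dir (g \<otimes> h) = dir g"
    if g: "g \<in> carrier G" and h: "h \<in> carrier G" and ne: "dir g \<noteq> None" "dir h \<noteq> None"
      and diff: "dir (inv g) \<noteq> dir h" for g h
  proof -
    obtain i j c e ws where ws: "set ws \<subseteq> S" "h = vec i j \<otimes> \<tau> c e \<otimes> lprod ws"
      "\<forall>k\<le>length ws. dir (vec i j \<otimes> \<tau> c e \<otimes> lprod (take k ws)) \<noteq> None"
      using last_exit[OF h ne(2)] .
    let ?x = "\<lambda>k. vec i j \<otimes> \<tau> c e \<otimes> lprod (take k ws)"
    have tk: "set (take k ws) \<subseteq> S" for k using ws(1) set_take_subset[of k ws] by auto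
    have x: "?x k \<in> carrier G" for k using lprod_closed[OF tk] by simp
    have stx: "dir (?x k) = dir h" if "k \<le> length ws" for k
    proof -
      have "dir (?x k) = dir (vec i j \<otimes> \<tau> c e)"
        by (rule stay_outside[OF tk]) (use ws(3) that in auto)
      also have "\<dots> = dir h" unfolding ws(2)
        by (rule stay_outside[OF ws(1) _ ws(3), symmetric]) simp
      finally show ?thesis .
    qed
    have "dir (g \<otimes> (?x k)) \<noteq> None" if "k \<le> length ws" for k
    proof
      assume "dir (g \<otimes> ?x k) = None"
      then obtain a b where "g \<otimes> ?x k = vec a b"
        using dir_None_vec[of "g \<otimes> ?x k"] g x[of k] by auto
      then have "inv g \<otimes> (g \<otimes> ?x k) = inv g \<otimes> vec a b" by simp
      then have "?x k = inv g \<otimes> vec a b" using g x[of k] by (simp add: inv_cancel_left)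
      then have "dir (?x k) = dir (inv g)" using dir_mult_vec[of "inv g" a b] g ne by (simp add: dir_inv_None)
      then show False using stx[OF that] diff by simp
    qed
    then have out: "\<forall>k\<le>length ws. dir (g \<otimes> (vec i j \<otimes> \<tau> c e) \<otimes> lprod (take k ws)) \<noteq> None"
      using g lprod_closed[OF tk] by (simp add: m_assoc)
    have "dir (g \<otimes> h) = dir (g \<otimes> (vec i j \<otimes> \<tau> c e) \<otimes> lprod ws)"
      using g lprod_closed[OF ws(1)] unfolding ws(2) by (simp add: m_assoc)
    also have "\<dots> = dir (g \<otimes> (vec i j \<otimes> \<tau> c e))"
      by (rule stay_outside[OF ws(1) _ out]) (use g in simp)
    also have "\<dots> = dir (g \<otimes> vec i j \<otimes> \<tau> c e)" using g by (simp add: m_assoc)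
    also have "\<dots> = dir (g \<otimes> vec i j)"
    proof (rule dir_step)
      show "dir (g \<otimes> vec i j \<otimes> \<tau> c e) \<noteq> None"
        using out[rule_format, of 0] g by (simp add: m_assoc)
    qed (use g ne stable_gen dir_mult_vec in auto)
    finally show ?thesis using dir_mult_vec[OF g ne(1)] by simp
  qed
  show "dir (g \<otimes> h) = dir g" using main[OF g h ne diff] .
  have "dir (inv h \<otimes> inv g) = dir (inv h)"
    by (rule main) (use g h ne diff in \<open>auto simp: dir_inv_None\<close>)
  then show "dir (inv (g \<otimes> h)) = dir (inv h)" using g h by (simp add: inv_mult_group)
qed

definition axis_len :: "int \<Rightarrow> int" where "axis_len x = int (len (vec x 0))"
text \<open>The length of \<open>(a\<^sup>rb\<^sup>\<plusminus>\<^sup>1)\<^sup>x\<close> as far as it is realised by conjugating \<open>a\<^sup>x\<close> with a stable letter;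
  it turns out to be the true length.\<close>

definition skew_len :: "int \<Rightarrow> int" where "skew_len x = (if x = 0 then 0 else 2 + axis_len x)"

definition edge_elem :: "bool \<Rightarrow> bool \<Rightarrow> int \<Rightarrow> 'a" where
  "edge_elem c e m = (if e then vec m 0 else vec (int r * m) (slope c * m))"

lemma edge_elem_closed [simp]: "edge_elem c e m \<in> carrier G" by (simp add: edge_elem_def)

lemma coset_rep_0_iff: "coset_rep r c e i j = 0 \<longleftrightarrow> (\<exists>m. vec i j = edge_elem c e m)"
proof (cases e)
  case False
  have "i = int r * slope c * j" if "i = int r * m" "j = slope c * m" for m using that by simp
  moreover have "\<exists>m. i = int r * m \<and> j = slope c * m" if "i = int r * slope c * j"
    using that by (intro exI[of _ "slope c * j"]) simp
  ultimately show ?thesis using False by (auto simp: edge_elem_def vec_inject)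
qed (auto simp: edge_elem_def vec_inject)

lemma conj_edge_elem: "\<tau> c (\<not> e) \<otimes> edge_elem c e m \<otimes> \<tau> c e = edge_elem c (\<not> e) m"
proof (cases e)
  case True then show ?thesis using conj_stable by (simp add: edge_elem_def)
next
  case False
  have "\<tau> c True \<otimes> (\<tau> c False \<otimes> vec m 0 \<otimes> \<tau> c True) \<otimes> \<tau> c False = vec m 0"
    using inv_cancel_left[of "\<tau> c True"] r_inv[of "\<tau> c True"] by (simp add: m_assoc del: r_inv)
  then show ?thesis using False by (simp add: conj_stable edge_elem_def)
qed

lemma axis_len_nonneg: "axis_len x \<ge> 0" by (simp add: axis_len_def)
lemma axis_len_zero [simp]: "axis_len 0 = 0" by (simp add: axis_len_def vec_zero)

lemma axis_len_add: "axis_len (x + y) \<le> axis_len x + axis_len y"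
  using len_mult[of "vec x 0" "vec y 0"] by (simp add: axis_len_def vec_mult)

lemma axis_len_minus [simp]: "axis_len (- x) = axis_len x"
  using len_inv[of "vec x 0"] by (simp add: axis_len_def)

lemma axis_len_le_abs: "axis_len x \<le> \<bar>x\<bar>"
proof -
  have nat: "axis_len (int n) \<le> int n" for n
  proof (induction n)
    case (Suc n)
    have "vec 1 0 \<in> S" by (simp add: gens)
    then have "axis_len 1 = 1" using len_gen by (simp add: axis_len_def)
    then show ?case using axis_len_add[of "int n" 1] Suc by (simp add: add.commute)
  qed simp
  show ?thesis
  proof (cases "x \<ge> 0")
    case True then show ?thesis using nat[of "nat x"] by simp
  next
    case False then show ?thesis using nat[of "nat (- x)"] by simp
  qed
qed

lemma skew_len_add: "skew_len (x + y) \<le> skew_len x + skew_len y"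
  using axis_len_add[of x y] axis_len_nonneg[of x] axis_len_nonneg[of y] by (auto simp: skew_len_def)

text \<open>This is where \<open>r \<ge> 3\<close> enters. The critical case is \<open>i + d = 0\<close>: the left-hand side is then at most
  \<open>2 + \<bar>d\<bar>\<close>, where 2 counts the two stable letters.\<close>

lemma skew_len_shift: "skew_len i \<le> skew_len (i + d) + int r * \<bar>d\<bar>"
proof (cases "d = 0 \<or> i = 0")
  case True then show ?thesis using axis_len_nonneg[of d] by (auto simp: skew_len_def)
next
  case False
  have "3 * \<bar>d\<bar> \<le> int r * \<bar>d\<bar>" using r3 by (intro mult_right_mono) auto
  moreover have "\<bar>d\<bar> \<ge> 1" using False by linarith
  ultimately have rd: "2 + \<bar>d\<bar> \<le> int r * \<bar>d\<bar>" by linarith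
  have "axis_len i \<le> axis_len (i + d) + \<bar>d\<bar>" using axis_len_add[of "i + d" "- d"] axis_len_le_abs[of d] by simp
  moreover have "0 \<le> axis_len (i + d)" by (rule axis_len_nonneg)
  ultimately show ?thesis using False rd unfolding skew_len_def by (cases "i + d = 0") auto
qed

text \<open>The vector \<open>a\<^sup>ib\<^sup>j\<close> is a product of a power of \<open>e\<^sub>1\<close>, a power of \<open>e\<^sub>2\<close> and a power of \<open>a\<close>, each
  written in the obvious way, with at most \<open>n\<close> letters altogether.\<close>

definition decomposes :: "int \<Rightarrow> int \<Rightarrow> int \<Rightarrow> bool" where
  "decomposes i j n \<longleftrightarrow> (\<exists>x y k. int r * (x + y) + k = i \<and> x - y = j \<and> skew_len x + skew_len y + \<bar>k\<bar> \<le> n)"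

lemma decomposes_add: "decomposes i j m \<Longrightarrow> decomposes i' j' n \<Longrightarrow> decomposes (i + i') (j + j') (m + n)"
proof -
  assume "decomposes i j m" "decomposes i' j' n"
  then obtain x y k x' y' k' where
    "int r * (x + y) + k = i" "x - y = j" "skew_len x + skew_len y + \<bar>k\<bar> \<le> m"
    "int r * (x' + y') + k' = i'" "x' - y' = j'" "skew_len x' + skew_len y' + \<bar>k'\<bar> \<le> n"
    unfolding decomposes_def by blast
  then have "int r * ((x + x') + (y + y')) + (k + k') = i + i'" "(x + x') - (y + y') = j + j'"
    "skew_len (x + x') + skew_len (y + y') + \<bar>k + k'\<bar> \<le> m + n"
    using skew_len_add[of x x'] skew_len_add[of y y'] by (auto simp: algebra_simps)
  then show ?thesis unfolding decomposes_def by blast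
qed

lemma decomposes_mono: "decomposes i j m \<Longrightarrow> m \<le> n \<Longrightarrow> decomposes i j n"
  unfolding decomposes_def by (elim exE conjE) (intro exI conjI, assumption+, linarith)

text \<open>Any other decomposition of \<open>e\<^sub>1\<^sup>xe\<^sub>2\<^sup>y\<close> arises from the relation \<open>e\<^sub>1e\<^sub>2 = a\<^sup>2\<^sup>r\<close> by shifting both
  exponents by some \<open>d\<close> and paying \<open>2r\<bar>d\<bar>\<close> letters \<open>a\<close>, which is never cheaper.\<close>

lemma decomposes_sum:
  assumes "decomposes (int r * (x + y)) (x - y) n"
  shows "skew_len x + skew_len y \<le> n"
proof -
  obtain x' y' k where *: "int r * (x' + y') + k = int r * (x + y)" "x' - y' = x - y" "skew_len x' + skew_len y' + \<bar>k\<bar> \<le> n"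
    using assms unfolding decomposes_def by blast
  define d where "d = x' - x"
  have d: "x' = x + d" "y' = y + d" using *(2) by (auto simp: d_def)
  have "k = - 2 * (int r * d)" using *(1) unfolding d by (simp add: algebra_simps)
  then have "\<bar>k\<bar> = 2 * (int r * \<bar>d\<bar>)" by (simp add: abs_mult)
  then show ?thesis using skew_len_shift[of x d] skew_len_shift[of y d] *(3) d by simp
qed

lemma decomposes_edge_elem: "decomposes (int r * m) (slope c * m) (skew_len m)"
  unfolding decomposes_def
  by (cases c; intro exI[of _ "if c then m else 0"] exI[of _ "if c then 0 else m"] exI[of _ 0])
    (auto simp: slope_def skew_len_def)

text \<open>By induction on the length, shortest words for elements of \<open>V\<close> may be taken of the obvious form.
  A word that starts with a stable letter returns to \<open>V\<close> for the first time by the inverse letter,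
  and the part in between represents an element of an edge group. An excursion from \<open>e\<^sub>1\<^sup>m\<close> or
  \<open>e\<^sub>2\<^sup>m\<close> into the neighbour in which it is \<open>a\<^sup>m\<close> is part of the obvious form; an excursion in the
  opposite direction wastes four letters.\<close>

lemma vertex_norm: "decomposes i j (int (len (vec i j)))"
proof (induction "len (vec i j)" arbitrary: i j rule: less_induct)
  case less
  show ?case
  proof (cases "vec i j = \<one>")
    case True
    then have "i = 0" "j = 0" using vec_inject[of i j 0 0] by (simp_all add: vec_zero)
    then show ?thesis by (auto simp: decomposes_def vec_zero skew_len_def intro!: exI[of _ 0])
  next
    case False
    then obtain \<sigma> h where \<sigma>: "\<sigma> \<in> S" "h \<in> carrier G" "vec i j = \<sigma> \<otimes> h" "len (vec i j) = Suc (len h)"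
      using len_Suc_split[of "vec i j"] by auto
    then have h: "h = inv \<sigma> \<otimes> vec i j" using gen_closed by (simp add: inv_cancel_left)
    consider (base) s :: int where "\<bar>s\<bar> = 1" "\<sigma> = vec s 0" | (stable) c e where "\<sigma> = \<tau> c e"
      using \<sigma>(1) unfolding gens by (auto simp: vec_inject)
    then show ?thesis
    proof cases
      case base
      then have h: "h = vec (i - s) j" using h by (simp add: vec_mult)
      have "decomposes (i - s) j (int (len h))" using less[of "i - s" j] h \<sigma>(4) by simp
      moreover have "decomposes s 0 1"
        unfolding decomposes_def using base(1) by (intro exI[of _ 0] exI[of _ s]) (auto simp: skew_len_def)
      ultimately have "decomposes (i - s + s) (j + 0) (int (len h) + 1)" by (rule decomposes_add)
      then show ?thesis using \<sigma>(4) by (simp add: add.commute)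
    next
      case stable
      obtain k l where kl: "coset_rep r c e k l = 0"
        "len (inv (\<tau> c e) \<otimes> (vec k l \<otimes> \<tau> c e)) + 1 + len (inv (vec k l) \<otimes> vec i j) \<le> len (inv (\<tau> c e) \<otimes> vec i j)"
        using cross[of "\<tau> c e" "vec i j" 0 c e] by auto
      then obtain m where m: "vec k l = edge_elem c e m" using coset_rep_0_iff by blast
      have "inv (\<tau> c e) \<otimes> (vec k l \<otimes> \<tau> c e) = edge_elem c (\<not> e) m"
        using conj_edge_elem[of c e m] m by (simp add: m_assoc)
      then have le: "len (edge_elem c (\<not> e) m) + 2 + len (vec (i - k) (j - l)) \<le> len (vec i j)"
        using kl(2) h stable \<sigma>(4) by (simp add: vec_mult)
      have rest: "decomposes (i - k) (j - l) (int (len (vec (i - k) (j - l))))"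
        using less[of "i - k" "j - l"] le by simp
      have "decomposes k l (int (len (edge_elem c (\<not> e) m)) + 2)"
      proof (cases e)
        case True
        then have kl': "k = m" "l = 0" using m by (auto simp: edge_elem_def vec_inject)
        have dec: "decomposes (int r * m) (slope c * m) (int (len (edge_elem c (\<not> e) m)))"
          using less[of "int r * m" "slope c * m"] le True by (simp add: edge_elem_def)
        have "skew_len m + skew_len 0 \<le> int (len (edge_elem c (\<not> e) m))"
        proof (cases c)
          case True then show ?thesis using dec decomposes_sum[of m 0] by (simp add: slope_def)
        next
          case False then show ?thesis using dec decomposes_sum[of 0 m] by (simp add: slope_def add.commute)
        qed
        then have fm: "m = 0 \<or> axis_len m + 2 \<le> int (len (edge_elem c (\<not> e) m))" by (auto simp: skew_len_def split: if_splits)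
        show ?thesis
        proof (cases "m = 0")
          case True
          then show ?thesis unfolding decomposes_def kl' by (intro exI[of _ 0]) (simp add: skew_len_def)
        next
          case False
          then have "decomposes m 0 (axis_len m)"
            using fm le less[of m 0] by (auto simp: axis_len_def)
          then show ?thesis using fm False kl' decomposes_mono by auto
        qed
      next
        case False
        then have kl': "k = int r * m" "l = slope c * m" using m by (auto simp: edge_elem_def vec_inject)
        have "skew_len m \<le> int (len (edge_elem c (\<not> e) m)) + 2" using False by (simp add: edge_elem_def skew_len_def axis_len_def)
        then show ?thesis using decomposes_edge_elem kl' decomposes_mono by blast
      qed
      from decomposes_add[OF this rest] show ?thesis using le decomposes_mono by simp
    qed
  qed
qed

lemma len_edge_elem_le: "int (len (edge_elem c False m)) \<le> skew_len m"
proof (cases "m = 0")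
  case False
  have "len (edge_elem c False m) = len (\<tau> c False \<otimes> edge_elem c True m \<otimes> \<tau> c True)"
    using conj_edge_elem[of c True m] by simp
  also have "\<dots> \<le> 1 + len (edge_elem c True m) + 1"
    using len_mult[of "\<tau> c False \<otimes> edge_elem c True m" "\<tau> c True"] len_mult[of "\<tau> c False" "edge_elem c True m"]
      len_gen[OF stable_gen] by (simp add: add.commute)
  finally show ?thesis using False by (simp add: skew_len_def axis_len_def edge_elem_def)
qed (simp add: edge_elem_def vec_zero skew_len_def)

lemma len_transverse: "len (edge_elem True False m) + len (edge_elem False False n) \<le> len (inv (edge_elem True False m) \<otimes> edge_elem False False n)"
proof -
  have "inv (edge_elem True False m) \<otimes> edge_elem False False n = vec (int r * (- m + n)) (- m - n)"
    by (simp add: edge_elem_def vec_mult slope_def algebra_simps)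
  then have "skew_len (- m) + skew_len n \<le> int (len (inv (edge_elem True False m) \<otimes> edge_elem False False n))"
    using decomposes_sum[of "- m" n] vertex_norm[of "int r * (- m + n)" "- m - n"] by simp
  then show ?thesis using len_edge_elem_le[of True m] len_edge_elem_le[of False n]
    by (simp add: skew_len_def split: if_splits)
qed

end

section \<open>The monoid of elements between two cut points\<close>

declare coset_rep.simps [simp del]

context snowflake_tree
begin

text \<open>Apart from the identity, the elements \<open>x\<close> such that the tree path from \<open>V\<close> to \<open>xV\<close> starts with the
  edge labelled \<open>t\<^sup>-\<^sup>1\<close> at the coset \<open>\<langle>e\<^sub>2\<rangle>\<close> and, read backwards from \<open>xV\<close>, with the translate by
  \<open>x\<close> of the edge labelled \<open>s\<^sup>-\<^sup>1\<close> at \<open>\<langle>e\<^sub>1\<rangle>\<close>.\<close>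

definition cut_elements :: "'a set" where
  "cut_elements = insert \<one> {x \<in> carrier G. dir x = Some (0, False, False) \<and> dir (inv x) = Some (0, True, False)}"

text \<open>Translate so that the middle point \<open>x\<close> becomes the identity. A shortest path from \<open>x\<^sup>-\<^sup>1\<close> to \<open>y\<close>
  meets \<open>\<langle>e\<^sub>1\<rangle>\<close> in some \<open>v\<close> and later \<open>\<langle>e\<^sub>2\<rangle>\<close> in some \<open>w\<close>. By the perpendicularity of the two
  lines its part from \<open>v\<close> to \<open>w\<close> may be replaced by a path through the identity.\<close>

lemma cut_mult:
  assumes x: "x \<in> carrier G" "dir (inv x) = Some (0, True, False)"
    and y: "y \<in> carrier G" "dir y = Some (0, False, False)"
  shows "dir (x \<otimes> y) = dir x" "dir (inv (x \<otimes> y)) = dir (inv y)" "len (x \<otimes> y) = len x + len y"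
proof -
  have xN: "dir x \<noteq> None" using x dir_inv_None[of x] by auto
  show "dir (x \<otimes> y) = dir x" "dir (inv (x \<otimes> y)) = dir (inv y)"
    using no_backtrack[of x y] x y xN by simp_all
  obtain i j where ij: "coset_rep r True False i j = 0"
    "len (inv (inv x) \<otimes> vec i j) + len (inv (vec i j) \<otimes> y) \<le> len (inv (inv x) \<otimes> y)"
    by (rule cross_weak[of "inv x" y 0 True False]) (use x y in simp_all)
  obtain k l where kl: "coset_rep r False False k l = 0"
    "len (inv y \<otimes> vec k l) + len (inv (vec k l) \<otimes> vec i j) \<le> len (inv y \<otimes> vec i j)"
    by (rule cross_weak[of y "vec i j" 0 False False]) (use y in simp_all)
  obtain m n where mn: "vec i j = edge_elem True False m" "vec k l = edge_elem False False n"
    using coset_rep_0_iff ij(1) kl(1) by blast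
  have flip: "len (inv g \<otimes> h) = len (inv h \<otimes> g)" if "g \<in> carrier G" "h \<in> carrier G" for g h
    using len_inv[of "inv g \<otimes> h"] that by (simp add: inv_mult_group)
  have "len (vec i j) + len (vec k l) \<le> len (inv (vec i j) \<otimes> vec k l)"
    unfolding mn by (rule len_transverse)
  moreover have "len (x \<otimes> vec i j) + len (inv (vec i j) \<otimes> y) \<le> len (x \<otimes> y)" using ij(2) x by simp
  moreover have "len (inv (vec k l) \<otimes> y) + len (inv (vec i j) \<otimes> vec k l) \<le> len (inv (vec i j) \<otimes> y)"
    using kl(2) flip[of y "vec k l"] flip[of "vec k l" "vec i j"] flip[of y "vec i j"] y by simp
  moreover have "len x \<le> len (x \<otimes> vec i j) + len (vec i j)"
    using len_mult[of "x \<otimes> vec i j" "inv (vec i j)"] x len_inv[of "vec i j"] by (simp add: m_assoc del: inv_vec len_inv)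
  moreover have "len y \<le> len (vec k l) + len (inv (vec k l) \<otimes> y)"
    using len_mult[of "vec k l" "inv (vec k l) \<otimes> y"] y by (simp add: inv_cancel_left del: inv_vec)
  ultimately show "len (x \<otimes> y) = len x + len y" using len_mult[of x y] x y by linarith
qed

lemma cut_mult_closed:
  assumes "x \<in> cut_elements" "y \<in> cut_elements"
  shows "x \<otimes> y \<in> cut_elements" "len (x \<otimes> y) = len x + len y"
  using assms cut_mult[of x y] by (auto simp: cut_elements_def)

lemma cut_vertex_disjoint:
  assumes "x \<in> cut_elements" "x = vec i j"
  shows "x = \<one>"
  using assms by (auto simp: cut_elements_def)

text \<open>Both \<open>xV\<close> and \<open>x'V\<close> lie on the tree path from \<open>V\<close> to \<open>xyV\<close>. If they coincide, then \<open>z = x\<^sup>-\<^sup>1x'\<close>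
  fixes a line in direction \<open>e\<^sub>1\<close> and one in direction \<open>e\<^sub>2\<close> and so is trivial. Otherwise one of
  them comes first, and \<open>z\<close> or its inverse is a cut element. In terms of first edges: since \<open>z\<close>
  carries \<open>y'\<close> to \<open>y\<close> and \<open>x'\<^sup>-\<^sup>1\<close> to \<open>x\<^sup>-\<^sup>1\<close>, each of the two directions is either that of \<open>z\<close> or
  that of \<open>z\<^sup>-\<^sup>1\<close>.\<close>

lemma cut_levi:
  assumes xy: "x \<in> cut_elements" "y \<in> cut_elements" "x' \<in> cut_elements" "y' \<in> cut_elements"
    and eq: "x \<otimes> y = x' \<otimes> y'"
  shows "(\<exists>z\<in>cut_elements. x' = x \<otimes> z) \<or> (\<exists>z\<in>cut_elements. x = x' \<otimes> z)"
proof -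
  have car: "x \<in> carrier G" "y \<in> carrier G" "x' \<in> carrier G" "y' \<in> carrier G"
    using xy by (auto simp: cut_elements_def)
  show ?thesis
  proof (cases "x = \<one> \<or> y = \<one> \<or> x' = \<one> \<or> y' = \<one>")
    case True
    then consider "x = \<one>" | "y = \<one>" | "x' = \<one>" | "y' = \<one>" by blast
    then show ?thesis
    proof cases
      case 1
      then have "x' = x \<otimes> x'" using car by simp
      then show ?thesis using xy by blast
    next
      case 2
      then have "x = x' \<otimes> y'" using car eq by simp
      then show ?thesis using xy by blast
    next
      case 3
      then have "x = x' \<otimes> x" using car by simp
      then show ?thesis using xy by blast
    next
      case 4
      then have "x' = x \<otimes> y" using car eq by simp
      then show ?thesis using xy by blast
    qed
  next
    case False
    then have dirs: "dir (inv x) = Some (0, True, False)" "dir (inv x') = Some (0, True, False)"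
      "dir y = Some (0, False, False)" "dir y' = Some (0, False, False)"
      using xy by (auto simp: cut_elements_def)
    define z where "z = inv x \<otimes> x'"
    have z: "z \<in> carrier G" "x' = x \<otimes> z" using car by (auto simp: z_def inv_cancel_left)
    have "x \<otimes> y = x \<otimes> (z \<otimes> y')" using eq car z by (simp add: m_assoc)
    then have y: "y = z \<otimes> y'" using car z by simp
    have y': "y' = inv z \<otimes> y" using y car z by (simp add: inv_cancel_left)
    have x'i: "inv x' = inv z \<otimes> inv x" using z car by (simp add: inv_mult_group)
    show ?thesis
    proof (cases "dir z = None")
      case True
      then obtain i j where ij: "z = vec i j" using dir_None_vec z by blast
      have "coset_rep r False False i j = 0"
        using dir_vec_mult[OF car(4) dirs(4), of i j] y ij dirs(3) by simp
      moreover have "coset_rep r True False (- i) (- j) = 0"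
        using dir_vec_mult[of "inv x" 0 True False "- i" "- j"] x'i ij dirs car by simp
      ultimately have "i = 0" "j = 0" using r3 by (auto simp: slope_def coset_rep.simps)
      then have "z = \<one>" using ij vec_zero by simp
      then show ?thesis using z car by (intro disjI1 bexI[of _ \<one>]) (auto simp: cut_elements_def)
    next
      case False
      then have zi: "dir (inv z) \<noteq> None" using dir_inv_None z by simp
      have a: "dir (inv z) = Some (0, False, False)" if "dir z \<noteq> Some (0, False, False)"
        using no_backtrack(1)[of "inv z" y] that dirs z car zi y' by simp
      have b: "dir (inv z) = Some (0, True, False)" if "dir z \<noteq> Some (0, True, False)"
        using no_backtrack(1)[of "inv z" "inv x"] that dirs z car zi x'i by simp
      show ?thesis
      proof (cases "dir z = Some (0, False, False)")
        case True
        then have "z \<in> cut_elements" using b z by (simp add: cut_elements_def)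
        then show ?thesis using z by blast
      next
        case f: False
        then have "dir z = Some (0, True, False)" using a b by auto
        then have "inv z \<in> cut_elements" using a f z by (simp add: cut_elements_def)
        moreover have "x = x' \<otimes> inv z" using z car by (simp add: m_assoc)
        ultimately show ?thesis by blast
      qed
    qed
  qed
qed

text \<open>One inverse stable letter is enough unless it cancels against \<open>g\<close>; in that case the inverse of the
  other stable letter is put in between.\<close>

lemma left_pad:
  assumes g: "g \<in> carrier G"
  obtains p where "p \<in> carrier G" "len p \<le> 2" "dir (p \<otimes> g) = Some (0, c, False)"
    "dir g \<noteq> None \<Longrightarrow> dir (inv (p \<otimes> g)) = dir (inv g)"
proof -
  have one: "dir (\<tau> d False \<otimes> g) = Some (0, d, False) \<and> (dir g \<noteq> None \<longrightarrow> dir (inv (\<tau> d False \<otimes> g)) = dir (inv g))"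
    if gd: "g \<in> carrier G" "dir g \<noteq> Some (0, d, True)" for d g
  proof (cases "dir g = None")
    case True
    obtain i j where "g = vec i j" using dir_None_vec[OF gd(1) True] .
    then show ?thesis using dir_mult_vec[of "\<tau> d False" i j] by simp
  next
    case False
    then have "dir (inv (\<tau> d False)) \<noteq> dir g" using gd by simp
    then show ?thesis using no_backtrack[of "\<tau> d False" g] gd False by simp
  qed
  show ?thesis
  proof (cases "dir g = Some (0, c, True)")
    case False
    show ?thesis
      by (rule that[of "\<tau> c False"]) (use one[OF g False] len_gen[OF stable_gen, of c False] in simp_all)
  next
    case True
    then have 1: "dir (\<tau> (\<not> c) False \<otimes> g) = Some (0, \<not> c, False)" "dir (inv (\<tau> (\<not> c) False \<otimes> g)) = dir (inv g)"
      using one[OF g, of "\<not> c"] by simp_all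
    then have 2: "dir (\<tau> c False \<otimes> (\<tau> (\<not> c) False \<otimes> g)) = Some (0, c, False)"
      "dir (inv (\<tau> c False \<otimes> (\<tau> (\<not> c) False \<otimes> g))) = dir (inv g)"
      using one[of "\<tau> (\<not> c) False \<otimes> g" c] g by simp_all
    show ?thesis
    proof (rule that[of "\<tau> c False \<otimes> \<tau> (\<not> c) False"])
      show "len (\<tau> c False \<otimes> \<tau> (\<not> c) False) \<le> 2"
        using len_mult[of "\<tau> c False" "\<tau> (\<not> c) False"] len_gen[OF stable_gen] by simp
    qed (use 2 g in \<open>simp_all add: m_assoc del: inv_stable\<close>)
  qed
qed

lemma cut_padding:
  assumes g: "g \<in> carrier G"
  shows "\<exists>p\<in>carrier G. \<exists>q\<in>carrier G. len p \<le> 2 \<and> len q \<le> 2 \<and> p \<otimes> g \<otimes> q \<in> cut_elements"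
proof -
  obtain q where q: "q \<in> carrier G" "len q \<le> 2" "dir (q \<otimes> inv g) = Some (0, True, False)"
    by (rule left_pad[of "inv g" True]) (use g in simp_all)
  define h where "h = g \<otimes> inv q"
  have h: "h \<in> carrier G" "inv h = q \<otimes> inv g" using g q by (auto simp: h_def inv_mult_group)
  have "dir h \<noteq> None" using dir_inv_None[OF h(1)] h q by simp
  obtain p where p: "p \<in> carrier G" "len p \<le> 2" "dir (p \<otimes> h) = Some (0, False, False)"
    "dir (inv (p \<otimes> h)) = dir (inv h)"
    by (rule left_pad[OF h(1), of False]) (use \<open>dir h \<noteq> None\<close> in simp_all)
  have "p \<otimes> h \<in> cut_elements" using p h q by (simp add: cut_elements_def)
  moreover have "p \<otimes> h = p \<otimes> g \<otimes> inv q" using p g q by (simp add: h_def m_assoc)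
  ultimately show ?thesis using p q by (intro bexI[of _ p] bexI[of _ "inv q"]) auto
qed

text \<open>If \<open>n\<close> is outside the edge group \<open>\<langle>a\<rangle>\<close>, then conjugation by a stable letter lengthens the tree path,
  provided that no cancellation occurs on either side.\<close>

lemma conj_stable_dir:
  assumes n: "n \<in> carrier G" and not_axis: "\<And>m. n \<noteq> vec m 0"
    and "dir n \<noteq> Some (0, c, True)" "dir (inv n) \<noteq> Some (0, c, True)"
  shows "dir (\<tau> c False \<otimes> n \<otimes> \<tau> c True) = Some (0, c, False)"
proof (cases "dir n = None")
  case True
  then obtain i j where ij: "n = vec i j" using dir_None_vec n by blast
  then have "j \<noteq> 0" using not_axis by auto
  then show ?thesis
    using no_backtrack(1)[of "\<tau> c False" "n \<otimes> \<tau> c True"] ij by (simp add: dir_leave m_assoc coset_rep.simps)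
next
  case False
  then have "dir (\<tau> c False \<otimes> n) = Some (0, c, False)" "dir (inv (\<tau> c False \<otimes> n)) = dir (inv n)"
    using no_backtrack[of "\<tau> c False" n] assms by simp_all
  then show ?thesis using no_backtrack(1)[of "\<tau> c False \<otimes> n" "\<tau> c True"] assms by simp
qed

text \<open>Conjugating an element of \<open>N\<close> by \<open>t\<^sup>-\<^sup>1\<close> makes it start with \<open>t\<^sup>-\<^sup>1\<close> and end with \<open>t\<close>, conjugating it
  by \<open>s\<^sup>-\<^sup>1\<close> makes it start with \<open>s\<^sup>-\<^sup>1\<close> and end with \<open>s\<close>. The product of the two conjugates is a
  cut element. A preliminary conjugation makes sure that nothing cancels.\<close>

lemma normal_meets_cut_elements:
  assumes N: "N \<lhd> G" and n: "n \<in> N" "n \<noteq> \<one>"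
  obtains h where "h \<in> cut_elements" "h \<in> N" "h \<noteq> \<one>"
proof -
  interpret N: normal N G by fact
  have nc: "n \<in> carrier G" using n N.subset by blast
  have conjN: "g \<otimes> x \<otimes> inv g \<in> N" if "g \<in> carrier G" "x \<in> N" for g x
    using N.inv_op_closed2 that by blast
  obtain m where m: "m \<in> N" "\<And>k. m \<noteq> vec k 0" "\<And>c. dir m \<noteq> Some (0, c, True)" "\<And>c. dir (inv m) \<noteq> Some (0, c, True)"
  proof (cases "dir n = None")
    case True
    then obtain i j where ij: "n = vec i j" using dir_None_vec nc by blast
    show ?thesis
    proof (cases "j = 0")
      case False
      then show ?thesis using that[of n] n ij by (simp add: vec_inject)
    next
      case True
      then have i: "i \<noteq> 0" using ij n vec_zero by auto
      \<comment> \<open>a power of \<open>a\<close> is conjugate to a power of \<open>e\<^sub>1\<close>\<close>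
      have "\<tau> True False \<otimes> n \<otimes> \<tau> True True = vec (int r * i) i"
        using ij True conj_stable[of True i] by (simp add: slope_def)
      then have "vec (int r * i) i \<in> N" using conjN[of "\<tau> True False" n] n by simp
      then show ?thesis using that[of "vec (int r * i) i"] i by (simp add: vec_inject)
    qed
  next
    case False
    then obtain \<rho> c e \<rho>' c' e' where dirs: "dir n = Some (\<rho>, c, e)" "dir (inv n) = Some (\<rho>', c', e')"
      using dir_inv_None[OF nc] by (metis option.exhaust prod_cases3)
    \<comment> \<open>conjugation by \<open>b\<^sup>k\<close> adds \<open>k\<close> to the coset of a first edge with positive letter, so that it is
      no longer 0 for \<open>n\<close> nor for its inverse\<close>
    define k where "k = \<bar>\<rho>\<bar> + \<bar>\<rho>'\<bar> + 1"
    define m where "m = vec 0 k \<otimes> n \<otimes> vec 0 (- k)"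
    have mi: "inv m = vec 0 k \<otimes> inv n \<otimes> vec 0 (- k)"
      using nc by (simp add: m_def inv_mult_group m_assoc)
    have stm: "dir m = Some (\<rho> + coset_rep r c e 0 k, c, e)" "dir (inv m) = Some (\<rho>' + coset_rep r c' e' 0 k, c', e')"
      unfolding mi unfolding m_def
      using dir_vec_mult[OF nc dirs(1), of 0 k] dir_vec_mult[OF inv_closed[OF nc] dirs(2), of 0 k] nc
      by (simp_all add: dir_mult_vec)
    have "\<rho> + k \<noteq> 0" "\<rho>' + k \<noteq> 0" by (auto simp: k_def)
    moreover have "m \<in> N" using conjN[of "vec 0 k" n] n by (simp add: m_def)
    moreover have "m \<noteq> vec l 0" for l using stm(1) by auto
    ultimately show ?thesis
      by (intro that[of m]) (use stm in \<open>auto simp: coset_rep.simps\<close>)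
  qed
  have mc: "m \<in> carrier G" using m(1) N.subset by blast
  have mi: "inv m \<noteq> vec k 0" for k
    using m(2)[of "- k"] mc by (metis inv_inv inv_vec minus_zero)
  define x where "x = (\<lambda>c. \<tau> c False \<otimes> m \<otimes> \<tau> c True)"
  have xc: "x c \<in> carrier G" and xN: "x c \<in> N" for c
    using mc conjN[of "\<tau> c False" m] m(1) by (auto simp: x_def)
  have xi: "inv (x c) = \<tau> c False \<otimes> inv m \<otimes> \<tau> c True" for c
    using mc by (simp add: x_def inv_mult_group m_assoc)
  have stx: "dir (x c) = Some (0, c, False)" "dir (inv (x c)) = Some (0, c, False)" for c
    unfolding xi unfolding x_def using conj_stable_dir[of m c] conj_stable_dir[of "inv m" c] m mc mi by simp_all
  have "dir (x False \<otimes> x True) = Some (0, False, False)" "dir (inv (x False \<otimes> x True)) = Some (0, True, False)"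
    using no_backtrack[of "x False" "x True"] xc stx by simp_all
  moreover have "x False \<otimes> x True \<in> N" using xN by simp
  moreover have "x False \<otimes> x True \<noteq> \<one>" using calculation(1) dir_one by (metis option.distinct(1))
  ultimately show ?thesis
    by (intro that[of "x False \<otimes> x True"]) (use xc in \<open>simp_all add: cut_elements_def\<close>)
qed

text \<open>The elements are \<open>t\<^sup>-\<^sup>1s\<close> and \<open>t\<^sup>-\<^sup>1as = t\<^sup>-\<^sup>1se\<^sub>1\<close>. They differ by an element of \<open>V\<close>, and no nontrivial
  element of \<open>V\<close> is a cut element.\<close>

lemma cut_free_pair:
  "\<exists>\<alpha>\<in>cut_elements. \<exists>\<beta>\<in>cut_elements. \<forall>z\<in>cut_elements. \<alpha> \<noteq> \<beta> \<otimes> z \<and> \<beta> \<noteq> \<alpha> \<otimes> z"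
proof -
  define \<alpha> where "\<alpha> = \<tau> False False \<otimes> \<tau> True True"
  have \<alpha>: "\<alpha> \<in> carrier G" by (simp add: \<alpha>_def)
  have dir\<alpha>: "dir \<alpha> = Some (0, False, False)" "dir (inv \<alpha>) = Some (0, True, False)"
    using no_backtrack[of "\<tau> False False" "\<tau> True True"] by (simp_all add: \<alpha>_def)
  define e1 where "e1 = vec (int r) 1"
  define \<beta> where "\<beta> = \<alpha> \<otimes> e1"
  have \<beta>: "\<beta> \<in> carrier G" using \<alpha> by (simp add: \<beta>_def e1_def)
  have "inv \<beta> = vec (- int r) (- 1) \<otimes> inv \<alpha>" using \<alpha> by (simp add: \<beta>_def e1_def inv_mult_group)
  then have dir\<beta>: "dir \<beta> = Some (0, False, False)" "dir (inv \<beta>) = Some (0, True, False)"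
    using dir_mult_vec[OF \<alpha>] dir_vec_mult[of "inv \<alpha>" 0 True False "- int r" "- 1"] \<alpha> dir\<alpha>
    by (simp_all add: \<beta>_def e1_def slope_def coset_rep.simps)
  have ne: "e1 \<noteq> \<one>" "inv e1 \<noteq> \<one>" using vec_inject[of _ _ 0 0] by (auto simp: e1_def vec_zero)
  have "\<alpha> \<noteq> \<beta> \<otimes> z \<and> \<beta> \<noteq> \<alpha> \<otimes> z" if z: "z \<in> cut_elements" for z
  proof (intro conjI notI)
    have zc: "z \<in> carrier G" using z by (auto simp: cut_elements_def)
    assume "\<beta> = \<alpha> \<otimes> z"
    then have "z = e1" using \<alpha> zc by (simp add: \<beta>_def e1_def)
    then show False using cut_vertex_disjoint[OF z] ne by (simp add: e1_def)
  next
    have zc: "z \<in> carrier G" using z by (auto simp: cut_elements_def)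
    assume "\<alpha> = \<beta> \<otimes> z"
    then have "\<alpha> \<otimes> \<one> = \<alpha> \<otimes> (e1 \<otimes> z)" using \<alpha> zc by (simp add: \<beta>_def e1_def m_assoc)
    then have "e1 \<otimes> z = \<one>" using \<alpha> zc by (simp add: e1_def del: r_one)
    then have "z = inv e1" using zc inv_cancel_left(1)[of e1 z] by (simp add: e1_def)
    then show False using cut_vertex_disjoint[OF z] ne by (simp add: e1_def)
  qed
  moreover have "\<alpha> \<in> cut_elements" "\<beta> \<in> cut_elements"
    using \<alpha> \<beta> dir\<alpha> dir\<beta> by (auto simp: cut_elements_def)
  ultimately show ?thesis by blast
qed

sublocale cut_monoid G S cut_elements
proof
  show "cut_elements \<subseteq> carrier G" "\<one> \<in> cut_elements" by (auto simp: cut_elements_def)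
  show "\<exists>K. \<forall>g\<in>carrier G. \<exists>p\<in>carrier G. \<exists>q\<in>carrier G.
      len p \<le> K \<and> len q \<le> K \<and> p \<otimes> g \<otimes> q \<in> cut_elements"
    using cut_padding by blast
qed (fact cut_mult_closed cut_levi cut_free_pair)+

end

section \<open>The stack machine of the snowflake group\<close>

text \<open>A normal form \<open>\<rho>\<^sub>1\<tau>\<^sub>1\<dots>\<rho>\<^sub>n\<tau>\<^sub>na\<^sup>ib\<^sup>j\<close>, where \<open>\<rho>\<^sub>k\<close> represents a coset of the edge group of \<open>\<tau>\<^sub>k\<close>, is
  stored as the list of the pairs \<open>\<rho>\<^sub>k\<tau>\<^sub>k\<close>, last pair first, together with \<open>(i, j)\<close>.\<close>

type_synonym stack_state = "(int \<times> bool \<times> bool) list \<times> int \<times> int"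

text \<open>Right multiplication of a normal form by a stable letter \<open>\<tau>\<close>: write \<open>a\<^sup>ib\<^sup>j\<close> as coset representative
  times element of the edge group, move the latter through \<open>\<tau>\<close>, and cancel \<open>\<tau>\<close> against the top of the
  stack if the representative is trivial and the top carries the inverse letter.\<close>

fun stable_step :: "nat \<Rightarrow> bool \<Rightarrow> bool \<Rightarrow> stack_state \<Rightarrow> stack_state" where
  "stable_step r c e (L, i, j) =
    (let x = (if e then i else slope c * j);
         i' = (if e then int r * x else x); j' = (if e then slope c * x else 0)
     in case L of
          (\<rho>, c', e') # L' \<Rightarrow>
            if coset_rep r c e i j = 0 \<and> c' = c \<and> e' = (\<not> e)
            then (L', if e then \<rho> + i' else i', if e then j' else \<rho>)
            else ((coset_rep r c e i j, c, e) # L, i', j')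
        | [] \<Rightarrow> ([(coset_rep r c e i j, c, e)], i', j'))"

fun step :: "nat \<Rightarrow> bb_gen \<times> bool \<Rightarrow> stack_state \<Rightarrow> stack_state" where
  "step r (GenA, e) (L, i, j) = (L, if e then i + 1 else i - 1, j)"
| "step r (GenB, e) (L, i, j) = (L, i, if e then j + 1 else j - 1)"
| "step r (GenS, e) s = stable_step r True e s"
| "step r (GenT, e) s = stable_step r False e s"

fun reduced_stack :: "(int \<times> bool \<times> bool) list \<Rightarrow> bool" where
  "reduced_stack ((\<rho>, c, e) # (\<rho>', c', e') # L) \<longleftrightarrow>
    \<not> (\<rho> = 0 \<and> c' = c \<and> e' = (\<not> e)) \<and> reduced_stack ((\<rho>', c', e') # L)"
| "reduced_stack L \<longleftrightarrow> True"

abbreviation run :: "nat \<Rightarrow> bb_gen word \<Rightarrow> stack_state \<Rightarrow> stack_state" where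
  "run r w s \<equiv> fold (step r) w s"

text \<open>After a cancellation the inverse letter must be pushed again; it cannot cancel further because
  the stack is reduced.\<close>

lemma stable_step_inverse:
  assumes "reduced_stack L"
  shows "stable_step r c (\<not> e) (stable_step r c e (L, i, j)) = (L, i, j)"
proof (cases L)
  case Nil
  then show ?thesis by (cases e) (auto simp: coset_rep.simps algebra_simps)
next
  case (Cons a L')
  obtain \<rho> c' e' where a: "a = (\<rho>, c', e')" by (cases a)
  show ?thesis
  proof (cases "coset_rep r c e i j = 0 \<and> c' = c \<and> e' = (\<not> e)")
    case False
    then show ?thesis unfolding Cons a by (cases e) (auto simp: coset_rep.simps algebra_simps)
  next
    case True
    show ?thesis
    proof (cases L')
      case Nil
      then show ?thesis using True unfolding Cons a by (cases e) (auto simp: coset_rep.simps algebra_simps)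
    next
      case (Cons b L'')
      obtain \<rho>2 c2 e2 where b: "b = (\<rho>2, c2, e2)" by (cases b)
      have "\<not> (\<rho> = 0 \<and> c2 = c' \<and> e2 = (\<not> e'))"
        using assms unfolding \<open>L = a # L'\<close> Cons a b by simp
      then show ?thesis using True unfolding \<open>L = a # L'\<close> Cons a b
        by (cases e) (auto simp: coset_rep.simps algebra_simps)
    qed
  qed
qed

lemma reduced_stack_tl: "reduced_stack (a # L) \<Longrightarrow> reduced_stack L"
  by (cases a; cases L) auto

lemma reduced_stack_stable_step: "reduced_stack L \<Longrightarrow> reduced_stack (fst (stable_step r c e (L, i, j)))"
  by (cases L) (auto simp: Let_def dest: reduced_stack_tl)

lemma reduced_stack_step: "reduced_stack (fst s) \<Longrightarrow> reduced_stack (fst (step r l s))"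
  by (cases s; cases "(r, l, s)" rule: step.cases)
    (auto simp del: stable_step.simps intro: reduced_stack_stable_step)

lemma reduced_stack_run: "reduced_stack (fst s) \<Longrightarrow> reduced_stack (fst (run r w s))"
  by (induction w arbitrary: s) (simp_all add: reduced_stack_step)

lemma step_inverse: "reduced_stack (fst s) \<Longrightarrow> step r (x, \<not> e) (step r (x, e) s) = s"
  using stable_step_inverse
  by (cases s; cases x) (auto simp del: stable_step.simps)

lemma run_replicate_A: "run r (replicate n (GenA, True)) (L, i, j) = (L, i + int n, j)"
  by (induction n arbitrary: i) (auto simp: algebra_simps)

text \<open>Without the step in the middle the two stable letters cancel; raising the first coordinate by 1
  before the second of them changes its result only by \<open>(r, slope c)\<close>.\<close>

lemma run_conjugate:
  assumes "reduced_stack L"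
  shows "stable_step r c True (step r (GenA, True) (stable_step r c False (L, i, j))) = (L, i + int r, j + slope c)"
proof -
  obtain L' x y where s: "stable_step r c False (L, i, j) = (L', x, y)" by (metis prod_cases3)
  have "stable_step r c True (L', x, y) = (L, i, j)"
    using stable_step_inverse[OF assms, of r c False i j] s by simp
  then have "stable_step r c True (L', x + 1, y) = (L, i + int r, j + slope c)"
    by (auto simp: coset_rep.simps Let_def algebra_simps split: list.splits if_splits)
  then show ?thesis using s by simp
qed

lemma run_relation:
  assumes "(l, l') \<in> snowflake_relations r" "reduced_stack L"
  shows "run r l (L, i, j) = run r l' (L, i, j)"
proof -
  consider "l = [(GenA, True), (GenB, True), (GenA, False), (GenB, False)]" "l' = []"
    | "l = [(GenS, False), (GenA, True), (GenS, True)]" "l' = replicate r (GenA, True) @ [(GenB, True)]"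
    | "l = [(GenT, False), (GenA, True), (GenT, True)]" "l' = replicate r (GenA, True) @ [(GenB, False)]"
    using assms(1) by (auto simp: snowflake_relations_def)
  then show ?thesis
  proof cases
    case 2
    then show ?thesis using run_conjugate[OF assms(2), of r True i j]
      by (simp add: run_replicate_A slope_def del: stable_step.simps fold_replicate)
  next
    case 3
    then show ?thesis using run_conjugate[OF assms(2), of r False i j]
      by (simp add: run_replicate_A slope_def del: stable_step.simps fold_replicate)
  qed simp
qed

lemma run_word_eq:
  assumes "word_eq (snowflake_relations r) u v"
  shows "\<forall>s. reduced_stack (fst s) \<longrightarrow> run r u s = run r v s"
  using assms
proof induction
  case (cancel u x e v)
  show ?case
  proof (intro allI impI)
    fix s :: stack_state assume "reduced_stack (fst s)"
    then have "reduced_stack (fst (run r u s))" by (rule reduced_stack_run)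
    then show "run r (u @ [(x, e), (x, \<not> e)] @ v) s = run r (u @ v) s"
      using step_inverse by simp
  qed
next
  case (relation l l' u v)
  show ?case
  proof (intro allI impI)
    fix s :: stack_state assume "reduced_stack (fst s)"
    then have "reduced_stack (fst (run r u s))" by (rule reduced_stack_run)
    then show "run r (u @ l @ v) s = run r (u @ l' @ v) s"
      using run_relation[OF relation.hyps, of "fst (run r u s)" "fst (snd (run r u s))" "snd (snd (run r u s))"] by simp
  qed
qed auto

lemma (in group) commute_int_pow:
  assumes "x \<otimes> y = y \<otimes> x" and xy: "x \<in> carrier G" "y \<in> carrier G"
  shows "x [^] (k::int) \<otimes> y = y \<otimes> x [^] k"
proof -
  have nat: "x [^] n \<otimes> y = y \<otimes> x [^] n" for n :: nat
    using group_commutes_pow[OF assms(1) xy] .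
  have "inv z \<otimes> y = y \<otimes> inv z" if z: "z \<in> carrier G" "z \<otimes> y = y \<otimes> z" for z
  proof -
    have "inv z \<otimes> y = inv z \<otimes> (y \<otimes> z) \<otimes> inv z" using z(1) xy by (simp add: m_assoc)
    also have "\<dots> = inv z \<otimes> (z \<otimes> y) \<otimes> inv z" by (simp only: z(2))
    also have "\<dots> = y \<otimes> inv z" using z(1) xy by (simp add: inv_cancel_left m_assoc)
    finally show ?thesis .
  qed
  from this[OF _ nat[of "nat (- k)"]] nat[of "nat k"] show ?thesis
    using xy unfolding int_pow_def2 by (cases "k < 0") simp_all
qed

text \<open>\<open>G\<close> is a name for the snowflake group, so that the group notation is available for it.\<close>

locale snowflake_presentation =
  fixes r :: nat and G (structure)
  assumes r_ge_3: "r \<ge> 3" and G_eq: "G = snowflake_group r"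
begin

sublocale group G
  unfolding G_eq snowflake_group_def by (rule group_presented_group)

abbreviation cls :: "bb_gen word \<Rightarrow> bb_gen word set" where
  "cls w \<equiv> word_class (snowflake_relations r) w"

lemma carrier_cls: "carrier G = range cls"
  by (simp add: G_eq snowflake_group_def carrier_presented_group)

lemma cls_closed [simp]: "cls w \<in> carrier G"
  by (simp add: carrier_cls)

lemma cls_Nil: "cls [] = \<one>"
  by (simp add: G_eq snowflake_group_def one_presented_group)

lemma cls_append: "cls (u @ v) = cls u \<otimes> cls v"
  by (simp add: G_eq snowflake_group_def mult_presented_group)

lemma cls_inverse: "inv (cls [(x, e)]) = cls [(x, \<not> e)]"
proof (rule inv_equality)
  have "word_eq (snowflake_relations r) ([] @ [(x, \<not> e), (x, \<not> \<not> e)] @ []) ([] @ [])" by (rule word_eq.cancel)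
  then show "cls [(x, \<not> e)] \<otimes> cls [(x, e)] = \<one>"
    by (simp add: word_class_eq_iff flip: cls_append cls_Nil)
qed auto

lemma cls_relation: "(l, l') \<in> snowflake_relations r \<Longrightarrow> cls l = cls l'"
  using word_eq.relation[of l l' "snowflake_relations r" "[]" "[]"] by (simp add: word_class_eq_iff)

text \<open>By \<open>run_word_eq\<close> every word of the class leads to the same state.\<close>

definition state :: "bb_gen word set \<Rightarrow> stack_state" where
  "state g = run r (SOME w. w \<in> g) ([], 0, 0)"

lemma state_cls: "state (cls w) = run r w ([], 0, 0)"
proof -
  have "w \<in> cls w" by (simp add: word_class_def word_eq.refl)
  then have "(SOME v. v \<in> cls w) \<in> cls w" by (rule someI)
  then have "word_eq (snowflake_relations r) w (SOME v. v \<in> cls w)" by (simp add: word_class_def)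
  then show ?thesis using run_word_eq by (auto simp: state_def)
qed

lemma state_mult: "g \<in> carrier G \<Longrightarrow> state (g \<otimes> cls w) = run r w (state g)"
  by (auto simp: carrier_cls state_cls simp flip: cls_append)

definition \<a> where "\<a> = cls [(GenA, True)]"
definition \<b> where "\<b> = cls [(GenB, True)]"
definition stable :: "bool \<Rightarrow> bool \<Rightarrow> bb_gen word set" where
  "stable c e = cls [(if c then GenS else GenT, e)]"
definition vertex :: "int \<Rightarrow> int \<Rightarrow> bb_gen word set" where
  "vertex i j = \<a> [^] i \<otimes> \<b> [^] j"

lemma a_closed [simp]: "\<a> \<in> carrier G" and b_closed [simp]: "\<b> \<in> carrier G"
  and stable_closed [simp]: "stable c e \<in> carrier G"
  and vertex_closed [simp]: "vertex i j \<in> carrier G"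
  by (simp_all add: \<a>_def \<b>_def stable_def vertex_def)

lemma inv_stable: "inv (stable c e) = stable c (\<not> e)"
  by (simp add: stable_def cls_inverse)

lemma a_b_commute: "\<a> \<otimes> \<b> = \<b> \<otimes> \<a>"
proof -
  have "([(GenA, True), (GenB, True), (GenA, False), (GenB, False)], []) \<in> snowflake_relations r"
    by (simp add: snowflake_relations_def)
  from cls_relation[OF this]
  have "cls [(GenA, True)] \<otimes> (cls [(GenB, True)] \<otimes> (cls [(GenA, False)] \<otimes> cls [(GenB, False)])) = \<one>"
    by (simp add: cls_Nil flip: cls_append)
  then have "\<a> \<otimes> (\<b> \<otimes> (inv \<a> \<otimes> inv \<b>)) = \<one>" by (simp add: \<a>_def \<b>_def cls_inverse)
  then have "(\<a> \<otimes> \<b>) \<otimes> inv (\<b> \<otimes> \<a>) = \<one>" by (simp add: inv_mult_group m_assoc)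
  then show ?thesis by (metis a_closed b_closed inv_closed inv_equality inv_inv m_closed)
qed

lemma state_a_power: "g \<in> carrier G \<Longrightarrow> state (g \<otimes> \<a> [^] k) =
    (fst (state g), fst (snd (state g)) + k, snd (snd (state g)))" for k :: int
proof (induction k rule: int_induct[of _ 0])
  case (step1 k)
  have "g \<otimes> \<a> [^] (k + 1) = g \<otimes> \<a> [^] k \<otimes> cls [(GenA, True)]"
    using step1.prems by (simp add: int_pow_mult m_assoc \<a>_def)
  then show ?case using state_mult[of "g \<otimes> \<a> [^] k" "[(GenA, True)]"] step1 by simp
next
  case (step2 k)
  have "g \<otimes> \<a> [^] (k - 1) = g \<otimes> \<a> [^] k \<otimes> cls [(GenA, False)]"
    using step2.prems by (simp add: int_pow_diff m_assoc \<a>_def cls_inverse)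
  then show ?case using state_mult[of "g \<otimes> \<a> [^] k" "[(GenA, False)]"] step2 by simp
qed simp

lemma state_b_power: "g \<in> carrier G \<Longrightarrow> state (g \<otimes> \<b> [^] k) =
    (fst (state g), fst (snd (state g)), snd (snd (state g)) + k)" for k :: int
proof (induction k rule: int_induct[of _ 0])
  case (step1 k)
  have "g \<otimes> \<b> [^] (k + 1) = g \<otimes> \<b> [^] k \<otimes> cls [(GenB, True)]"
    using step1.prems by (simp add: int_pow_mult m_assoc \<b>_def)
  then show ?case using state_mult[of "g \<otimes> \<b> [^] k" "[(GenB, True)]"] step1 by simp
next
  case (step2 k)
  have "g \<otimes> \<b> [^] (k - 1) = g \<otimes> \<b> [^] k \<otimes> cls [(GenB, False)]"
    using step2.prems by (simp add: int_pow_diff m_assoc \<b>_def cls_inverse)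
  then show ?case using state_mult[of "g \<otimes> \<b> [^] k" "[(GenB, False)]"] step2 by simp
qed simp

lemma state_mult_vertex: "g \<in> carrier G \<Longrightarrow> state (g \<otimes> vertex k l) =
    (fst (state g), fst (snd (state g)) + k, snd (snd (state g)) + l)"
  using state_a_power[of g k] state_b_power[of "g \<otimes> \<a> [^] k" l]
  by (simp add: vertex_def flip: m_assoc)

lemma state_one: "state \<one> = ([], 0, 0)"
  by (simp add: state_cls flip: cls_Nil)

lemma state_vertex: "state (vertex i j) = ([], i, j)"
  using state_mult_vertex[of \<one> i j] by (simp add: state_one)

lemma state_mult_stable: "g \<in> carrier G \<Longrightarrow> state (g \<otimes> stable c e) = stable_step r c e (state g)"
  using state_mult[of g "[(if c then GenS else GenT, e)]"] by (simp add: stable_def)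

lemma powers_commute: "\<b> [^] (j::int) \<otimes> \<a> [^] (k::int) = \<a> [^] k \<otimes> \<b> [^] j"
  by (intro commute_int_pow commute_int_pow[symmetric] a_b_commute a_closed b_closed int_pow_closed)

lemma vertex_mult: "vertex i j \<otimes> vertex k l = vertex (i + k) (j + l)"
proof -
  have "vertex i j \<otimes> vertex k l = \<a> [^] i \<otimes> (\<b> [^] j \<otimes> \<a> [^] k) \<otimes> \<b> [^] l"
    by (simp add: vertex_def m_assoc)
  also have "\<dots> = \<a> [^] i \<otimes> \<a> [^] k \<otimes> (\<b> [^] j \<otimes> \<b> [^] l)"
    unfolding powers_commute by (simp add: m_assoc)
  finally show ?thesis by (simp add: vertex_def int_pow_mult)
qed

lemma vertex_zero: "vertex 0 0 = \<one>"
  by (simp add: vertex_def)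

lemma conj_stable: "stable c False \<otimes> vertex m 0 \<otimes> stable c True = vertex (int r * m) (slope c * m)"
proof -
  have rep: "cls (replicate n (GenA, True)) = vertex (int n) 0" for n
  proof (induction n)
    case (Suc n)
    have "cls (replicate (Suc n) (GenA, True)) = vertex 1 0 \<otimes> cls (replicate n (GenA, True))"
      using cls_append[of "[(GenA, True)]" "replicate n (GenA, True)"] by (simp add: vertex_def \<a>_def)
    then show ?case using Suc by (simp add: vertex_mult add.commute)
  qed (simp add: cls_Nil vertex_def)
  have b: "cls [(GenB, d)] = vertex 0 (if d then 1 else - 1)" for d
    using int_pow_neg[of \<b> 1] cls_inverse[of GenB True] by (simp add: vertex_def \<b>_def)
  have "([(if c then GenS else GenT, False), (GenA, True), (if c then GenS else GenT, True)],
      replicate r (GenA, True) @ [(GenB, c)]) \<in> snowflake_relations r"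
    by (cases c) (simp_all add: snowflake_relations_def)
  from cls_relation[OF this]
  have base: "stable c False \<otimes> vertex 1 0 \<otimes> stable c True = vertex (int r) (slope c)"
    by (cases c; simp add: cls_append rep b vertex_mult slope_def stable_def flip: append_Cons)
      (simp_all add: vertex_def \<a>_def flip: cls_append)
  define h where "h = (\<lambda>g. stable c False \<otimes> g \<otimes> stable c True)"
  have hm: "h (g \<otimes> g') = h g \<otimes> h g'" if "g \<in> carrier G" "g' \<in> carrier G" for g g'
  proof -
    have "stable c True \<otimes> (stable c False \<otimes> x) = x" if "x \<in> carrier G" for x
      using inv_cancel_left(2)[of "stable c True" x] that by (simp add: inv_stable)
    then show ?thesis using that by (simp add: h_def m_assoc)
  qed
  have h1: "h (vertex 1 0) = vertex (int r) (slope c)" using base by (simp add: h_def)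
  have hc: "h g \<in> carrier G" if "g \<in> carrier G" for g using that by (simp add: h_def)
  have v0: "vertex 0 0 = \<one>" by (simp add: vertex_def)
  have h0: "h (vertex 0 0) = \<one>"
    using r_inv[of "stable c False"] by (simp add: h_def v0 inv_stable del: r_inv)
  have "h (vertex m 0) = vertex (int r * m) (slope c * m)"
  proof (induction m rule: int_induct[of _ 0])
    case (step1 m)
    have "h (vertex (m + 1) 0) = h (vertex m 0) \<otimes> h (vertex 1 0)" by (simp add: vertex_mult flip: hm)
    then show ?case using step1 h1 by (simp add: vertex_mult algebra_simps)
  next
    case (step2 m)
    have "h (vertex m 0) = h (vertex (m - 1) 0) \<otimes> h (vertex 1 0)" by (simp add: vertex_mult flip: hm)
    then have "h (vertex m 0) \<otimes> vertex (- int r) (- slope c) = h (vertex (m - 1) 0) \<otimes> (vertex (int r) (slope c) \<otimes> vertex (- int r) (- slope c))"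
      using h1 hc by (simp add: m_assoc)
    then have "h (vertex (m - 1) 0) = vertex (int r * m) (slope c * m) \<otimes> vertex (- int r) (- slope c)"
      using step2 hc by (simp add: vertex_mult v0)
    then show ?case by (simp add: vertex_mult algebra_simps)
  qed (use h0 in \<open>simp add: v0\<close>)
  then show ?thesis by (simp add: h_def)
qed

lemma move_through_stable:
  "vertex (if e then m else int r * m) (if e then 0 else slope c * m) \<otimes> stable c e
    = stable c e \<otimes> vertex (if e then int r * m else m) (if e then slope c * m else 0)"
proof (cases e)
  case True
  have "stable c True \<otimes> (stable c False \<otimes> vertex m 0 \<otimes> stable c True) = vertex m 0 \<otimes> stable c True"
    using inv_cancel_left(2)[of "stable c True"] by (simp add: inv_stable m_assoc)
  then show ?thesis using True by (simp add: conj_stable)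
next
  case False
  have "(stable c False \<otimes> vertex m 0 \<otimes> stable c True) \<otimes> stable c False = stable c False \<otimes> vertex m 0"
    using r_inv[of "stable c True"] by (simp add: inv_stable m_assoc del: r_inv)
  then show ?thesis using False by (simp add: conj_stable)
qed

primrec stack_value :: "(int \<times> bool \<times> bool) list \<Rightarrow> bb_gen word set" where
  "stack_value [] = \<one>"
| "stack_value (x # L) = (case x of (\<rho>, c, e) \<Rightarrow>
    stack_value L \<otimes> vertex (if e then 0 else \<rho>) (if e then \<rho> else 0) \<otimes> stable c e)"

definition state_value :: "stack_state \<Rightarrow> bb_gen word set" where
  "state_value s = stack_value (fst s) \<otimes> vertex (fst (snd s)) (snd (snd s))"

lemma stack_value_closed [simp]: "stack_value L \<in> carrier G"
  by (induction L) (auto split: prod.splits)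

lemma state_value_stable_step: "state_value (stable_step r c e (L, i, j)) = state_value (L, i, j) \<otimes> stable c e"
proof -
  define x where "x = (if e then i else slope c * j)"
  let ?\<rho> = "coset_rep r c e i j"
  let ?v = "vertex (if e then int r * x else x) (if e then slope c * x else 0)"
  have "vertex i j = vertex (if e then 0 else ?\<rho>) (if e then ?\<rho> else 0) \<otimes> vertex (if e then x else int r * x) (if e then 0 else slope c * x)"
    by (auto simp: vertex_mult coset_rep.simps x_def algebra_simps)
  then have ij: "vertex i j \<otimes> stable c e = vertex (if e then 0 else ?\<rho>) (if e then ?\<rho> else 0) \<otimes> (stable c e \<otimes> ?v)"
    using move_through_stable[of e x c] by (simp add: m_assoc)
  have push: "stack_value ((?\<rho>, c, e) # L) \<otimes> ?v = state_value (L, i, j) \<otimes> stable c e"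
    using ij by (simp add: state_value_def m_assoc)
  show ?thesis
  proof (cases "\<exists>\<rho> L'. ?\<rho> = 0 \<and> L = (\<rho>, c, \<not> e) # L'")
    case False
    then have "stable_step r c e (L, i, j) = ((?\<rho>, c, e) # L, if e then int r * x else x, if e then slope c * x else 0)"
      by (auto simp: x_def Let_def split: list.splits)
    then show ?thesis using push by (simp add: state_value_def)
  next
    case True
    then obtain \<rho> L' where L: "?\<rho> = 0" "L = (\<rho>, c, \<not> e) # L'" by blast
    have v0: "vertex 0 0 = \<one>" by (simp add: vertex_def)
    have "stable c (\<not> e) \<otimes> (stable c e \<otimes> ?v) = ?v"
      using inv_cancel_left(1)[of "stable c e" ?v] by (simp add: inv_stable)
    moreover have "vertex i j \<otimes> stable c e = stable c e \<otimes> ?v"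
      using ij unfolding L(1) by (simp add: v0)
    ultimately have "state_value (L, i, j) \<otimes> stable c e
        = stack_value L' \<otimes> (vertex (if e then \<rho> else 0) (if e then 0 else \<rho>) \<otimes> ?v)"
      unfolding L(2) state_value_def by (simp add: m_assoc)
    also have "\<dots> = state_value (stable_step r c e (L, i, j))"
      using L by (simp add: state_value_def vertex_mult x_def Let_def)
    finally show ?thesis by simp
  qed
qed

text \<open>Correctness of the machine. Hence a state determines the group element, and in particular an
  empty stack means that the element lies in \<open>V\<close>.\<close>

lemma state_value_run: "state_value (run r w s) = state_value s \<otimes> cls w"
proof (induction w arbitrary: s)
  case Nil
  then show ?case by (simp add: cls_Nil state_value_def)
next
  case (Cons l w)
  obtain L i j where s: "s = (L, i, j)" by (metis prod_cases3)
  have c: "state_value s \<in> carrier G" by (simp add: state_value_def)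
  have a: "cls [(GenA, e)] = vertex (if e then 1 else - 1) 0" "cls [(GenB, e)] = vertex 0 (if e then 1 else - 1)" for e
    using int_pow_neg[of \<a> 1] cls_inverse[of GenA True] int_pow_neg[of \<b> 1] cls_inverse[of GenB True]
    by (simp_all add: vertex_def \<a>_def \<b>_def)
  obtain x e where l: "l = (x, e)" by (cases l)
  have "state_value (step r l s) = state_value s \<otimes> cls [l]"
  proof (cases x)
    case GenA
    then show ?thesis by (simp add: s l a state_value_def m_assoc vertex_mult)
  next
    case GenB
    then show ?thesis by (simp add: s l a state_value_def m_assoc vertex_mult)
  next
    case GenS
    then show ?thesis using state_value_stable_step[of True e L i j]
      by (simp add: s l stable_def del: stable_step.simps)
  next
    case GenT
    then show ?thesis using state_value_stable_step[of False e L i j]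
      by (simp add: s l stable_def del: stable_step.simps)
  qed
  moreover have "cls (l # w) = cls [l] \<otimes> cls w" using cls_append[of "[l]" w] by simp
  ultimately show ?case using Cons c by (simp add: m_assoc)
qed

lemma state_value_state:
  assumes "g \<in> carrier G"
  shows "state_value (state g) = g"
proof -
  obtain w where w: "g = cls w" using assms carrier_cls by blast
  have "state_value ([], 0, 0) = \<one>" by (simp add: state_value_def vertex_def)
  then show ?thesis
    using state_value_run[of w "([], 0, 0)"] unfolding w state_cls by simp
qed

definition gen_set :: "bb_gen word set set" where
  "gen_set = {vertex 1 0, vertex (- 1) 0} \<union> range (case_prod stable)"

text \<open>The bottom of the stack is the first pair \<open>\<rho>\<^sub>1\<tau>\<^sub>1\<close> of the normal form.\<close>

definition first_edge :: "bb_gen word set \<Rightarrow> (int \<times> bool \<times> bool) option" where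
  "first_edge g = (if fst (state g) = [] then None else Some (last (fst (state g))))"

lemma state_cases:
  obtains L i j where "state g = (L, i, j)"
  by (metis prod_cases3)

lemma inv_vertex: "inv (vertex i j) = vertex (- i) (- j)"
  by (rule inv_equality) (simp_all add: vertex_mult vertex_zero)

lemma stable_in_gen_set: "stable c e \<in> gen_set"
  by (force simp: gen_set_def)

text \<open>Only the letter \<open>b\<^sup>\<plusminus>\<^sup>1 = a\<^sup>\<minusplus>\<^sup>rs\<^sup>-\<^sup>1a\<^sup>\<plusminus>\<^sup>1s\<close> has to be rewritten.\<close>

lemma word_letters_generate: "\<exists>ws. set ws \<subseteq> gen_set \<and> foldr (\<otimes>) ws \<one> = cls [(x, e)]"
proof -
  have gc: "gen_set \<subseteq> carrier G" by (auto simp: gen_set_def)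
  have v0: "vertex 0 0 = \<one>" by (simp add: vertex_def)
  have vpow: "foldr (\<otimes>) (replicate n (vertex s 0)) \<one> = vertex (int n * s) 0" for n s
    by (induction n) (simp_all add: v0 vertex_mult algebra_simps del: foldr_replicate)
  have a: "cls [(GenA, e)] = vertex (if e then 1 else - 1) 0" "cls [(GenB, e)] = vertex 0 (if e then 1 else - 1)" for e
    using int_pow_neg[of \<a> 1] cls_inverse[of GenA True] int_pow_neg[of \<b> 1] cls_inverse[of GenB True]
    by (simp_all add: vertex_def \<a>_def \<b>_def)
  have conj: "stable True False \<otimes> (vertex s 0 \<otimes> stable True True) = vertex (int r * s) s" for s
    using conj_stable[of True s] by (simp add: slope_def m_assoc)
  show ?thesis
  proof (cases x)
    case GenA
    then show ?thesis by (intro exI[of _ "[vertex (if e then 1 else - 1) 0]"]) (simp add: a gen_set_def)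
  next
    case GenB
    let ?s = "if e then 1 else - 1 :: int"
    \<comment> \<open>spelling of \<open>b\<^sup>\<plusminus>\<^sup>1\<close> without \<open>b\<close>\<close>
    let ?ws = "replicate r (vertex (- ?s) 0)" and ?vs = "[stable True False, vertex ?s 0, stable True True]"
    have sub: "set ?ws \<subseteq> gen_set" "set ?vs \<subseteq> gen_set" by (auto simp: gen_set_def)
    then have "foldr (\<otimes>) (?ws @ ?vs) \<one> = vertex (int r * (- ?s)) 0 \<otimes> vertex (int r * ?s) ?s"
      using foldr_mult_append[of ?ws ?vs] gc vpow[of r "- ?s"] conj by (simp del: foldr_append foldr_replicate)
    also have "\<dots> = cls [(x, e)]" using GenB by (simp add: a vertex_mult)
    finally show ?thesis using sub by (intro exI[of _ "?ws @ ?vs"]) simp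
  next
    case GenS
    then have "stable True e \<in> gen_set" "cls [(x, e)] = stable True e"
      by (force simp: gen_set_def, simp add: stable_def)
    then show ?thesis by (intro exI[of _ "[stable True e]"]) simp
  next
    case GenT
    then have "stable False e \<in> gen_set" "cls [(x, e)] = stable False e"
      by (force simp: gen_set_def, simp add: stable_def)
    then show ?thesis by (intro exI[of _ "[stable False e]"]) simp
  qed
qed

lemma words_generate: "\<exists>ws. set ws \<subseteq> gen_set \<and> foldr (\<otimes>) ws \<one> = cls w"
proof (induction w)
  case Nil
  then show ?case by (intro exI[of _ "[]"]) (simp add: cls_Nil)
next
  case (Cons l w)
  have gc: "gen_set \<subseteq> carrier G" by (auto simp: gen_set_def)
  obtain us where us: "set us \<subseteq> gen_set" "foldr (\<otimes>) us \<one> = cls [l]"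
    using word_letters_generate[of "fst l" "snd l"] by auto
  obtain ws where ws: "set ws \<subseteq> gen_set" "foldr (\<otimes>) ws \<one> = cls w" using Cons by blast
  have "foldr (\<otimes>) (us @ ws) \<one> = cls (l # w)"
    using foldr_mult_append[of us ws] us ws gc cls_append[of "[l]" w] by (simp del: foldr_append)
  then show ?case using us(1) ws(1) by (intro exI[of _ "us @ ws"]) auto
qed

sublocale word_length G gen_set
proof
  show "finite gen_set" by (simp add: gen_set_def)
  show "gen_set \<subseteq> carrier G" by (auto simp: gen_set_def)
  show "\<one> \<notin> gen_set"
  proof
    assume "\<one> \<in> gen_set"
    then consider "\<one> = vertex 1 0" | "\<one> = vertex (- 1) 0" | c e where "\<one> = stable c e"
      by (auto simp: gen_set_def)
    then show False
    proof cases
      case 3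
      have "state (stable c e) = stable_step r c e ([], 0, 0)"
        using state_mult_stable[of \<one> c e] by (simp add: state_one)
      then show False using state_one unfolding 3[symmetric] by (simp add: Let_def)
    qed (metis state_one state_vertex prod.inject zero_neq_one zero_neq_neg_one)+
  qed
  show "inv \<sigma> \<in> gen_set" if "\<sigma> \<in> gen_set" for \<sigma>
  proof -
    consider "\<sigma> = vertex 1 0" | "\<sigma> = vertex (- 1) 0" | c e where "\<sigma> = stable c e"
      using \<open>\<sigma> \<in> gen_set\<close> by (auto simp: gen_set_def)
    then show ?thesis
      by cases (simp_all add: inv_stable stable_in_gen_set, simp_all add: inv_vertex gen_set_def)
  qed
  show "\<exists>ws. set ws \<subseteq> gen_set \<and> foldr (\<otimes>) ws \<one> = g" if "g \<in> carrier G" for g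
    using that words_generate by (auto simp: carrier_cls)
qed

lemma last_stable_step:
  assumes "L \<noteq> []" "fst (stable_step r c e (L, i, j)) \<noteq> []"
  shows "last (fst (stable_step r c e (L, i, j))) = last L"
  using assms by (cases L) (auto simp: Let_def split: if_splits)

sublocale snowflake_tree G gen_set r vertex stable first_edge
proof
  show "r \<ge> 3" by (rule r_ge_3)
  show "gen_set = {vertex 1 0, vertex (- 1) 0} \<union> range (case_prod stable)" by (rule gen_set_def)
  show "vertex i j \<in> carrier G" for i j by simp
  show "vertex i j \<otimes> vertex k l = vertex (i + k) (j + l)" for i j k l by (rule vertex_mult)
  show "vertex i j = vertex k l \<longleftrightarrow> i = k \<and> j = l" for i j k l
    by (metis prod.inject state_vertex)
  show "inv (stable c e) = stable c (\<not> e)" for c e by (rule inv_stable)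
  show "stable c False \<otimes> vertex m 0 \<otimes> stable c True = vertex (int r * m) (slope c * m)" for c m
    by (rule conj_stable)
  show "first_edge g = None \<longleftrightarrow> g \<in> range (case_prod vertex)" if g: "g \<in> carrier G" for g
  proof
    assume "first_edge g = None"
    then have "fst (state g) = []" by (auto simp: first_edge_def split: if_splits)
    then have "g = vertex (fst (snd (state g))) (snd (snd (state g)))"
      using state_value_state[OF g] by (simp add: state_value_def)
    then show "g \<in> range (case_prod vertex)" by (metis case_prod_conv rangeI)
  qed (auto simp: first_edge_def state_vertex)
  show "first_edge (vertex i j \<otimes> stable c e) = Some (coset_rep r c e i j, c, e)" for i j c e
    by (simp add: first_edge_def state_mult_stable state_vertex Let_def)
  show "first_edge (g \<otimes> \<sigma>) = first_edge g"
    if g: "g \<in> carrier G" and \<sigma>: "\<sigma> \<in> gen_set \<union> range (case_prod vertex)"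
      and ne: "first_edge g \<noteq> None" "first_edge (g \<otimes> \<sigma>) \<noteq> None" for g \<sigma>
  proof -
    obtain L i j where s: "state g = (L, i, j)" by (rule state_cases)
    consider (v) k l where "\<sigma> = vertex k l" | (st) c e where "\<sigma> = stable c e"
      using \<sigma> by (auto simp: gen_set_def)
    then show ?thesis
    proof cases
      case v
      then show ?thesis using state_mult_vertex[OF g] by (simp add: first_edge_def)
    next
      case st
      have L: "L \<noteq> []" "fst (stable_step r c e (L, i, j)) \<noteq> []"
        using ne s state_mult_stable[OF g, of c e] st
        by (auto simp: first_edge_def simp del: stable_step.simps split: if_splits)
      then show ?thesis
        using last_stable_step[OF L] s state_mult_stable[OF g, of c e] st
        by (simp add: first_edge_def del: stable_step.simps)
    qed
  qed
qed

end

section \<open>The metric graph of a word length\<close>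

context Metric_space
begin

text \<open>A 1-Lipschitz path of length \<open>l\<close>. Such paths can be concatenated freely, and one whose length is
  the distance of its endpoints is a geodesic; so geodesics need not be cut and pasted.\<close>

definition joined :: "'a \<Rightarrow> 'a \<Rightarrow> real \<Rightarrow> bool" where
  "joined x y l \<longleftrightarrow> 0 \<le> l \<and> (\<exists>\<gamma>. \<gamma> ` {0..l} \<subseteq> M \<and> \<gamma> 0 = x \<and> \<gamma> l = y \<and>
    (\<forall>s\<in>{0..l}. \<forall>t\<in>{0..l}. d (\<gamma> s) (\<gamma> t) \<le> \<bar>s - t\<bar>))"

lemma joined_sym:
  assumes "joined x y l"
  shows "joined y x l"
proof -
  obtain \<gamma> where \<gamma>: "0 \<le> l" "\<gamma> ` {0..l} \<subseteq> M" "\<gamma> 0 = x" "\<gamma> l = y"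
    "\<forall>s\<in>{0..l}. \<forall>t\<in>{0..l}. d (\<gamma> s) (\<gamma> t) \<le> \<bar>s - t\<bar>"
    using assms unfolding joined_def by blast
  have "\<forall>s\<in>{0..l}. \<forall>t\<in>{0..l}. d (\<gamma> (l - s)) (\<gamma> (l - t)) \<le> \<bar>s - t\<bar>"
  proof (intro ballI)
    fix s t assume "s \<in> {0..l}" "t \<in> {0..l}"
    then have "d (\<gamma> (l - s)) (\<gamma> (l - t)) \<le> \<bar>(l - s) - (l - t)\<bar>"
      by (intro \<gamma>(5)[rule_format]) auto
    then show "d (\<gamma> (l - s)) (\<gamma> (l - t)) \<le> \<bar>s - t\<bar>" by linarith
  qed
  moreover have "(\<lambda>s. \<gamma> (l - s)) ` {0..l} \<subseteq> M" using \<gamma>(2) by auto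
  ultimately show ?thesis
    unfolding joined_def using \<gamma> by (intro conjI exI[of _ "\<lambda>s. \<gamma> (l - s)"]) auto
qed

lemma joined_trans:
  assumes "joined x y k" "joined y z l"
  shows "joined x z (k + l)"
proof -
  obtain \<gamma> where \<gamma>: "0 \<le> k" "\<gamma> ` {0..k} \<subseteq> M" "\<gamma> 0 = x" "\<gamma> k = y"
    "\<forall>s\<in>{0..k}. \<forall>t\<in>{0..k}. d (\<gamma> s) (\<gamma> t) \<le> \<bar>s - t\<bar>"
    using assms(1) unfolding joined_def by blast
  obtain \<eta> where \<eta>: "0 \<le> l" "\<eta> ` {0..l} \<subseteq> M" "\<eta> 0 = y" "\<eta> l = z"
    "\<forall>s\<in>{0..l}. \<forall>t\<in>{0..l}. d (\<eta> s) (\<eta> t) \<le> \<bar>s - t\<bar>"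
    using assms(2) unfolding joined_def by blast
  define \<theta> where "\<theta> = (\<lambda>s. if s \<le> k then \<gamma> s else \<eta> (s - k))"
  have in_M: "\<theta> s \<in> M" if "s \<in> {0..k + l}" for s
    using that \<gamma>(2) \<eta>(2) by (auto simp: \<theta>_def image_subset_iff)
  have le: "d (\<theta> s) (\<theta> t) \<le> t - s" if st: "s \<in> {0..k + l}" "t \<in> {0..k + l}" "s \<le> t" for s t
  proof -
    consider "t \<le> k" | "s > k" | "s \<le> k" "k < t" by linarith
    then show ?thesis
    proof cases
      case 1
      then have "d (\<gamma> s) (\<gamma> t) \<le> \<bar>s - t\<bar>" by (intro \<gamma>(5)[rule_format]) (use 1 st in auto)
      then show ?thesis using 1 st by (simp add: \<theta>_def)
    next
      case 2
      then have "d (\<eta> (s - k)) (\<eta> (t - k)) \<le> \<bar>(s - k) - (t - k)\<bar>" by (intro \<eta>(5)[rule_format]) (use 2 st in auto)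
      then show ?thesis using 2 st by (simp add: \<theta>_def)
    next
      case 3
      have "d (\<gamma> s) (\<gamma> k) \<le> \<bar>s - k\<bar>" by (intro \<gamma>(5)[rule_format]) (use \<gamma>(1) st 3 in auto)
      moreover have "d (\<eta> 0) (\<eta> (t - k)) \<le> \<bar>0 - (t - k)\<bar>" by (intro \<eta>(5)[rule_format]) (use \<eta>(1) st 3 in auto)
      moreover have "\<gamma> s \<in> M" "\<gamma> k \<in> M" "\<eta> (t - k) \<in> M"
        using \<gamma>(1,2) \<eta>(2) st 3 by (auto simp: image_subset_iff)
      ultimately show ?thesis
        using triangle[of "\<gamma> s" "\<gamma> k" "\<eta> (t - k)"] 3 \<gamma>(4) \<eta>(3) by (simp add: \<theta>_def)
    qed
  qed
  have "d (\<theta> s) (\<theta> t) \<le> \<bar>s - t\<bar>" if "s \<in> {0..k + l}" "t \<in> {0..k + l}" for s t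
    using le[of s t] le[of t s] that commute by (cases "s \<le> t") auto
  moreover have "\<theta> 0 = x" "\<theta> (k + l) = z"
    using \<gamma> \<eta> by (auto simp: \<theta>_def)
  ultimately show ?thesis
    unfolding joined_def using in_M \<gamma>(1) \<eta>(1) by (intro conjI exI[of _ \<theta>]) auto
qed

lemma joined_geodesic:
  assumes "joined x y (d x y)"
  shows "\<exists>\<gamma>. \<gamma> ` {0..d x y} \<subseteq> M \<and> \<gamma> 0 = x \<and> \<gamma> (d x y) = y \<and>
        (\<forall>s\<in>{0..d x y}. \<forall>t\<in>{0..d x y}. d (\<gamma> s) (\<gamma> t) = \<bar>s - t\<bar>)"
proof -
  obtain \<gamma> where \<gamma>: "\<gamma> ` {0..d x y} \<subseteq> M" "\<gamma> 0 = x" "\<gamma> (d x y) = y"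
    "\<forall>s\<in>{0..d x y}. \<forall>t\<in>{0..d x y}. d (\<gamma> s) (\<gamma> t) \<le> \<bar>s - t\<bar>"
    using assms unfolding joined_def by blast
  have *: "d (\<gamma> s) (\<gamma> t) \<ge> t - s" if st: "s \<in> {0..d x y}" "t \<in> {0..d x y}" for s t
  proof -
    have M: "\<gamma> 0 \<in> M" "\<gamma> s \<in> M" "\<gamma> t \<in> M" "\<gamma> (d x y) \<in> M" using \<gamma>(1) st by (auto simp: image_subset_iff)
    have "d (\<gamma> 0) (\<gamma> s) \<le> \<bar>0 - s\<bar>" "d (\<gamma> t) (\<gamma> (d x y)) \<le> \<bar>t - d x y\<bar>"
      by (intro \<gamma>(4)[rule_format]; use st in auto)+
    then show ?thesis
      using triangle[OF M(1,2,4)] triangle[OF M(2,3,4)] st \<gamma>(2,3) by auto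
  qed
  have "d (\<gamma> s) (\<gamma> t) = \<bar>s - t\<bar>" if "s \<in> {0..d x y}" "t \<in> {0..d x y}" for s t
    using *[of s t] *[of t s] \<gamma>(4) that commute[of "\<gamma> s" "\<gamma> t"] by fastforce
  then show ?thesis using \<gamma> by blast
qed

end

context word_length
begin

definition vdist :: "'a \<Rightarrow> 'a \<Rightarrow> real" where "vdist u v = real (len (inv u \<otimes> v))"

lemma vdist_sym: "u \<in> carrier G \<Longrightarrow> v \<in> carrier G \<Longrightarrow> vdist u v = vdist v u"
  using len_inv[of "inv u \<otimes> v"] by (simp add: vdist_def inv_mult_group)

lemma vdist_triangle:
  assumes "u \<in> carrier G" "v \<in> carrier G" "w \<in> carrier G"
  shows "vdist u w \<le> vdist u v + vdist v w"
proof -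
  have "inv u \<otimes> w = (inv u \<otimes> v) \<otimes> (inv v \<otimes> w)"
    using assms by (simp add: m_assoc inv_cancel_left)
  then show ?thesis
    using len_mult[of "inv u \<otimes> v" "inv v \<otimes> w"] assms by (simp add: vdist_def flip: of_nat_add)
qed

lemma vdist_self [simp]: "u \<in> carrier G \<Longrightarrow> vdist u u = 0"
  by (simp add: vdist_def)

lemma vdist_eq_0: "u \<in> carrier G \<Longrightarrow> v \<in> carrier G \<Longrightarrow> vdist u v = 0 \<longleftrightarrow> u = v"
  using len_eq_0_iff[of "inv u \<otimes> v"] inv_cancel_left(2)[of u v]
  by (auto simp: vdist_def)

lemma vdist_nonneg [simp]: "0 \<le> vdist u v" by (simp add: vdist_def)

lemma vdist_left: "g \<in> carrier G \<Longrightarrow> u \<in> carrier G \<Longrightarrow> v \<in> carrier G \<Longrightarrow> vdist (g \<otimes> u) (g \<otimes> v) = vdist u v"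
  by (simp add: vdist_def inv_mult_group m_assoc inv_cancel_left)

lemma vdist_edge: "g \<in> carrier G \<Longrightarrow> \<sigma> \<in> insert \<one> S \<Longrightarrow> vdist g (g \<otimes> \<sigma>) \<le> 1"
  using len_gen[of \<sigma>] gen_closed[of \<sigma>] by (auto simp: vdist_def inv_cancel_left)

text \<open>The Cayley graph: \<open>(g, \<sigma>, t)\<close> is the point at distance \<open>t\<close> from \<open>g\<close> on the edge from \<open>g\<close> to
  \<open>g\<sigma>\<close>. A vertex is the point with \<open>t = 0\<close> on a fictitious edge labelled by the identity. The edge
  labelled \<open>\<sigma>\<^sup>-\<^sup>1\<close> from \<open>g\<sigma>\<close> back to \<open>g\<close> is a separate one.\<close>

definition graph_points :: "('a \<times> 'a \<times> real) set" where
  "graph_points = {(g, \<sigma>, t). g \<in> carrier G \<and> (\<sigma> = \<one> \<and> t = 0 \<or> \<sigma> \<in> S \<and> 0 < t \<and> t < 1)}"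

text \<open>The vertices next to a point, with the distances along its edge. For a vertex the second entry is
  the vertex itself at distance 1, which is harmless in a minimum.\<close>

definition ends :: "'a \<times> 'a \<times> real \<Rightarrow> ('a \<times> real) set" where
  "ends x = (case x of (g, \<sigma>, t) \<Rightarrow> {(g, t), (g \<otimes> \<sigma>, 1 - t)})"

definition through :: "'a \<times> 'a \<times> real \<Rightarrow> 'a \<times> 'a \<times> real \<Rightarrow> real" where
  "through x y = Min ((\<lambda>((u, \<alpha>), (v, \<beta>)). \<alpha> + vdist u v + \<beta>) ` (ends x \<times> ends y))"

text \<open>The first case allows for staying inside a common edge. Outside the graph the value is 0 because a
  metric on a carrier has to be symmetric and nonnegative everywhere.\<close>

definition graph_dist :: "'a \<times> 'a \<times> real \<Rightarrow> 'a \<times> 'a \<times> real \<Rightarrow> real" where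
  "graph_dist x y = (if x \<in> graph_points \<and> y \<in> graph_points then
     (case x of (g, \<sigma>, s) \<Rightarrow> case y of (h, \<tau>, t) \<Rightarrow>
       if g = h \<and> \<sigma> = \<tau> then min \<bar>s - t\<bar> (through x y) else through x y) else 0)"

lemma finite_ends: "finite (ends x)" "ends x \<noteq> {}"
  by (cases x; simp add: ends_def)+

lemma through_le: "(u, \<alpha>) \<in> ends x \<Longrightarrow> (v, \<beta>) \<in> ends y \<Longrightarrow> through x y \<le> \<alpha> + vdist u v + \<beta>"
  unfolding through_def by (rule Min_le) (auto intro: rev_image_eqI simp: finite_ends)

lemma through_attained:
  obtains u \<alpha> v \<beta> where "(u, \<alpha>) \<in> ends x" "(v, \<beta>) \<in> ends y" "through x y = \<alpha> + vdist u v + \<beta>"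
proof -
  have "through x y \<in> (\<lambda>((u, \<alpha>), (v, \<beta>)). \<alpha> + vdist u v + \<beta>) ` (ends x \<times> ends y)"
    unfolding through_def by (rule Min_in) (use finite_ends in auto)
  then show ?thesis using that by auto
qed

lemma ends_props:
  assumes "x \<in> graph_points" "(u, \<alpha>) \<in> ends x"
  shows "u \<in> carrier G" "0 \<le> \<alpha>" "\<alpha> = 0 \<Longrightarrow> x = (u, \<one>, 0)" "\<alpha> \<le> 1"
  using assms gen_closed by (auto simp: graph_points_def ends_def)

text \<open>Passing through a point along its edge is never shorter than the distance between the endpoints;
  this is what makes the triangle inequality hold.\<close>

lemma ends_dist:
  assumes "x \<in> graph_points" "(u, \<alpha>) \<in> ends x" "(v, \<beta>) \<in> ends x"
  shows "vdist u v \<le> \<alpha> + \<beta>"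
proof -
  obtain g \<sigma> t where x: "x = (g, \<sigma>, t)" "g \<in> carrier G" "\<sigma> \<in> insert \<one> S" "0 \<le> t" "t \<le> 1"
    using assms(1) by (auto simp: graph_points_def)
  have c: "g \<otimes> \<sigma> \<in> carrier G" using x gen_closed by auto
  then show ?thesis
    using assms(2,3) x vdist_edge[OF x(2,3)] vdist_sym[OF x(2) c] by (auto simp: ends_def)
qed

lemma through_sym:
  assumes "x \<in> graph_points" "y \<in> graph_points"
  shows "through x y = through y x"
proof -
  have le: "through y x \<le> through x y" if xy: "x \<in> graph_points" "y \<in> graph_points" for x y
  proof -
    obtain u \<alpha> v \<beta> where *: "(u, \<alpha>) \<in> ends x" "(v, \<beta>) \<in> ends y" "through x y = \<alpha> + vdist u v + \<beta>"
      by (rule through_attained)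
    then show ?thesis
      using through_le[OF *(2,1)] vdist_sym[of u v] ends_props(1) xy by fastforce
  qed
  then show ?thesis using le[of x y] le[of y x] assms by (intro antisym) auto
qed

lemma through_nonneg:
  assumes "x \<in> graph_points" "y \<in> graph_points"
  shows "0 \<le> through x y"
proof -
  obtain u \<alpha> v \<beta> where "(u, \<alpha>) \<in> ends x" "(v, \<beta>) \<in> ends y" "through x y = \<alpha> + vdist u v + \<beta>"
    by (rule through_attained)
  then show ?thesis using ends_props(2) assms by (smt (verit) vdist_nonneg)
qed

lemma through_eq_0:
  assumes "x \<in> graph_points" "y \<in> graph_points" "through x y = 0"
  shows "x = y"
proof -
  obtain u \<alpha> v \<beta> where *: "(u, \<alpha>) \<in> ends x" "(v, \<beta>) \<in> ends y" "through x y = \<alpha> + vdist u v + \<beta>"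
    by (rule through_attained)
  have "0 \<le> \<alpha>" "0 \<le> \<beta>" using ends_props(2) * assms by blast+
  then have 0: "\<alpha> = 0" "\<beta> = 0" "vdist u v = 0"
    using *(3) assms(3) vdist_nonneg[of u v] by linarith+
  then have "u = v" using vdist_eq_0 ends_props(1) * assms by blast
  then show ?thesis using ends_props(3)[OF assms(1) *(1)] ends_props(3)[OF assms(2) *(2)] 0 by simp
qed

lemma through_triangle:
  assumes "x \<in> graph_points" "y \<in> graph_points" "z \<in> graph_points"
  shows "through x z \<le> through x y + through y z"
proof -
  obtain u \<alpha> v \<beta> where 1: "(u, \<alpha>) \<in> ends x" "(v, \<beta>) \<in> ends y" "through x y = \<alpha> + vdist u v + \<beta>"
    by (rule through_attained)
  obtain v' \<beta>' w \<gamma> where 2: "(v', \<beta>') \<in> ends y" "(w, \<gamma>) \<in> ends z" "through y z = \<beta>' + vdist v' w + \<gamma>"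
    by (rule through_attained)
  have c: "u \<in> carrier G" "v \<in> carrier G" "v' \<in> carrier G" "w \<in> carrier G"
    using ends_props(1) assms 1 2 by blast+
  show ?thesis
    using through_le[OF 1(1) 2(2)] 1(3) 2(3) ends_dist[OF assms(2) 1(2) 2(1)]
      vdist_triangle[of u v w] vdist_triangle[of v v' w] c by linarith
qed

lemma through_same_edge:
  assumes "(g, \<sigma>, s) \<in> graph_points" "(g, \<sigma>, t) \<in> graph_points" "z \<in> graph_points"
  shows "through (g, \<sigma>, s) z \<le> \<bar>s - t\<bar> + through (g, \<sigma>, t) z"
proof -
  obtain u \<alpha> v \<beta> where *: "(u, \<alpha>) \<in> ends (g, \<sigma>, t)" "(v, \<beta>) \<in> ends z" "through (g, \<sigma>, t) z = \<alpha> + vdist u v + \<beta>"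
    by (rule through_attained)
  have "(u, s) \<in> ends (g, \<sigma>, s) \<and> s \<le> \<bar>s - t\<bar> + \<alpha> \<or> (u, 1 - s) \<in> ends (g, \<sigma>, s) \<and> 1 - s \<le> \<bar>s - t\<bar> + \<alpha>"
    using *(1) by (auto simp: ends_def)
  then obtain \<alpha>' where a: "(u, \<alpha>') \<in> ends (g, \<sigma>, s)" "\<alpha>' \<le> \<bar>s - t\<bar> + \<alpha>" by blast
  show ?thesis using through_le[OF a(1) *(2)] *(3) a(2) by linarith
qed

lemma graph_dist_le_through: "x \<in> graph_points \<Longrightarrow> y \<in> graph_points \<Longrightarrow> graph_dist x y \<le> through x y"
  by (auto simp: graph_dist_def split: prod.splits)

lemma graph_dist_cases:
  assumes "x \<in> graph_points" "y \<in> graph_points"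
  obtains "graph_dist x y = through x y"
  | g \<sigma> s t where "x = (g, \<sigma>, s)" "y = (g, \<sigma>, t)" "graph_dist x y = \<bar>s - t\<bar>"
proof -
  obtain g \<sigma> s h \<tau> t where xy: "x = (g, \<sigma>, s)" "y = (h, \<tau>, t)" by (metis prod_cases3)
  show ?thesis
  proof (cases "g = h \<and> \<sigma> = \<tau> \<and> \<bar>s - t\<bar> \<le> through x y")
    case True
    then have "graph_dist x y = \<bar>s - t\<bar>" using assms xy by (auto simp: graph_dist_def min_def)
    then show ?thesis using that(2) True xy by blast
  next
    case False
    then have "graph_dist x y = through x y" using assms xy by (auto simp: graph_dist_def min_def)
    then show ?thesis by (rule that(1))
  qed
qed

lemma graph_dist_same_edge: "graph_dist (g, \<sigma>, s) (g, \<sigma>, t) \<le> \<bar>s - t\<bar>"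
  by (simp add: graph_dist_def)

lemma graph_dist_sym: "graph_dist x y = graph_dist y x"
proof (cases "x \<in> graph_points \<and> y \<in> graph_points")
  case True
  then have "through x y = through y x" using through_sym by blast
  then show ?thesis by (cases x; cases y) (auto simp: graph_dist_def abs_minus_commute)
qed (auto simp: graph_dist_def)

lemma graph_dist_triangle:
  assumes "x \<in> graph_points" "y \<in> graph_points" "z \<in> graph_points"
  shows "graph_dist x z \<le> graph_dist x y + graph_dist y z"
proof (rule graph_dist_cases[OF assms(1,2)])
  assume xy: "graph_dist x y = through x y"
  show ?thesis
  proof (rule graph_dist_cases[OF assms(2,3)])
    assume "graph_dist y z = through y z"
    then show ?thesis using xy through_triangle[OF assms] graph_dist_le_through[OF assms(1,3)] by linarith
  next
    fix g \<sigma> s t assume *: "y = (g, \<sigma>, s)" "z = (g, \<sigma>, t)" "graph_dist y z = \<bar>s - t\<bar>"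
    have "through z x \<le> \<bar>t - s\<bar> + through y x"
      using through_same_edge[of g \<sigma> t s x] * assms by simp
    then show ?thesis
      using xy * through_sym assms graph_dist_le_through[OF assms(1,3)] by (simp add: abs_minus_commute)
  qed
next
  fix g \<sigma> s t assume 1: "x = (g, \<sigma>, s)" "y = (g, \<sigma>, t)" "graph_dist x y = \<bar>s - t\<bar>"
  show ?thesis
  proof (rule graph_dist_cases[OF assms(2,3)])
    assume "graph_dist y z = through y z"
    then show ?thesis
      using 1 through_same_edge[of g \<sigma> s t z] assms graph_dist_le_through[OF assms(1,3)] by simp
  next
    fix g' \<sigma>' s' t' assume "y = (g', \<sigma>', s')" "z = (g', \<sigma>', t')" "graph_dist y z = \<bar>s' - t'\<bar>"
    then show ?thesis using 1 graph_dist_same_edge[of g \<sigma> s t'] by simp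
  qed
qed

sublocale graph: Metric_space graph_points graph_dist
proof
  fix x y
  show "0 \<le> graph_dist x y" using through_nonneg[of x y] by (auto simp: graph_dist_def split: prod.splits)
  show "graph_dist x y = graph_dist y x" by (rule graph_dist_sym)
  assume xy: "x \<in> graph_points" "y \<in> graph_points"
  show "graph_dist x y = 0 \<longleftrightarrow> x = y"
  proof
    assume "graph_dist x y = 0"
    then show "x = y" by (cases rule: graph_dist_cases[OF xy]) (use through_eq_0[OF xy] in auto)
  next
    assume "x = y"
    then show "graph_dist x y = 0"
      using xy through_nonneg[of x y] by (auto simp: graph_dist_def split: prod.splits)
  qed
qed (rule graph_dist_triangle)

definition edge_point :: "'a \<Rightarrow> 'a \<Rightarrow> real \<Rightarrow> 'a \<times> 'a \<times> real" where
  "edge_point g \<sigma> s = (if s \<le> 0 \<or> \<sigma> = \<one> then (g, \<one>, 0) else if s \<ge> 1 then (g \<otimes> \<sigma>, \<one>, 0) else (g, \<sigma>, s))"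

lemma edge_point_in_points: "g \<in> carrier G \<Longrightarrow> \<sigma> \<in> insert \<one> S \<Longrightarrow> edge_point g \<sigma> s \<in> graph_points"
  using gen_closed by (auto simp: edge_point_def graph_points_def)

lemma points_edge_point:
  assumes "x \<in> graph_points"
  obtains g \<sigma> s where "g \<in> carrier G" "\<sigma> \<in> insert \<one> S" "0 \<le> s" "s \<le> 1" "x = edge_point g \<sigma> s" "ends x = {(g, s), (g \<otimes> \<sigma>, 1 - s)}" "fst x = g"
proof -
  obtain g \<sigma> s where x: "x = (g, \<sigma>, s)" by (metis prod_cases3)
  show ?thesis
    by (rule that[of g \<sigma> s]) (use assms one_not_gen in \<open>auto simp: x graph_points_def edge_point_def ends_def\<close>)
qed

lemma edge_point_lipschitz:
  assumes g: "g \<in> carrier G" and \<sigma>: "\<sigma> \<in> insert \<one> S" and st: "0 \<le> s" "s \<le> 1" "0 \<le> t" "t \<le> 1"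
  shows "graph_dist (edge_point g \<sigma> s) (edge_point g \<sigma> t) \<le> \<bar>s - t\<bar>"
proof -
  have main: "graph_dist (edge_point g \<sigma> s) (edge_point g \<sigma> t) \<le> t - s" if st: "0 \<le> s" "s < t" "t \<le> 1" for s t
  proof (cases "\<sigma> = \<one>")
    case True
    then show ?thesis using st g by (simp add: edge_point_def edge_point_in_points graph_points_def)
  next
    case False
    have gs: "g \<otimes> \<sigma> \<in> carrier G" using g \<sigma> gen_closed by auto
    have le: "graph_dist (edge_point g \<sigma> s) (edge_point g \<sigma> t) \<le> through (edge_point g \<sigma> s) (edge_point g \<sigma> t)"
      by (rule graph_dist_le_through) (use edge_point_in_points g \<sigma> in auto)
    consider "s = 0" "t = 1" | "s = 0" "t < 1" | "0 < s" "t = 1" | "0 < s" "t < 1"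
      using st by linarith
    then show ?thesis
    proof cases
      case 1
      have "through (edge_point g \<sigma> s) (edge_point g \<sigma> t) \<le> 0 + vdist g (g \<otimes> \<sigma>) + 0"
        by (rule through_le) (use 1 False in \<open>auto simp: edge_point_def ends_def\<close>)
      then show ?thesis using le vdist_edge[OF g \<sigma>] 1 by simp
    next
      case 2
      have "through (edge_point g \<sigma> s) (edge_point g \<sigma> t) \<le> 0 + vdist g g + t"
        by (rule through_le) (use 2 st False in \<open>auto simp: edge_point_def ends_def\<close>)
      then show ?thesis using le 2 g by simp
    next
      case 3
      have "through (edge_point g \<sigma> s) (edge_point g \<sigma> t) \<le> (1 - s) + vdist (g \<otimes> \<sigma>) (g \<otimes> \<sigma>) + 0"
        by (rule through_le) (use 3 st False in \<open>auto simp: edge_point_def ends_def\<close>)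
      then show ?thesis using le 3 gs by simp
    next
      case 4
      then show ?thesis using graph_dist_same_edge[of g \<sigma> s t] st False by (simp add: edge_point_def)
    qed
  qed
  have "s < t \<or> t < s \<or> s = t" by linarith
  then show ?thesis
    using main[of s t] main[of t s] st graph_dist_sym[of "edge_point g \<sigma> s" "edge_point g \<sigma> t"] edge_point_in_points[OF g \<sigma>]
    by (elim disjE) auto
qed

lemma joined_edge_point:
  assumes g: "g \<in> carrier G" and \<sigma>: "\<sigma> \<in> insert \<one> S" and st: "0 \<le> s" "s \<le> t" "t \<le> 1"
  shows "graph.joined (edge_point g \<sigma> s) (edge_point g \<sigma> t) (t - s)"
  unfolding graph.joined_def
proof (intro conjI exI[of _ "\<lambda>x. edge_point g \<sigma> (s + x)"] ballI)
  fix x y assume "x \<in> {0..t - s}" "y \<in> {0..t - s}"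
  then have "graph_dist (edge_point g \<sigma> (s + x)) (edge_point g \<sigma> (s + y)) \<le> \<bar>(s + x) - (s + y)\<bar>"
    using st by (intro edge_point_lipschitz g \<sigma>) auto
  then show "graph_dist (edge_point g \<sigma> (s + x)) (edge_point g \<sigma> (s + y)) \<le> \<bar>x - y\<bar>" by simp
qed (use st edge_point_in_points[OF g \<sigma>] in auto)

lemma joined_vertices:
  assumes "u \<in> carrier G" "v \<in> carrier G"
  shows "graph.joined (u, \<one>, 0) (v, \<one>, 0) (vdist u v)"
  using assms
proof (induction "len (inv u \<otimes> v)" arbitrary: u)
  case 0
  then have "u = v" using vdist_eq_0[of u v] by (simp add: vdist_def)
  then show ?case using joined_edge_point[of u \<one> 0 0] 0 by (simp add: edge_point_def)
next
  case (Suc n)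
  have "inv u \<otimes> v \<noteq> \<one>" using Suc(2) by auto
  then obtain \<sigma> h where \<sigma>: "\<sigma> \<in> S" "h \<in> carrier G" "inv u \<otimes> v = \<sigma> \<otimes> h" "len (inv u \<otimes> v) = Suc (len h)"
    using len_Suc_split[of "inv u \<otimes> v"] Suc by auto
  have c: "\<sigma> \<in> carrier G" "u \<otimes> \<sigma> \<in> carrier G" using \<sigma>(1) gen_closed Suc by auto
  have "inv (u \<otimes> \<sigma>) \<otimes> v = inv \<sigma> \<otimes> (inv u \<otimes> v)" using c Suc by (simp add: inv_mult_group m_assoc)
  also have "\<dots> = h" using c \<sigma> by (simp add: inv_cancel_left)
  finally have h: "inv (u \<otimes> \<sigma>) \<otimes> v = h" .
  have "n = len (inv (u \<otimes> \<sigma>) \<otimes> v)" using h \<sigma>(4) Suc(2) by simp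
  then have "graph.joined (u \<otimes> \<sigma>, \<one>, 0) (v, \<one>, 0) (vdist (u \<otimes> \<sigma>) v)"
    by (rule Suc(1)) (use c Suc in auto)
  moreover have "graph.joined (u, \<one>, 0) (u \<otimes> \<sigma>, \<one>, 0) 1"
  proof -
    have "\<sigma> \<noteq> \<one>" using \<sigma>(1) one_not_gen by auto
    then show ?thesis using joined_edge_point[of u \<sigma> 0 1] \<sigma>(1) Suc by (simp add: edge_point_def)
  qed
  ultimately have "graph.joined (u, \<one>, 0) (v, \<one>, 0) (1 + vdist (u \<otimes> \<sigma>) v)"
    using graph.joined_trans by blast
  moreover have "vdist u v = 1 + vdist (u \<otimes> \<sigma>) v" using h \<sigma>(4) by (simp add: vdist_def)
  ultimately show ?case by simp
qed

lemma joined_end: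
  assumes "x \<in> graph_points" "(u, \<alpha>) \<in> ends x"
  shows "graph.joined x (u, \<one>, 0) \<alpha>"
proof -
  obtain g \<sigma> s where x: "g \<in> carrier G" "\<sigma> \<in> insert \<one> S" "0 \<le> s" "s \<le> 1" "x = edge_point g \<sigma> s"
    "ends x = {(g, s), (g \<otimes> \<sigma>, 1 - s)}"
    by (rule points_edge_point[OF assms(1)])
  have "graph.joined (edge_point g \<sigma> s) (edge_point g \<sigma> 0) s"
    using graph.joined_sym[OF joined_edge_point[of g \<sigma> 0 s]] x by simp
  moreover have "edge_point g \<sigma> 0 = (g, \<one>, 0)" by (simp add: edge_point_def)
  moreover have "graph.joined (edge_point g \<sigma> s) (edge_point g \<sigma> 1) (1 - s)" using joined_edge_point[of g \<sigma> s 1] x by simp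
  moreover have "edge_point g \<sigma> 1 = (g \<otimes> \<sigma>, \<one>, 0)" using x by (simp add: edge_point_def)
  ultimately show ?thesis using assms(2) x by auto
qed

lemma joined_points:
  assumes "x \<in> graph_points" "y \<in> graph_points"
  shows "graph.joined x y (graph_dist x y)"
proof (rule graph_dist_cases[OF assms])
  assume eq: "graph_dist x y = through x y"
  obtain u \<alpha> v \<beta> where *: "(u, \<alpha>) \<in> ends x" "(v, \<beta>) \<in> ends y" "through x y = \<alpha> + vdist u v + \<beta>"
    by (rule through_attained)
  have "graph.joined (u, \<one>, 0) (v, \<one>, 0) (vdist u v)"
    using joined_vertices ends_props(1) assms * by blast
  then show ?thesis
    using graph.joined_trans[OF graph.joined_trans[OF joined_end[OF assms(1) *(1)]]
        graph.joined_sym[OF joined_end[OF assms(2) *(2)]]] eq *(3) by simp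
next
  fix g \<sigma> s t assume *: "x = (g, \<sigma>, s)" "y = (g, \<sigma>, t)" "graph_dist x y = \<bar>s - t\<bar>"
  then have gs: "g \<in> carrier G" "\<sigma> \<in> insert \<one> S" "0 \<le> s" "s \<le> 1" "0 \<le> t" "t \<le> 1"
    "x = edge_point g \<sigma> s" "y = edge_point g \<sigma> t"
    using assms one_not_gen by (auto simp: graph_points_def edge_point_def)
  show ?thesis
  proof (cases "s \<le> t")
    case True
    then show ?thesis using joined_edge_point[OF gs(1,2), of s t] gs *(3) by simp
  next
    case False
    then show ?thesis using graph.joined_sym[OF joined_edge_point[OF gs(1,2), of t s]] gs *(3) by simp
  qed
qed

lemma vdist_le_graph_dist:
  assumes "x \<in> graph_points" "y \<in> graph_points"
  shows "\<bar>graph_dist x y - vdist (fst x) (fst y)\<bar> \<le> 2"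
proof -
  have v: "(fst x, \<one>, 0) \<in> graph_points \<and> graph_dist x (fst x, \<one>, 0) \<le> 1" if x: "x \<in> graph_points" for x
  proof -
    obtain g \<sigma> s where "g \<in> carrier G" "\<sigma> \<in> insert \<one> S" "0 \<le> s" "s \<le> 1" "x = edge_point g \<sigma> s" "fst x = g"
      by (rule points_edge_point[OF x])
    then show ?thesis using edge_point_lipschitz[of g \<sigma> s 0] edge_point_in_points[of g \<sigma> 0] by (simp add: edge_point_def)
  qed
  have eq: "graph_dist (u, \<one>, 0) (v, \<one>, 0) = vdist u v" if uv: "u \<in> carrier G" "v \<in> carrier G" for u v
  proof -
    have P: "(u, \<one>, 0) \<in> graph_points" "(v, \<one>, 0) \<in> graph_points" using uv by (auto simp: graph_points_def)
    have le: "graph_dist (u, \<one>, 0) (v, \<one>, 0) \<le> vdist u v"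
      using graph_dist_le_through[OF P] through_le[of u 0 "(u, \<one>, 0)" v 0 "(v, \<one>, 0)"] by (simp add: ends_def)
    have "vdist u v \<le> through (u, \<one>, 0) (v, \<one>, 0)"
      by (rule through_attained[of "(u, \<one>, 0)" "(v, \<one>, 0)"]) (use uv in \<open>auto simp: ends_def\<close>)
    then show ?thesis using le uv P by (cases rule: graph_dist_cases[OF P]) auto
  qed
  have c: "fst x \<in> carrier G" "fst y \<in> carrier G" using assms by (auto simp: graph_points_def)
  have px: "(fst x, \<one>, 0) \<in> graph_points" "graph_dist x (fst x, \<one>, 0) \<le> 1" using v[OF assms(1)] by simp_all
  have py: "(fst y, \<one>, 0) \<in> graph_points" "graph_dist y (fst y, \<one>, 0) \<le> 1" using v[OF assms(2)] by simp_all
  note t = graph_dist_triangle[OF assms(1) px(1) assms(2)] graph_dist_triangle[OF px(1) py(1) assms(2)]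
    graph_dist_triangle[OF px(1) assms(1) py(1)] graph_dist_triangle[OF assms(1,2) py(1)]
  show ?thesis
    using t px(2) py(2) eq[OF c] graph_dist_sym[of x "(fst x, \<one>, 0)"] graph_dist_sym[of y "(fst y, \<one>, 0)"]
    by linarith
qed

end

section \<open>The metric graph as a cocompact space of real numbers\<close>

context word_length
begin

definition act :: "'a \<Rightarrow> 'a \<times> 'a \<times> real \<Rightarrow> 'a \<times> 'a \<times> real" where
  "act h x = (case x of (g, \<sigma>, t) \<Rightarrow> (h \<otimes> g, \<sigma>, t))"

lemma act_points: "h \<in> carrier G \<Longrightarrow> x \<in> graph_points \<Longrightarrow> act h x \<in> graph_points"
  by (auto simp: graph_points_def act_def)

lemma act_mult: "\<lbrakk>g \<in> carrier G; h \<in> carrier G; x \<in> graph_points\<rbrakk> \<Longrightarrow> act (g \<otimes> h) x = act g (act h x)"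
  by (auto simp: graph_points_def act_def m_assoc)

lemma act_one: "x \<in> graph_points \<Longrightarrow> act \<one> x = x"
  by (auto simp: graph_points_def act_def)

lemma act_edge_point: "\<lbrakk>h \<in> carrier G; g \<in> carrier G; \<sigma> \<in> insert \<one> S\<rbrakk> \<Longrightarrow> act h (edge_point g \<sigma> s) = edge_point (h \<otimes> g) \<sigma> s"
  using gen_closed by (auto simp: edge_point_def act_def m_assoc)

lemma graph_dist_act:
  assumes h: "h \<in> carrier G" and xy: "x \<in> graph_points" "y \<in> graph_points"
  shows "graph_dist (act h x) (act h y) = graph_dist x y"
proof -
  have ends: "ends (act h x) = (\<lambda>(u, \<alpha>). (h \<otimes> u, \<alpha>)) ` ends x" if x: "x \<in> graph_points" for x
  proof -
    obtain g \<sigma> t where "x = (g, \<sigma>, t)" "g \<in> carrier G" "\<sigma> \<in> carrier G"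
      using x gen_closed by (auto simp: graph_points_def)
    then show ?thesis using h by (simp add: ends_def act_def m_assoc)
  qed
  have le: "through (act h x) (act h y) \<le> through x y"
    if h: "h \<in> carrier G" and xy: "x \<in> graph_points" "y \<in> graph_points"
      and ends: "\<And>x. x \<in> graph_points \<Longrightarrow> ends (act h x) = (\<lambda>(u, \<alpha>). (h \<otimes> u, \<alpha>)) ` ends x" for h x y
  proof -
    obtain u \<alpha> v \<beta> where *: "(u, \<alpha>) \<in> ends x" "(v, \<beta>) \<in> ends y" "through x y = \<alpha> + vdist u v + \<beta>"
      by (rule through_attained)
    have "(h \<otimes> u, \<alpha>) \<in> ends (act h x)" "(h \<otimes> v, \<beta>) \<in> ends (act h y)"
      using *(1,2) unfolding ends[OF xy(1)] ends[OF xy(2)] by (force, force)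
    then have "through (act h x) (act h y) \<le> \<alpha> + vdist (h \<otimes> u) (h \<otimes> v) + \<beta>" by (rule through_le)
    moreover have "u \<in> carrier G" "v \<in> carrier G" using ends_props(1) * xy by blast+
    ultimately show ?thesis using vdist_left[OF h] *(3) by simp
  qed
  have "through (act h x) (act h y) = through x y"
  proof (rule antisym)
    show "through (act h x) (act h y) \<le> through x y" by (rule le[OF h xy ends])
    obtain u \<alpha> v \<beta> where *: "(u, \<alpha>) \<in> ends (act h x)" "(v, \<beta>) \<in> ends (act h y)"
      "through (act h x) (act h y) = \<alpha> + vdist u v + \<beta>"
      by (rule through_attained)
    then obtain u' v' where uv: "(u', \<alpha>) \<in> ends x" "u = h \<otimes> u'" "(v', \<beta>) \<in> ends y" "v = h \<otimes> v'"
      using ends xy by auto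
    have "u' \<in> carrier G" "v' \<in> carrier G" using ends_props(1) uv xy by blast+
    then show "through x y \<le> through (act h x) (act h y)"
      using through_le[OF uv(1,3)] *(3) uv vdist_left[OF h] by simp
  qed
  moreover obtain g \<sigma> s g' \<sigma>' t where xy': "x = (g, \<sigma>, s)" "y = (g', \<sigma>', t)"
    by (metis prod_cases3)
  moreover have "h \<otimes> g = h \<otimes> g' \<longleftrightarrow> g = g'"
    using xy xy' h by (auto simp: graph_points_def)
  ultimately show ?thesis
    using act_points[OF h xy(1)] act_points[OF h xy(2)] xy by (auto simp: graph_dist_def act_def)
qed

end

text \<open>A numbering of the group makes the points of the graph real numbers: the integral part encodes the
  edge and the fractional part the position on it. It exists for every finitely generated group.\<close>

locale cayley_graph = word_length +
  fixes idx :: "'a \<Rightarrow> nat"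
  assumes idx_inj: "inj_on idx (carrier G)"
begin

definition enc :: "'a \<times> 'a \<times> real \<Rightarrow> real" where
  "enc x = (case x of (g, \<sigma>, t) \<Rightarrow> real (prod_encode (idx g, idx \<sigma>)) + t)"

definition X :: "real set" where "X = enc ` graph_points"

definition dec :: "real \<Rightarrow> 'a \<times> 'a \<times> real" where "dec = inv_into graph_points enc"

definition dX :: "real \<Rightarrow> real \<Rightarrow> real" where "dX p q = graph_dist (dec p) (dec q)"

definition actX :: "'a \<Rightarrow> real \<Rightarrow> real" where "actX h = (\<lambda>p\<in>X. enc (act h (dec p)))"

lemma enc_inj: "inj_on enc graph_points"
proof (rule inj_onI)
  fix x y assume xy: "x \<in> graph_points" "y \<in> graph_points" "enc x = enc y"
  obtain g \<sigma> s where x: "x = (g, \<sigma>, s)" "g \<in> carrier G" "\<sigma> \<in> carrier G" "0 \<le> s" "s < 1"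
    using xy(1) gen_closed by (auto simp: graph_points_def)
  obtain h \<tau> t where y: "y = (h, \<tau>, t)" "h \<in> carrier G" "\<tau> \<in> carrier G" "0 \<le> t" "t < 1"
    using xy(2) gen_closed by (auto simp: graph_points_def)
  let ?m = "prod_encode (idx g, idx \<sigma>)" and ?n = "prod_encode (idx h, idx \<tau>)"
  have eq: "real ?m + s = real ?n + t" using xy(3) x(1) y(1) by (simp add: enc_def)
  have "\<bar>real ?m - real ?n\<bar> < 1" using eq x(4,5) y(4,5) by linarith
  then have "?m = ?n" by linarith
  then have "idx g = idx h" "idx \<sigma> = idx \<tau>" by (auto simp: prod_encode_eq)
  then show "x = y"
    using idx_inj x y eq \<open>?m = ?n\<close> by (auto dest: inj_onD)
qed

lemma dec_enc [simp]: "x \<in> graph_points \<Longrightarrow> dec (enc x) = x"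
  unfolding dec_def by (rule inv_into_f_f[OF enc_inj])

lemma enc_X: "x \<in> graph_points \<Longrightarrow> enc x \<in> X"
  by (simp add: X_def)

lemma dec_points: "p \<in> X \<Longrightarrow> dec p \<in> graph_points"
  by (auto simp: X_def)

lemma enc_dec [simp]: "p \<in> X \<Longrightarrow> enc (dec p) = p"
  by (auto simp: X_def)

lemma actX_enc: "x \<in> graph_points \<Longrightarrow> actX h (enc x) = enc (act h x)"
  by (simp add: actX_def enc_X)

lemma actX_closed: "h \<in> carrier G \<Longrightarrow> p \<in> X \<Longrightarrow> actX h p \<in> X"
  by (simp add: actX_def enc_X act_points dec_points)

lemma dX_actX: "h \<in> carrier G \<Longrightarrow> p \<in> X \<Longrightarrow> q \<in> X \<Longrightarrow> dX (actX h p) (actX h q) = dX p q"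
  by (simp add: actX_def dX_def act_points dec_points graph_dist_act)

sublocale MX: Metric_space X dX
proof
  fix p q
  show "0 \<le> dX p q" by (simp add: dX_def)
  show "dX p q = dX q p" by (simp add: dX_def graph.commute)
  show "dX p q = 0 \<longleftrightarrow> p = q" if "p \<in> X" "q \<in> X"
    using that dec_points by (metis dX_def enc_dec graph.zero)
next
  fix p q s assume "p \<in> X" "q \<in> X" "s \<in> X"
  then show "dX p s \<le> dX p q + dX q s"
    unfolding dX_def by (intro graph.triangle dec_points)
qed

text \<open>The base point may be any point of the graph. Replacing it by a nearby vertex \<open>b\<close> changes distances
  by at most 2, and \<open>b\<close> enters only by conjugation.\<close>

lemma orbit_dist:
  assumes p: "p \<in> X"
  shows "\<exists>K. \<forall>g\<in>carrier G. \<bar>dX p (actX g p) - real (len g)\<bar> \<le> real K"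
proof -
  define b where "b = fst (dec p)"
  have b: "b \<in> carrier G" using dec_points[OF p] by (auto simp: b_def graph_points_def)
  have "\<bar>dX p (actX g p) - real (len g)\<bar> \<le> real (2 * len b + 2)" if g: "g \<in> carrier G" for g
  proof -
    have P: "dec p \<in> graph_points" "act g (dec p) \<in> graph_points" using dec_points[OF p] act_points g by auto
    have "dX p (actX g p) = graph_dist (dec p) (act g (dec p))"
      using p P by (simp add: dX_def actX_def)
    moreover have "fst (act g (dec p)) = g \<otimes> b" by (simp add: act_def b_def split: prod.splits)
    ultimately have 1: "\<bar>dX p (actX g p) - vdist b (g \<otimes> b)\<bar> \<le> 2"
      using vdist_le_graph_dist[OF P] by (simp add: b_def)
    have "len (inv b \<otimes> (g \<otimes> b)) \<le> len b + (len g + len b)"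
      using len_mult[of "inv b" "g \<otimes> b"] len_mult[of g b] b g by simp
    moreover have "g = b \<otimes> ((inv b \<otimes> (g \<otimes> b)) \<otimes> inv b)" using b g by (simp add: m_assoc inv_cancel_left)
    then have "len g \<le> len b + (len (inv b \<otimes> (g \<otimes> b)) + len b)"
      using len_mult[of b "(inv b \<otimes> (g \<otimes> b)) \<otimes> inv b"] len_mult[of "inv b \<otimes> (g \<otimes> b)" "inv b"] b g by simp
    ultimately have "\<bar>vdist b (g \<otimes> b) - real (len g)\<bar> \<le> real (2 * len b)"
      by (simp add: vdist_def abs_le_iff)
    then show ?thesis using 1 by simp
  qed
  then show ?thesis by blast
qed

lemma finite_orbit_ball:
  assumes p: "p \<in> X"
  shows "finite {g \<in> carrier G. dX p (actX g p) \<le> \<rho>}"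
proof -
  obtain K where K: "\<And>g. g \<in> carrier G \<Longrightarrow> \<bar>dX p (actX g p) - real (len g)\<bar> \<le> real K"
    using orbit_dist[OF p] by blast
  have "{g \<in> carrier G. dX p (actX g p) \<le> \<rho>} \<subseteq> {g \<in> carrier G. len g \<le> nat \<lceil>\<rho> + real K\<rceil>}"
  proof
    fix g assume "g \<in> {g \<in> carrier G. dX p (actX g p) \<le> \<rho>}"
    then have g: "g \<in> carrier G" "dX p (actX g p) \<le> \<rho>" by auto
    then have "real (len g) \<le> \<rho> + real K" using K[of g] by linarith
    then show "g \<in> {g \<in> carrier G. len g \<le> nat \<lceil>\<rho> + real K\<rceil>}" using g(1) by simp linarith
  qed
  then show ?thesis using finite_ball finite_subset by blast
qed

definition edge :: "'a \<Rightarrow> 'a \<Rightarrow> real set" where "edge g \<sigma> = (\<lambda>s. enc (edge_point g \<sigma> s)) ` {0..1}"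

lemma compactin_edge:
  assumes g: "g \<in> carrier G" and \<sigma>: "\<sigma> \<in> insert \<one> S"
  shows "compactin MX.mtopology (edge g \<sigma>)"
  unfolding edge_def
proof (rule image_compactin)
  show "compactin (top_of_set {0..1::real}) {0..1}"
    by (simp add: compactin_subtopology)
  show "continuous_map (top_of_set {0..1}) MX.mtopology (\<lambda>s. enc (edge_point g \<sigma> s))"
    unfolding MX.continuous_map_to_metric
  proof (intro ballI allI impI)
    fix s :: real and \<epsilon> :: real assume s: "s \<in> topspace (top_of_set {0..1})" and \<epsilon>: "0 < \<epsilon>"
    have "enc (edge_point g \<sigma> t) \<in> MX.mball (enc (edge_point g \<sigma> s)) \<epsilon>" if t: "t \<in> {0..1} \<inter> ball s \<epsilon>" for t
    proof -
      have "dX (enc (edge_point g \<sigma> s)) (enc (edge_point g \<sigma> t)) \<le> \<bar>s - t\<bar>"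
        using edge_point_lipschitz[OF g \<sigma>, of s t] s t edge_point_in_points[OF g \<sigma>] by (simp add: dX_def)
      also have "\<dots> < \<epsilon>" using t by (simp add: dist_real_def)
      finally show ?thesis using enc_X edge_point_in_points[OF g \<sigma>] by simp
    qed
    moreover have "openin (top_of_set {0..1}) ({0..1} \<inter> ball s \<epsilon>)"
      by (simp add: openin_open_Int)
    ultimately show "\<exists>U. openin (top_of_set {0..1}) U \<and> s \<in> U \<and> (\<forall>y\<in>U. enc (edge_point g \<sigma> y) \<in> MX.mball (enc (edge_point g \<sigma> s)) \<epsilon>)"
      using s \<epsilon> by (intro exI[of _ "{0..1} \<inter> ball s \<epsilon>"]) auto
  qed
qed

lemma in_edge:
  assumes p: "p \<in> X"
  obtains \<sigma> where "\<sigma> \<in> insert \<one> S" "p \<in> edge (fst (dec p)) \<sigma>"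
proof -
  obtain g \<sigma> s where "g \<in> carrier G" "\<sigma> \<in> insert \<one> S" "0 \<le> s" "s \<le> 1" "dec p = edge_point g \<sigma> s"
    "ends (dec p) = {(g, s), (g \<otimes> \<sigma>, 1 - s)}" "fst (dec p) = g"
    by (rule points_edge_point[OF dec_points[OF p]])
  then show ?thesis using p that[of \<sigma>] unfolding edge_def by (metis enc_dec image_eqI atLeastAtMost_iff)
qed

lemma edge_subset_X: "g \<in> carrier G \<Longrightarrow> \<sigma> \<in> insert \<one> S \<Longrightarrow> edge g \<sigma> \<subseteq> X"
  unfolding edge_def using enc_X edge_point_in_points by blast

lemma actX_edge: "h \<in> carrier G \<Longrightarrow> g \<in> carrier G \<Longrightarrow> \<sigma> \<in> insert \<one> S \<Longrightarrow> actX h ` edge g \<sigma> = edge (h \<otimes> g) \<sigma>"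
  unfolding edge_def image_image by (rule image_cong) (simp_all add: actX_enc edge_point_in_points act_edge_point)

lemma compactin_edges:
  assumes "finite B" "B \<subseteq> carrier G"
  shows "compactin MX.mtopology (\<Union>(g, \<sigma>)\<in>B \<times> insert \<one> S. edge g \<sigma>)"
  by (rule compactin_Union) (use assms finite_gens compactin_edge in auto)

text \<open>A ball is a closed subset of a finite union of compact edges.\<close>

lemma compactin_mcball:
  assumes p: "p \<in> X"
  shows "compactin MX.mtopology (MX.mcball p \<rho>)"
proof -
  define b where "b = fst (dec p)"
  have b: "b \<in> carrier G" using dec_points[OF p] by (auto simp: b_def graph_points_def)
  define B where "B = (\<lambda>h. b \<otimes> h) ` {h \<in> carrier G. len h \<le> nat \<lceil>\<rho> + 2\<rceil>}"
  have B: "finite B" "B \<subseteq> carrier G" using finite_ball b by (auto simp: B_def)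
  have "MX.mcball p \<rho> \<subseteq> (\<Union>(g, \<sigma>)\<in>B \<times> insert \<one> S. edge g \<sigma>)"
  proof
    fix q assume "q \<in> MX.mcball p \<rho>"
    then have q: "q \<in> X" "dX p q \<le> \<rho>" by auto
    define c where "c = fst (dec q)"
    have c: "c \<in> carrier G" using dec_points[OF q(1)] by (auto simp: c_def graph_points_def)
    have "vdist b c \<le> \<rho> + 2"
      using vdist_le_graph_dist[OF dec_points[OF p] dec_points[OF q(1)]] q(2)
      by (simp add: b_def c_def dX_def)
    then have "len (inv b \<otimes> c) \<le> nat \<lceil>\<rho> + 2\<rceil>" unfolding vdist_def by linarith
    then have "c \<in> B"
      unfolding B_def using b c by (intro image_eqI[of _ _ "inv b \<otimes> c"]) (auto simp: inv_cancel_left)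
    moreover obtain \<sigma> where "\<sigma> \<in> insert \<one> S" "q \<in> edge c \<sigma>" using in_edge[OF q(1)] c_def by blast
    ultimately show "q \<in> (\<Union>(g, \<sigma>)\<in>B \<times> insert \<one> S. edge g \<sigma>)" by blast
  qed
  then show ?thesis
    using closed_compactin[OF compactin_edges[OF B]] MX.closedin_mcball by blast
qed

lemma group_action_X: "group_action G X actX"
proof (rule group_action.intro, rule group_hom.intro)
  show "group G" by (rule is_group)
  show "group (BijGroup X)" by (rule group_BijGroup)
  have comp: "actX (g \<otimes> h) p = actX g (actX h p)" if "g \<in> carrier G" "h \<in> carrier G" "p \<in> X" for g h p
    using that by (simp add: actX_def act_mult act_points dec_points enc_X)
  have one: "actX \<one> p = p" if "p \<in> X" for p
    using that by (simp add: actX_def act_one dec_points)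
  have bij: "actX h \<in> Bij X" if h: "h \<in> carrier G" for h
  proof -
    have "bij_betw (actX h) X X"
    proof (rule bij_betw_byWitness[where f' = "actX (inv h)"])
      show "\<forall>p\<in>X. actX (inv h) (actX h p) = p"
        using comp[of "inv h" h] one h by simp
      show "\<forall>p\<in>X. actX h (actX (inv h) p) = p"
        using comp[of h "inv h"] one h by simp
    qed (use actX_closed h in auto)
    then show ?thesis by (simp add: Bij_def actX_def)
  qed
  show "group_hom_axioms G (BijGroup X) actX"
  proof
    show "actX \<in> hom G (BijGroup X)"
    proof (rule homI)
      fix g h assume gh: "g \<in> carrier G" "h \<in> carrier G"
      have "actX (g \<otimes> h) = compose X (actX g) (actX h)"
      proof (rule extensionalityI[of _ X])
        show "actX (g \<otimes> h) \<in> extensional X" by (simp add: actX_def)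
        show "compose X (actX g) (actX h) \<in> extensional X" by (simp add: compose_def)
        show "actX (g \<otimes> h) p = compose X (actX g) (actX h) p" if "p \<in> X" for p
          using comp[OF gh that] that by (simp add: compose_def)
      qed
      then show "actX (g \<otimes> h) = actX g \<otimes>\<^bsub>BijGroup X\<^esub> actX h"
        using bij gh by (simp add: BijGroup_def)
    qed (use bij in \<open>simp add: BijGroup_def\<close>)
  qed
qed

theorem G_space_X: "G_space G X dX actX"
proof -
  interpret act: group_action G X actX by (rule group_action_X)
  show ?thesis
  proof
    show "compactin MX.mtopology (MX.mcball p \<rho>)" if "p \<in> X" for p \<rho>
      using compactin_mcball[OF that] .
    show "\<exists>\<gamma>. \<gamma> ` {0..dX p q} \<subseteq> X \<and> \<gamma> 0 = p \<and> \<gamma> (dX p q) = q \<and>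
        (\<forall>s\<in>{0..dX p q}. \<forall>t\<in>{0..dX p q}. dX (\<gamma> s) (\<gamma> t) = \<bar>s - t\<bar>)" if pq: "p \<in> X" "q \<in> X" for p q
    proof -
      have P: "dec p \<in> graph_points" "dec q \<in> graph_points" using pq dec_points by auto
      obtain \<gamma> where \<gamma>: "\<gamma> ` {0..dX p q} \<subseteq> graph_points" "\<gamma> 0 = dec p" "\<gamma> (dX p q) = dec q"
        "\<forall>s\<in>{0..dX p q}. \<forall>t\<in>{0..dX p q}. graph_dist (\<gamma> s) (\<gamma> t) = \<bar>s - t\<bar>"
        using graph.joined_geodesic[OF joined_points[OF P]] unfolding dX_def by blast
      have in_points: "\<gamma> s \<in> graph_points" if "s \<in> {0..dX p q}" for s using \<gamma>(1) that by blast
      have "\<forall>s\<in>{0..dX p q}. \<forall>t\<in>{0..dX p q}. dX (enc (\<gamma> s)) (enc (\<gamma> t)) = \<bar>s - t\<bar>"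
        using \<gamma>(4) in_points by (simp add: dX_def)
      moreover have "(\<lambda>s. enc (\<gamma> s)) ` {0..dX p q} \<subseteq> X"
        using in_points enc_X by blast
      ultimately show ?thesis
        using \<gamma>(2,3) pq by (intro exI[of _ "\<lambda>s. enc (\<gamma> s)"]) auto
    qed
    have "(\<one>, \<one>, 0) \<in> graph_points" by (simp add: graph_points_def)
    then show "X \<noteq> {}" using enc_X by blast
    show "dX (actX g p) (actX g q) = dX p q" if "g \<in> carrier G" "p \<in> X" "q \<in> X" for g p q
      using dX_actX[OF that] .
    show "finite {g \<in> carrier G. actX g ` K \<inter> K \<noteq> {}}" if K: "compactin MX.mtopology K" for K
    proof (cases "K = {}")
      case False
      then obtain p where p: "p \<in> K" by blast
      have "MX.mbounded K" using MX.compactin_imp_mbounded[OF K] .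
      then obtain B where KX: "K \<subseteq> X" and B: "\<And>x y. x \<in> K \<Longrightarrow> y \<in> K \<Longrightarrow> dX x y \<le> B"
        unfolding MX.mbounded_alt by blast
      have "{g \<in> carrier G. actX g ` K \<inter> K \<noteq> {}} \<subseteq> {g \<in> carrier G. dX p (actX g p) \<le> 2 * B}"
      proof
        fix g assume "g \<in> {g \<in> carrier G. actX g ` K \<inter> K \<noteq> {}}"
        then obtain q where g: "g \<in> carrier G" and q: "q \<in> K" "actX g q \<in> K" by blast
        have "dX p (actX g p) \<le> dX p (actX g q) + dX (actX g q) (actX g p)"
          by (rule MX.triangle) (use p q KX g actX_closed in auto)
        also have "dX (actX g q) (actX g p) = dX q p" using dX_actX g p q KX by blast
        finally show "g \<in> {g \<in> carrier G. dX p (actX g p) \<le> 2 * B}"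
          using B[OF p q(2)] B[OF q(1) p] g by simp
      qed
      then show ?thesis using finite_orbit_ball finite_subset p KX by blast
    qed simp
  qed
qed

theorem cocompact_X: "cocompact_action G X dX actX"
  unfolding cocompact_action_def
proof (intro exI conjI)
  show "compactin MX.mtopology (\<Union>(g, \<sigma>)\<in>{\<one>} \<times> insert \<one> S. edge g \<sigma>)"
    by (rule compactin_edges) auto
  show "(\<Union>h\<in>carrier G. actX h ` (\<Union>(g, \<sigma>)\<in>{\<one>} \<times> insert \<one> S. edge g \<sigma>)) = X"
  proof (intro equalityI subsetI)
    fix p assume "p \<in> (\<Union>h\<in>carrier G. actX h ` (\<Union>(g, \<sigma>)\<in>{\<one>} \<times> insert \<one> S. edge g \<sigma>))"
    then show "p \<in> X" using edge_subset_X[OF one_closed] actX_closed by fast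
  next
    fix p assume p: "p \<in> X"
    define b where "b = fst (dec p)"
    have b: "b \<in> carrier G" using dec_points[OF p] by (auto simp: b_def graph_points_def)
    obtain \<sigma> where \<sigma>: "\<sigma> \<in> insert \<one> S" "p \<in> edge b \<sigma>" using in_edge[OF p] b_def by blast
    then have "p \<in> actX b ` edge \<one> \<sigma>" using actX_edge[OF b one_closed \<sigma>(1)] b by simp
    then show "p \<in> (\<Union>h\<in>carrier G. actX h ` (\<Union>(g, \<sigma>)\<in>{\<one>} \<times> insert \<one> S. edge g \<sigma>))"
      using b \<sigma>(1) by blast
  qed
qed

end

section \<open>Comparison of exponents\<close>

context word_length
begin

text \<open>If the exponent were smaller than \<open>\<delta>\<close>, then it would be smaller than some \<open>\<eta> < \<delta>\<close>, and the orbit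
  counts would be bounded by \<open>exp (\<eta> \<rho>)\<close> for large radii. A constant takes care of the shift by
  \<open>K\<close> and of the small radii.\<close>

lemma growth_exponent_ge:
  assumes K: "\<And>g. g \<in> carrier G \<Longrightarrow> \<bar>d p (\<phi> g p) - real (len g)\<bar> \<le> real K"
    and fast: "\<And>\<epsilon>. \<epsilon> > 0 \<Longrightarrow> \<not> (\<exists>C. \<forall>n. real (card {g \<in> carrier G. len g \<le> n}) \<le> C * exp ((\<delta> - \<epsilon>) * real n))"
  shows "ereal \<delta> \<le> growth_exponent G d \<phi> p"
proof (rule ccontr)
  let ?B = "\<lambda>\<rho>::real. {g \<in> carrier G. d p (\<phi> g p) \<le> \<rho>}"
  let ?b = "\<lambda>n. {g \<in> carrier G. len g \<le> n}"
  assume "\<not> ereal \<delta> \<le> growth_exponent G d \<phi> p"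
  then have "growth_exponent G d \<phi> p < ereal \<delta>" by simp
  then obtain \<eta> where \<eta>: "growth_exponent G d \<phi> p < ereal \<eta>" "\<eta> < \<delta>"
    using ereal_dense2[of "growth_exponent G d \<phi> p" "ereal \<delta>"] by auto
  have "\<forall>\<^sub>F \<rho> in at_top. ereal (1 / \<rho> * ln (card (?B \<rho>))) < ereal \<eta>"
    using \<eta>(1) unfolding growth_exponent_def by (rule Limsup_lessD)
  then obtain \<rho>0 where \<rho>0: "\<And>\<rho>. \<rho> \<ge> \<rho>0 \<Longrightarrow> 1 / \<rho> * ln (card (?B \<rho>)) < \<eta>"
    by (auto simp: eventually_at_top_linorder)
  define n0 where "n0 = nat \<lceil>max \<rho>0 1\<rceil>"
  define C where "C = exp (\<bar>\<eta>\<bar> * real K) + real (card (?b n0)) * exp (\<bar>\<eta>\<bar> * real n0)"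
  have "real (card (?b n)) \<le> C * exp (\<eta> * real n)" for n
  proof (cases "n0 \<le> n")
    case True
    then have large: "max \<rho>0 1 \<le> real n + real K" unfolding n0_def by linarith
    have fin: "finite (?B (real n + real K))"
    proof (rule finite_subset)
      show "?B (real n + real K) \<subseteq> ?b (n + 2 * K)"
      proof
        fix g assume "g \<in> ?B (real n + real K)"
        then have g: "g \<in> carrier G" "d p (\<phi> g p) \<le> real n + real K" by auto
        then have "real (len g) \<le> real (n + 2 * K)" using K[OF g(1)] by (simp add: abs_le_iff)
        then show "g \<in> ?b (n + 2 * K)" using g(1) by simp
      qed
    qed (rule finite_ball)
    have "?b n \<subseteq> ?B (real n + real K)"
    proof
      fix g assume g: "g \<in> ?b n"
      then have "d p (\<phi> g p) \<le> real (len g) + real K" using K[of g] by (simp add: abs_le_iff)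
      then show "g \<in> ?B (real n + real K)" using g by auto
    qed
    then have le: "card (?b n) \<le> card (?B (real n + real K))" by (rule card_mono[OF fin])
    have "\<one> \<in> ?b n" by simp
    then have "card (?b n) > 0" using finite_ball[of n] card_gt_0_iff by blast
    then have pos: "real (card (?B (real n + real K))) > 0" using le by linarith
    have "ln (card (?B (real n + real K))) < \<eta> * (real n + real K)"
      using \<rho>0[of "real n + real K"] large by (simp add: field_simps)
    then have "exp (ln (real (card (?B (real n + real K))))) \<le> exp (\<eta> * (real n + real K))" by simp
    then have "real (card (?B (real n + real K))) \<le> exp (\<eta> * (real n + real K))"
      unfolding exp_ln[OF pos] .
    also have "\<dots> = exp (\<eta> * real K) * exp (\<eta> * real n)" by (simp add: algebra_simps flip: exp_add)
    also have "\<dots> \<le> C * exp (\<eta> * real n)"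
    proof (rule mult_right_mono)
      have "exp (\<eta> * real K) \<le> exp (\<bar>\<eta>\<bar> * real K)" by (simp add: mult_right_mono)
      then show "exp (\<eta> * real K) \<le> C" by (simp add: C_def add_increasing2)
    qed simp
    finally show ?thesis using le by linarith
  next
    case False
    then have "card (?b n) \<le> card (?b n0)" by (intro card_mono finite_ball) auto
    then have "real (card (?b n)) * 1 \<le> real (card (?b n0)) * (exp (\<bar>\<eta>\<bar> * real n0) * exp (\<eta> * real n))"
    proof (intro mult_mono)
      have "\<bar>\<eta> * real n\<bar> \<le> \<bar>\<eta>\<bar> * real n0" using False by (simp add: abs_mult mult_left_mono)
      then have "0 \<le> \<bar>\<eta>\<bar> * real n0 + \<eta> * real n" by linarith
      then show "1 \<le> exp (\<bar>\<eta>\<bar> * real n0) * exp (\<eta> * real n)" by (simp flip: exp_add)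
    qed auto
    also have "\<dots> \<le> C * exp (\<eta> * real n)" by (simp add: C_def distrib_right)
    finally show ?thesis by simp
  qed
  then show False using fast[of "\<delta> - \<eta>"] \<eta>(2) by auto
qed

text \<open>The distance between the cosets is an infimum, which is approached up to 1; by equivariance it
  compares the base point with its translate by an element of the coset.\<close>

lemma coset_len_le_coset_dist:
  assumes sp: "G_space G X d \<phi>" and p: "p \<in> X" and N: "N \<lhd> G"
    and K: "\<And>g. g \<in> carrier G \<Longrightarrow> \<bar>d p (\<phi> g p) - real (len g)\<bar> \<le> real K"
    and C: "C \<in> rcosets N" "coset_dist d \<phi> p N C \<le> \<rho>"
  shows "real (coset_len C) \<le> \<rho> + 1 + real K"
proof -
  interpret sp: G_space G X d \<phi> by fact
  interpret N: normal N G by fact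
  obtain x where x: "x \<in> carrier G" "C = N #> x" using C(1) by (auto simp: RCOSETS_def)
  have "x \<in> C" using rcos_self[OF x(1) N.is_subgroup] x(2) by simp
  then have "N \<times> C \<noteq> {}" using subgroup.one_closed[OF N.is_subgroup] by blast
  moreover have "(INF (g, g')\<in>N \<times> C. d (\<phi> g p) (\<phi> g' p)) < \<rho> + 1"
    using C(2) by (simp add: coset_dist_def)
  ultimately obtain n g where n: "n \<in> N" and g: "g \<in> C" and lt: "d (\<phi> n p) (\<phi> g p) < \<rho> + 1"
    using cInf_lessD[of "(\<lambda>(g, g'). d (\<phi> g p) (\<phi> g' p)) ` (N \<times> C)" "\<rho> + 1"] by auto
  have nc: "n \<in> carrier G" using n N.subset by blast
  have gc: "g \<in> carrier G" using g x r_coset_subset_G[OF N.subset x(1)] by blast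
  obtain m where m: "m \<in> N" "g = m \<otimes> x" using g x(2) by (auto simp: r_coset_def)
  have mc: "m \<in> carrier G" using m N.subset by blast
  have "inv n \<otimes> g = (inv n \<otimes> m) \<otimes> x" using m x nc mc by (simp add: m_assoc)
  moreover have "inv n \<otimes> m \<in> N" using n m by simp
  ultimately have mem: "inv n \<otimes> g \<in> C" using x(2) by (auto simp: r_coset_def)
  have c: "inv n \<otimes> g \<in> carrier G" using nc gc by simp
  have "\<phi> g p = \<phi> n (\<phi> (inv n \<otimes> g) p)"
    using sp.composition_rule[OF p nc c] nc gc by (simp add: inv_cancel_left)
  then have "d (\<phi> n p) (\<phi> g p) = d p (\<phi> (inv n \<otimes> g) p)"
    using sp.isometric[OF nc p] sp.element_image[OF c p] by simp
  then have "real (len (inv n \<otimes> g)) \<le> \<rho> + 1 + real K" using lt K[OF c] by linarith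
  moreover have "coset_len C \<le> len (inv n \<otimes> g)" using mem by (rule coset_len_le)
  ultimately show ?thesis by linarith
qed

lemma quotient_growth_exponent_le:
  assumes sp: "G_space G X d \<phi>" and p: "p \<in> X" and N: "N \<lhd> G"
    and K: "\<And>g. g \<in> carrier G \<Longrightarrow> \<bar>d p (\<phi> g p) - real (len g)\<bar> \<le> real K"
    and \<delta>: "\<delta> \<ge> 0" and \<epsilon>: "\<epsilon> > 0"
    and slow: "\<And>n. real (card (coset_ball N n)) \<le> C * exp ((\<delta> + \<epsilon>) * real n)"
  shows "quotient_growth_exponent G N d \<phi> p \<le> ereal (\<delta> + 2 * \<epsilon>)"
  unfolding quotient_growth_exponent_def
proof (rule Limsup_bounded)
  define c where "c = ln (max C 1) + (\<delta> + \<epsilon>) * (real K + 2)"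
  have "\<forall>\<^sub>F \<rho>::real in at_top. \<rho> \<ge> max 1 (c / \<epsilon>)" by (rule eventually_ge_at_top)
  then show "\<forall>\<^sub>F \<rho>::real in at_top. ereal (1 / \<rho> * ln (card {C \<in> carrier (G Mod N). coset_dist d \<phi> p N C \<le> \<rho>}))
      \<le> ereal (\<delta> + 2 * \<epsilon>)"
  proof eventually_elim
    case (elim \<rho>)
    let ?Q = "{C \<in> carrier (G Mod N). coset_dist d \<phi> p N C \<le> \<rho>}"
    define n where "n = nat \<lceil>\<rho> + 1 + real K\<rceil>"
    have \<rho>: "\<rho> \<ge> 1" "c \<le> \<epsilon> * \<rho>" using elim \<epsilon> by (auto simp: field_simps)
    have n: "real n \<le> \<rho> + 2 + real K" unfolding n_def using \<rho>(1) by linarith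
    have "?Q \<subseteq> coset_ball N n"
    proof
      fix A assume "A \<in> ?Q"
      then have A: "A \<in> rcosets N" "coset_dist d \<phi> p N A \<le> \<rho>" by (auto simp: FactGroup_def)
      have "real (coset_len A) \<le> \<rho> + 1 + real K"
        by (rule coset_len_le_coset_dist[OF sp p N K A])
      then have "coset_len A \<le> n" unfolding n_def by linarith
      then show "A \<in> coset_ball N n" using A by simp
    qed
    then have "card ?Q \<le> card (coset_ball N n)" by (rule card_mono[OF finite_coset_ball[OF N]])
    then have "real (card ?Q) \<le> C * exp ((\<delta> + \<epsilon>) * real n)" using slow[of n] by linarith
    also have "\<dots> \<le> max C 1 * exp ((\<delta> + \<epsilon>) * (\<rho> + 2 + real K))"
      using n \<delta> \<epsilon> by (intro mult_mono) (auto intro!: mult_left_mono)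
    also have "\<dots> = exp (ln (max C 1) + (\<delta> + \<epsilon>) * (\<rho> + 2 + real K))" by (simp add: exp_add)
    also have "ln (max C 1) + (\<delta> + \<epsilon>) * (\<rho> + 2 + real K) = c + (\<delta> + \<epsilon>) * \<rho>"
      by (simp add: c_def algebra_simps)
    finally have le: "real (card ?Q) \<le> exp (c + (\<delta> + \<epsilon>) * \<rho>)" .
    have "ln (real (card ?Q)) \<le> c + (\<delta> + \<epsilon>) * \<rho>"
    proof (cases "card ?Q = 0")
      case True
      have "0 \<le> c" using \<delta> \<epsilon> by (simp add: c_def)
      then show ?thesis using True \<delta> \<epsilon> \<rho>(1) by simp
    next
      case False
      then show ?thesis using ln_mono[OF le] by simp
    qed
    also have "\<dots> \<le> (\<delta> + 2 * \<epsilon>) * \<rho>" using \<rho>(2) by (simp add: algebra_simps)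
    finally show ?case using \<rho>(1) by (simp add: field_simps)
  qed
qed

end

theorem (in cut_monoid) growth_tight_if_cut_elements:
  assumes sp: "G_space G X d \<phi>"
    and quasi: "\<And>p. p \<in> X \<Longrightarrow> \<exists>K. \<forall>g\<in>carrier G. \<bar>d p (\<phi> g p) - real (len g)\<bar> \<le> real K"
    and meets: "\<And>N. N \<lhd> G \<Longrightarrow> infinite N \<Longrightarrow> \<exists>h\<in>M. h \<in> N \<and> h \<noteq> \<one>"
  shows "growth_tight_action G X d \<phi>"
  unfolding growth_tight_action_def
proof (intro ballI allI impI, elim conjE)
  fix p N assume p: "p \<in> X" and N: "N \<lhd> G" "infinite N"
  obtain K where K: "\<And>g. g \<in> carrier G \<Longrightarrow> \<bar>d p (\<phi> g p) - real (len g)\<bar> \<le> real K"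
    using quasi[OF p] by blast
  obtain h where h: "h \<in> M" "h \<in> N" "h \<noteq> \<one>" using meets[OF N] by blast
  obtain \<delta> \<delta>' where \<delta>: "0 \<le> \<delta>" "\<delta> < \<delta>'"
    and slow: "\<And>\<epsilon>. \<epsilon> > 0 \<Longrightarrow> \<exists>C. \<forall>n. real (card (coset_ball N n)) \<le> C * exp ((\<delta> + \<epsilon>) * real n)"
    and fast: "\<And>\<epsilon>. \<epsilon> > 0 \<Longrightarrow> \<not> (\<exists>C. \<forall>n. real (card {g \<in> carrier G. len g \<le> n}) \<le> C * exp ((\<delta>' - \<epsilon>) * real n))"
    using growth_gap[OF N(1) h] by blast
  define \<epsilon> where "\<epsilon> = (\<delta>' - \<delta>) / 4"
  have \<epsilon>: "\<epsilon> > 0" using \<delta> by (simp add: \<epsilon>_def)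
  obtain C where C: "\<And>n. real (card (coset_ball N n)) \<le> C * exp ((\<delta> + \<epsilon>) * real n)"
    using slow[OF \<epsilon>] by blast
  have "quotient_growth_exponent G N d \<phi> p \<le> ereal (\<delta> + 2 * \<epsilon>)"
    by (rule quotient_growth_exponent_le[OF sp p N(1) K \<delta>(1) \<epsilon> C])
  also have "\<dots> < ereal \<delta>'" using \<delta> by (simp add: \<epsilon>_def field_simps)
  also have "\<dots> \<le> growth_exponent G d \<phi> p"
    by (rule growth_exponent_ge[where d = d and p = p and \<phi> = \<phi> and K = K and \<delta> = \<delta>', OF K fast])
  finally show "quotient_growth_exponent G N d \<phi> p < growth_exponent G d \<phi> p" .
qed

lemma (in snowflake_presentation) countable_carrier: "countable (carrier G)"
proof -
  have "(UNIV :: bb_gen set) = {GenA, GenB, GenS, GenT}"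
    using bb_gen.exhaust by auto
  then have "finite (UNIV :: bb_gen set)" by (metis finite.emptyI finite.insertI)
  then have "finite (UNIV :: (bb_gen \<times> bool) set)"
    by (simp add: finite_prod)
  then have "countable (lists (UNIV :: (bb_gen \<times> bool) set))"
    by (intro countable_lists countable_finite)
  then show ?thesis unfolding carrier_cls by (simp add: lists_UNIV)
qed

theorem theorem11p1:
  fixes r :: nat
  assumes "r \<ge> 3"
  shows "\<exists>(X :: real set) d \<phi>.
    G_space (snowflake_group r) X d \<phi> \<and>
    cocompact_action (snowflake_group r) X d \<phi> \<and>
    growth_tight_action (snowflake_group r) X d \<phi>"
proof -
  interpret P: snowflake_presentation r "snowflake_group r"
    by unfold_locales (use assms in auto)
  obtain idx :: "bb_gen word set \<Rightarrow> nat" where "inj_on idx (carrier (snowflake_group r))"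
    using P.countable_carrier by (auto simp: countable_def)
  then interpret C: cayley_graph "snowflake_group r" P.gen_set idx
    by unfold_locales
  have "growth_tight_action (snowflake_group r) C.X C.dX C.actX"
  proof (rule P.growth_tight_if_cut_elements[OF C.G_space_X C.orbit_dist])
    fix N assume N: "N \<lhd> snowflake_group r" "infinite N"
    have "\<not> N \<subseteq> {\<one>\<^bsub>snowflake_group r\<^esub>}" using N(2) finite_subset by blast
    then obtain n where "n \<in> N" "n \<noteq> \<one>\<^bsub>snowflake_group r\<^esub>" by blast
    then show "\<exists>h\<in>P.cut_elements. h \<in> N \<and> h \<noteq> \<one>\<^bsub>snowflake_group r\<^esub>"
      using P.normal_meets_cut_elements[OF N(1)] by blast
  qed
  then show ?thesis using C.G_space_X C.cocompact_X by blast
qed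

end
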